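(* Let $G$ be a finite cyclic group and let $S$ be a Schur ring over $\mathbb{Q}[G]$. Then for every subgroup $H\le G$ with $\overline{H}\in S$, the element $\varepsilon(S,H)$ is a primitive idempotent of $S$. In particular, $\{\varepsilon(S,H)\mid H\le G,\ \overline{H}\in S\}$ is a complete set of primitive idempotents in $S$.
   Context: For a finite group $G$, a field $F$ and $A\subseteq G$, write $\overline{A}=\sum_{g\in A}g\in F[G]$. A Schur ring over $F[G]$ (or over $G$) is a subspace $S=\mathrm{Span}_F\{\overline{C_1},\dots,\overline{C_r}\}$ of $F[G]$, where $\{C_1,\dots,C_r\}$ is a partition of $G$ with $C_1=\{1\}$, such that for each $i$ there is $j$ with $C_i^{-1}=C_j$, and for all $i,j$ the product $\overline{C_i}\,\overline{C_j}$ is an $F$-linear combination of the $\overline{C_k}$. For $H\le G$ put $\widehat{H}=\frac{1}{|H|}\overline{H}$. The set $\mathcal{L}$ of all normal subgroups $H$ of $G$ with $\overline{H}\in S$ is closed under joins (products) and intersections and contains $1$ and $G$. For $H,K\in\mathcal{L}$, $K$ covers $H$ in $\mathcal{L}$ if $H<K$ and the only $L\in\mathcal{L}$ with $H\le L\le K$ are $H$ and $K$; $\mathcal{M}(\mathcal{L},H)$ is the set of covers of $H$ in $\mathcal{L}$. Define $$\varepsilon(S,H)=\prod_{M\in\mathcal{M}(\mathcal{L},H)}(\widehat{H}-\widehat{M})\quad (H\in\mathcal{L},\ H\ne G),\qquad \varepsilon(S,G)=\widehat{G}.$$ A (central) idempotent is primitive if it is nonzero and is not a sum of two nonzero (central)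 idempotents; here $S$ is commutative. A complete set of primitive idempotents of $S$ is the set of all primitive idempotents of $S$ (these are pairwise orthogonal with sum $1$). *)

theory Defs
  imports "HOL-Algebra.Algebra" "HOL-Library.Disjoint_Sets"
begin

text \<open>
  Elements of \<open>F[G]\<close>, \<open>G\<close> a finite group, are coefficient functions vanishing off
  the carrier of \<open>G\<close>; multiplication is convolution. The coefficient field \<open>F\<close> is a type
  of class \<open>field\<close>.
\<close>

definition group_algebra :: "('a, 'b) monoid_scheme \<Rightarrow> ('a \<Rightarrow> 'f::field) ring" where
  "group_algebra G =
     \<lparr>carrier = {u. \<forall>x. x \<notin> carrier G \<longrightarrow> u x = 0},
      monoid.mult = (\<lambda>u v x. \<Sum>y\<in>carrier G. \<Sum>z\<in>carrier G. if y \<otimes>\<^bsub>G\<^esub> z = x then u y * v z else 0),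
      monoid.one = (\<lambda>x. if x = \<one>\<^bsub>G\<^esub> then 1 else 0),
      ring.zero = (\<lambda>x. 0),
      ring.add = (\<lambda>u v x. u x + v x)\<rparr>"

definition group_elem :: "'a \<Rightarrow> 'a \<Rightarrow> 'f::field" where
  "group_elem g = (\<lambda>x. if x = g then 1 else 0)"

definition set_sum :: "'a set \<Rightarrow> 'a \<Rightarrow> 'f::field" where
  "set_sum A = (\<lambda>x. \<Sum>g\<in>A. group_elem g x)"

definition set_sum_span :: "'a set set \<Rightarrow> ('a \<Rightarrow> 'f::field) set" where
  "set_sum_span P = {u. \<exists>c. u = (\<lambda>x. \<Sum>C\<in>P. c C * set_sum C x)}"

definition schur_ring :: "('a, 'b) monoid_scheme \<Rightarrow> ('a \<Rightarrow> 'f::field) set \<Rightarrow> bool" where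
  "schur_ring G S \<longleftrightarrow>
     (\<exists>P. partition_on (carrier G) P \<and>
          {\<one>\<^bsub>G\<^esub>} \<in> P \<and>
          (\<forall>C\<in>P. set_inv\<^bsub>G\<^esub> C \<in> P) \<and>
          (\<forall>C\<in>P. \<forall>D\<in>P. set_sum C \<otimes>\<^bsub>group_algebra G\<^esub> set_sum D
                         \<in> (set_sum_span P :: ('a \<Rightarrow> 'f) set)) \<and>
          S = set_sum_span P)"

text \<open>Meaningful when the order of \<open>H\<close> is nonzero in the coefficient field, as it is over \<open>\<rat>\<close>.\<close>

definition hat :: "'a set \<Rightarrow> 'a \<Rightarrow> 'f::field" where
  "hat H = (\<lambda>x. 1 / of_nat (card H) * set_sum H x)"

definition schur_lattice :: "('a, 'b) monoid_scheme \<Rightarrow> ('a \<Rightarrow> 'f::field) set \<Rightarrow> 'a set set" where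
  "schur_lattice G S = {H. H \<lhd> G \<and> set_sum H \<in> S}"

definition covers :: "'a set set \<Rightarrow> 'a set \<Rightarrow> 'a set set" where
  "covers \<L> H = {K \<in> \<L>. H \<subset> K \<and> (\<forall>L\<in>\<L>. H \<subseteq> L \<and> L \<subseteq> K \<longrightarrow> L = H \<or> L = K)}"

definition schur_eps ::
  "('a, 'b) monoid_scheme \<Rightarrow> ('a \<Rightarrow> 'f::field) set \<Rightarrow> 'a set \<Rightarrow> 'a \<Rightarrow> 'f" where
  "schur_eps G S H =
     (if H = carrier G then hat (carrier G)
      else \<Otimes>\<^bsub>group_algebra G\<^esub>M\<in>covers (schur_lattice G S) H. (hat H \<ominus>\<^bsub>group_algebra G\<^esub> hat M))"

definition idempotents :: "('r, 'm) ring_scheme \<Rightarrow> 'r set" where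
  "idempotents R = {e \<in> carrier R. e \<otimes>\<^bsub>R\<^esub> e = e}"

text \<open>Intended for commutative \<open>R\<close>, where every idempotent is central.\<close>

definition primitive_idempotent :: "('r, 'm) ring_scheme \<Rightarrow> 'r \<Rightarrow> bool" where
  "primitive_idempotent R e \<longleftrightarrow>
     e \<in> idempotents R \<and> e \<noteq> \<zero>\<^bsub>R\<^esub> \<and>
     \<not> (\<exists>f\<in>idempotents R. \<exists>g\<in>idempotents R. f \<noteq> \<zero>\<^bsub>R\<^esub> \<and> g \<noteq> \<zero>\<^bsub>R\<^esub> \<and> e = f \<oplus>\<^bsub>R\<^esub> g)"

definition complete_set_of_primitive_idempotents :: "('r, 'm) ring_scheme \<Rightarrow> 'r set \<Rightarrow> bool" where
  "complete_set_of_primitive_idempotents R E \<longleftrightarrow> E = {e. primitive_idempotent R e}"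

end

theory Submission
  imports Defs "HOL-Computational_Algebra.Polynomial"
begin

text \<open>
  An idempotent of \<open>\<rat>[G]\<close> is fixed by \<open>x \<mapsto> x\<^sup>p\<close> for every prime \<open>p\<close> dividing neither the order of \<open>G\<close>
  nor a common denominator, because the Frobenius map makes it congruent modulo \<open>p\<close> to its image and
  congruent idempotents are equal. Hence it has equal coefficients at elements generating the same
  subgroup, and the idempotents of \<open>S\<close> lie in the rational Schur ring of all elements of \<open>S\<close> with this
  property. By a theorem of Muzychuk a rational Schur ring over a cyclic group is spanned by the
  sums of its subgroups; the point is that a basic set generating \<open>G\<close> contains a generator of \<open>G\<close>,
  which follows by induction on the order of \<open>G\<close> from Schur's observation that \<open>p\<close>-th powers of sets
  of the Schur ring, counted modulo \<open>p\<close>, are again such sets.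

  So every idempotent of \<open>S\<close> is a combination of the \<open>hat K\<close>, \<open>K\<close> in the lattice. The product of \<open>hat K\<close>
  with \<open>\<epsilon>(S,H)\<close> is \<open>\<epsilon>(S,H)\<close> if \<open>K \<subseteq> H\<close> and \<open>0\<close> otherwise, so multiplication by \<open>\<epsilon>(S,H)\<close> maps this
  span onto the line of \<open>\<epsilon>(S,H)\<close>, which is nonzero by the linear independence of the \<open>hat K\<close>.
\<close>

hide_const (open) Divisibility.prime UnivPoly.monom UnivPoly.coeff Polynomials.degree

section \<open>Cyclic convolution\<close>

text \<open>Congruences need integers, so an idempotent \<open>e\<close> is replaced by an integral
  multiple \<open>f = D e\<close>, which satisfies \<open>f f = D f\<close>. A unit modulo
  \<open>n\<close> may share primes with \<open>D\<close>; it is first moved within its residue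
  class to avoid them.

  The obstacle in Muzychuk's theorem is a prime \<open>p\<close> that divides \<open>n\<close>.
  Multiplication by \<open>p\<close> is then not injective, and the Frobenius congruence only tells
  which elements have a number of \<open>p\<close>-th roots in a given set that is prime to
  \<open>p\<close>. In a rational Schur ring this is still manageable: a coset of the subgroup of
  order \<open>p\<close> either lies in one class or consists of one special element and
  \<open>p - 1\<close> equivalent ones. If the resulting set is empty, the class is a union of
  cosets and can be studied in a proper quotient. Otherwise the set generates a subgroup of the
  Schur ring whose order is prime to \<open>p\<close>, and this is played off against a minimal
  subgroup of order divisible by \<open>p\<close>.

  A class that does not generate Z/n is treated inside the subgroup that it generates; there it
  contains a generator, which makes the passage from functions to subgroups triangular.\<close>

definition conv :: "int \<Rightarrow> (int \<Rightarrow> 'a::comm_ring_1) \<Rightarrow> (int \<Rightarrow> 'a) \<Rightarrow> int \<Rightarrow> 'a" where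
  "conv n f g x = (\<Sum>y\<in>{0..<n}. f y * g (x - y))"

text \<open>An \<open>n\<close>-periodic function on the integers stands for a function on Z/n.
  Quotients and subgroups of Z/n then change only \<open>n\<close> and never the type, as the
  induction on \<open>n\<close> requires.\<close>

definition periodic :: "int \<Rightarrow> (int \<Rightarrow> 'a) \<Rightarrow> bool" where
  "periodic n f \<longleftrightarrow> (\<forall>x y. n dvd x - y \<longrightarrow> f x = f y)"

lemma periodicD: "periodic n f \<Longrightarrow> n dvd x - y \<Longrightarrow> f x = f y"
  by (auto simp: periodic_def)

lemma periodic_mod: "periodic n f \<Longrightarrow> f (x mod n) = f x"
  by (rule periodicD[of n f]) (simp_all add: mod_eq_dvd_iff[symmetric])

lemma dvd_diff_0_less_eq:
  fixes n :: int
  assumes "n dvd x - y" "x \<in> {0..<n}" "y \<in> {0..<n}"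
  shows "x = y"
  using assms by (metis atLeastLessThan_iff mod_eq_dvd_iff mod_pos_pos_trivial)

lemma bij_betw_affine_mod:
  fixes n :: int
  assumes "n > 0" "coprime u n"
  shows "bij_betw (\<lambda>y. (a + u * y) mod n) {0..<n} {0..<n}"
proof -
  have "inj_on (\<lambda>y. (a + u * y) mod n) {0..<n}"
  proof (rule inj_onI)
    fix x y assume xy: "x \<in> {0..<n}" "y \<in> {0..<n}" and eq: "(a + u * x) mod n = (a + u * y) mod n"
    have "n dvd u * (x - y)"
      using eq by (simp add: mod_eq_dvd_iff algebra_simps)
    then have "n dvd x - y"
      using assms(2) by (simp add: coprime_commute coprime_dvd_mult_right_iff)
    then show "x = y" using xy by (rule dvd_diff_0_less_eq)
  qed
  moreover have "(\<lambda>y. (a + u * y) mod n) ` {0..<n} \<subseteq> {0..<n}"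
    using assms by auto
  ultimately show ?thesis
    by (simp add: bij_betw_def endo_inj_surj)
qed

lemma sum_periodic_affine:
  fixes f :: "int \<Rightarrow> 'a::comm_monoid_add"
  assumes "n > 0" "periodic n f" "coprime u n"
  shows "(\<Sum>y\<in>{0..<n}. f (a + u * y)) = (\<Sum>y\<in>{0..<n}. f y)"
proof -
  have "(\<Sum>y\<in>{0..<n}. f (a + u * y)) = (\<Sum>y\<in>{0..<n}. f ((a + u * y) mod n))"
    by (simp add: periodic_mod[OF assms(2)])
  also have "\<dots> = (\<Sum>y\<in>{0..<n}. f y)"
    by (rule sum.reindex_bij_betw[OF bij_betw_affine_mod]) (use assms in auto)
  finally show ?thesis .
qed

lemma sum_periodic_reflect:
  fixes f :: "int \<Rightarrow> 'a::comm_monoid_add"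
  assumes "n > 0" "periodic n f"
  shows "(\<Sum>y\<in>{0..<n}. f (a - y)) = (\<Sum>y\<in>{0..<n}. f y)"
  using sum_periodic_affine[of n f "-1" a] assms by simp

lemma sum_periodic_shift:
  fixes f :: "int \<Rightarrow> 'a::comm_monoid_add"
  assumes "n > 0" "periodic n f"
  shows "(\<Sum>y\<in>{0..<n}. f (y + a)) = (\<Sum>y\<in>{0..<n}. f y)"
  using sum_periodic_affine[of n f 1 a] assms by (simp add: add.commute)

lemma periodic_conv:
  assumes "periodic n g"
  shows "periodic n (conv n f g)"
  unfolding periodic_def conv_def
proof (intro allI impI sum.cong refl arg_cong2[of _ _ _ _ "(*)"])
  fix x y z :: int assume "n dvd x - y"
  then show "g (x - z) = g (y - z)"
    by (intro periodicD[OF assms]) simp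
qed

lemma periodic_mult_reflect:
  assumes "periodic n f" "periodic n g"
  shows "periodic n (\<lambda>y. f y * g (x - y))"
  unfolding periodic_def
proof (intro allI impI arg_cong2[of _ _ _ _ "(*)"])
  fix y z assume yz: "n dvd y - z"
  show "f y = f z" using yz by (rule periodicD[OF assms(1)])
  have "(x - y) - (x - z) = - (y - z)" by simp
  then show "g (x - y) = g (x - z)"
    by (metis periodicD[OF assms(2)] dvd_minus_iff yz)
qed

lemma conv_commute:
  assumes "n > 0" "periodic n f" "periodic n g"
  shows "conv n f g = conv n g f"
proof
  fix x
  have "conv n f g x = (\<Sum>y\<in>{0..<n}. f (x - y) * g (x - (x - y)))"
    unfolding conv_def
    using sum_periodic_reflect[OF assms(1) periodic_mult_reflect[OF assms(2,3)], of x x] by simp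
  then show "conv n f g x = conv n g f x"
    by (simp add: conv_def mult.commute)
qed

lemma conv_assoc:
  assumes "n > 0" "periodic n f" "periodic n g" "periodic n h"
  shows "conv n (conv n f g) h = conv n f (conv n g h)"
proof
  fix x
  have "conv n (conv n f g) h x = (\<Sum>w\<in>{0..<n}. \<Sum>y\<in>{0..<n}. f y * (g (w - y) * h (x - w)))"
    by (simp add: conv_def sum_distrib_right mult.assoc)
  also have "\<dots> = (\<Sum>y\<in>{0..<n}. \<Sum>w\<in>{0..<n}. f y * (g (w - y) * h (x - w)))"
    by (rule sum.swap)
  also have "\<dots> = (\<Sum>y\<in>{0..<n}. f y * conv n g h (x - y))"
  proof (rule sum.cong[OF refl])
    fix y
    have "(\<Sum>w\<in>{0..<n}. g (w - y) * h (x - w))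
        = (\<Sum>w\<in>{0..<n}. g (w + (- y)) * h ((x - y) - (w + (- y))))"
      by simp
    also have "\<dots> = conv n g h (x - y)"
      unfolding conv_def
      by (rule sum_periodic_shift[OF assms(1) periodic_mult_reflect[OF assms(3,4)]])
    finally show "(\<Sum>w\<in>{0..<n}. f y * (g (w - y) * h (x - w))) = f y * conv n g h (x - y)"
      by (simp add: sum_distrib_left[symmetric])
  qed
  finally show "conv n (conv n f g) h x = conv n f (conv n g h) x"
    by (simp add: conv_def)
qed

text \<open>Multiplication by a unit is an automorphism of Z/n and so induces a ring automorphism of
  the group ring. This is the action that will turn out to fix idempotents.\<close>

lemma conv_dilate:
  assumes "n > 0" "periodic n f" "periodic n g" "coprime u n"
  shows "conv n f g (u * x) = conv n (\<lambda>y. f (u * y)) (\<lambda>y. g (u * y)) x"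
proof -
  have "conv n f g (u * x) = (\<Sum>y\<in>{0..<n}. f (u * y) * g (u * x - u * y))"
    unfolding conv_def
    using sum_periodic_affine[OF assms(1) periodic_mult_reflect[OF assms(2,3)] assms(4), of 0 "u * x"]
    by simp
  then show ?thesis by (simp add: conv_def right_diff_distrib)
qed

lemma periodic_dilate:
  assumes "periodic n f"
  shows "periodic n (\<lambda>y. f (u * y))"
  unfolding periodic_def
proof (intro allI impI)
  fix x y assume "n dvd x - y"
  then have "n dvd u * x - u * y"
    by (simp flip: right_diff_distrib)
  then show "f (u * x) = f (u * y)" by (rule periodicD[OF assms])
qed

lemma conv_diff_left: "conv n (\<lambda>x. f x - g x) h = (\<lambda>x. conv n f h x - conv n g h x)"
  by (auto simp: conv_def left_diff_distrib sum_subtractf)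

lemma conv_diff_right: "conv n h (\<lambda>x. f x - g x) = (\<lambda>x. conv n h f x - conv n h g x)"
  by (auto simp: conv_def right_diff_distrib sum_subtractf)

lemma conv_scale_left: "conv n (\<lambda>x. c * f x) g = (\<lambda>x. c * conv n f g x)"
  by (auto simp: conv_def sum_distrib_left mult_ac)

lemma conv_scale_right: "conv n f (\<lambda>x. c * g x) = (\<lambda>x. c * conv n f g x)"
  by (auto simp: conv_def sum_distrib_left mult_ac)

primrec conv_power :: "int \<Rightarrow> (int \<Rightarrow> 'a::comm_ring_1) \<Rightarrow> nat \<Rightarrow> int \<Rightarrow> 'a" where
  "conv_power n f 0 = (\<lambda>x. if n dvd x then 1 else 0)"
| "conv_power n f (Suc k) = conv n f (conv_power n f k)"

lemma periodic_unit: "periodic n (\<lambda>x. if n dvd x then 1 else 0)"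
  unfolding periodic_def by (metis diff_add_cancel dvd_add_right_iff)

lemma periodic_conv_power: "periodic n (conv_power n f k)"
  by (induction k) (simp_all add: periodic_unit periodic_conv)

lemma conv_unit_right:
  assumes "n > 0" "periodic n f"
  shows "conv n f (\<lambda>x. if n dvd x then 1 else 0) = f"
proof
  fix x
  have *: "n dvd x - y \<longleftrightarrow> y = x mod n" if "y \<in> {0..<n}" for y
    using that assms(1) by (metis atLeastLessThan_iff mod_eq_dvd_iff mod_pos_pos_trivial)
  have "conv n f (\<lambda>x. if n dvd x then 1 else 0) x = (\<Sum>y\<in>{0..<n}. if y = x mod n then f y else 0)"
    unfolding conv_def by (rule sum.cong) (auto simp: *)
  also have "\<dots> = f (x mod n)" using assms(1) by simp
  also have "\<dots> = f x" by (rule periodic_mod[OF assms(2)])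
  finally show "conv n f (\<lambda>x. if n dvd x then 1 else 0) x = f x" .
qed

lemma conv_power_one:
  assumes "n > 0" "periodic n f"
  shows "conv_power n f 1 = f"
  using conv_unit_right[OF assms] by simp

section \<open>Frobenius for cyclic convolution\<close>

lemma prime_dvd_power_add_diff:
  fixes a b :: "'a::comm_ring_1"
  assumes "prime p"
  shows "of_nat p dvd (a + b) ^ p - (a ^ p + b ^ p)"
proof -
  have p: "p > 1" using assms by (rule prime_gt_1_nat)
  have "(a + b) ^ p = (\<Sum>k\<le>p. of_nat (p choose k) * a ^ k * b ^ (p - k))"
    by (rule binomial_ring)
  also have "{..p} = insert 0 (insert p {1..<p})" using p by auto
  also have "(\<Sum>k\<in>\<dots>. of_nat (p choose k) * a ^ k * b ^ (p - k))
     = a ^ p + b ^ p + (\<Sum>k\<in>{1..<p}. of_nat (p choose k) * a ^ k * b ^ (p - k))"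
    using p by simp
  finally have eq: "(a + b) ^ p - (a ^ p + b ^ p)
      = (\<Sum>k\<in>{1..<p}. of_nat (p choose k) * a ^ k * b ^ (p - k))" by simp
  have dvd: "of_nat p dvd (of_nat (p choose k) * a ^ k * b ^ (p - k) :: 'a)" if "k \<in> {1..<p}" for k
  proof -
    have "p dvd p choose k"
      using that assms by (intro dvd_choose_prime) auto
    then have "(of_nat p :: 'a) dvd of_nat (p choose k)" by (metis dvd_def of_nat_mult)
    then show ?thesis by (simp add: dvd_mult2)
  qed
  show ?thesis unfolding eq by (rule dvd_sum) (rule dvd)
qed

text \<open>Stated for any commutative ring because it serves both for integer polynomials
  (Frobenius) and for integers (Fermat).\<close>

lemma prime_dvd_power_sum_diff:
  fixes f :: "'b \<Rightarrow> 'a::comm_ring_1"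
  assumes "prime p" "finite A"
  shows "of_nat p dvd (\<Sum>x\<in>A. f x) ^ p - (\<Sum>x\<in>A. f x ^ p)"
  using assms(2)
proof (induction A rule: finite_induct)
  case empty
  then show ?case using assms(1) by (simp add: power_0_left prime_gt_0_nat)
next
  case (insert x A)
  have "(\<Sum>x\<in>insert x A. f x) ^ p - (\<Sum>x\<in>insert x A. f x ^ p)
     = ((f x + (\<Sum>x\<in>A. f x)) ^ p - (f x ^ p + (\<Sum>x\<in>A. f x) ^ p))
       + ((\<Sum>x\<in>A. f x) ^ p - (\<Sum>x\<in>A. f x ^ p))"
    using insert by simp
  then show ?case
    using prime_dvd_power_add_diff[OF assms(1)] insert.IH by (metis dvd_add)
qed

text \<open>The image of a polynomial in the group ring \<open>\<int>[t]/(t\<^sup>n - 1)\<close>, as a function of the exponent.\<close>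

definition fold_poly :: "int \<Rightarrow> int poly \<Rightarrow> int \<Rightarrow> int" where
  "fold_poly n q x = (\<Sum>i\<le>degree q. if n dvd x - int i then coeff q i else 0)"

lemma fold_poly_bound:
  assumes "degree q \<le> N"
  shows "fold_poly n q x = (\<Sum>i\<le>N. if n dvd x - int i then coeff q i else 0)"
  unfolding fold_poly_def
  by (rule sum.mono_neutral_left) (use assms in \<open>auto simp: coeff_eq_0\<close>)

lemma fold_poly_add: "fold_poly n (q + r) x = fold_poly n q x + fold_poly n r x"
proof -
  define N where "N = max (degree q) (degree r)"
  have deg: "degree q \<le> N" "degree r \<le> N" "degree (q + r) \<le> N"
    by (auto simp: N_def degree_add_le)
  show ?thesis
    unfolding deg[THEN fold_poly_bound] sum.distrib[symmetric] by (intro sum.cong) auto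
qed

lemma fold_poly_0: "fold_poly n 0 x = 0"
  unfolding fold_poly_def by (rule sum.neutral) simp

lemma fold_poly_sum: "fold_poly n (\<Sum>i\<in>A. q i) x = (\<Sum>i\<in>A. fold_poly n (q i) x)"
  by (induction A rule: infinite_finite_induct) (auto simp: fold_poly_0 fold_poly_add)

lemma fold_poly_of_nat_mult: "fold_poly n (of_nat p * q) x = int p * fold_poly n q x"
  by (induction p) (simp_all add: fold_poly_0 fold_poly_add ring_distribs)

lemma fold_poly_monom: "fold_poly n (monom c k) x = (if n dvd x - int k then c else 0)"
proof -
  have "fold_poly n (monom c k) x = (\<Sum>i\<le>k. if n dvd x - int i then coeff (monom c k) i else 0)"
    by (rule fold_poly_bound) (rule degree_monom_le)
  also have "\<dots> = (\<Sum>i\<le>k. if i = k then (if n dvd x - int k then c else 0) else 0)"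
    by (rule sum.cong) auto
  finally show ?thesis by simp
qed

lemma fold_poly_monom_mult: "fold_poly n (monom c k * q) x = c * fold_poly n q (x - int k)"
proof -
  have "monom c k * q = monom c k * (\<Sum>i\<le>degree q. monom (coeff q i) i)"
    by (simp add: poly_as_sum_of_monoms)
  also have "\<dots> = (\<Sum>i\<le>degree q. monom (c * coeff q i) (k + i))"
    by (simp add: sum_distrib_left mult_monom)
  finally have "fold_poly n (monom c k * q) x
      = (\<Sum>i\<le>degree q. if n dvd x - int (k + i) then c * coeff q i else 0)"
    by (simp only: fold_poly_sum fold_poly_monom)
  then show ?thesis
    by (simp add: fold_poly_def sum_distrib_left if_distrib[of "(*) c"] algebra_simps cong: if_cong)
qed

lemma conv_power_eq_fold_poly:
  fixes f :: "int \<Rightarrow> int"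
  shows "conv_power n f k x = fold_poly n ((\<Sum>y\<in>{0..<n}. monom (f y) (nat y)) ^ k) x"
proof (induction k arbitrary: x)
  case 0
  have "fold_poly n (monom 1 0) x = (if n dvd x then 1 else 0)"
    by (simp only: fold_poly_monom) simp
  then show ?case by simp
next
  case (Suc k)
  let ?F = "\<Sum>y\<in>{0..<n}. monom (f y) (nat y)"
  have "fold_poly n (?F ^ Suc k) x = (\<Sum>y\<in>{0..<n}. fold_poly n (monom (f y) (nat y) * ?F ^ k) x)"
    by (simp add: sum_distrib_right fold_poly_sum)
  also have "\<dots> = (\<Sum>y\<in>{0..<n}. f y * conv_power n f k (x - y))"
    by (rule sum.cong) (auto simp: fold_poly_monom_mult Suc)
  finally show ?case by (simp add: conv_def)
qed

text \<open>The binomial congruence holds in \<open>int poly\<close>, and \<open>fold_poly\<close>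
  carries it to the group ring of Z/n, where the \<open>p\<close>-th power of a monomial at
  \<open>y\<close> sits at the residue \<open>p y\<close>.\<close>

lemma conv_power_prime:
  fixes f :: "int \<Rightarrow> int"
  assumes "prime p"
  shows "int p dvd conv_power n f p x - (\<Sum>y\<in>{0..<n}. if n dvd x - int p * y then f y ^ p else 0)"
proof -
  let ?F = "\<Sum>y\<in>{0..<n}. monom (f y) (nat y)" and ?G = "\<Sum>y\<in>{0..<n}. monom (f y) (nat y) ^ p"
  obtain Q where "?F ^ p - ?G = of_nat p * Q"
    using prime_dvd_power_sum_diff[OF assms, of "{0..<n}" "\<lambda>y. monom (f y) (nat y)"] by (auto elim: dvdE)
  then have "?F ^ p = ?G + of_nat p * Q" by (simp add: algebra_simps)
  then have "conv_power n f p x = fold_poly n ?G x + int p * fold_poly n Q x"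
    by (simp only: conv_power_eq_fold_poly fold_poly_add fold_poly_of_nat_mult)
  moreover have "fold_poly n ?G x = (\<Sum>y\<in>{0..<n}. if n dvd x - int p * y then f y ^ p else 0)"
    unfolding fold_poly_sum by (rule sum.cong) (auto simp: monom_power fold_poly_monom mult.commute)
  ultimately show ?thesis by simp
qed

lemma int_subgroup_multiples:
  fixes n :: int
  assumes n: "n \<in> A" "n > 0" and add: "\<And>x y. x \<in> A \<Longrightarrow> y \<in> A \<Longrightarrow> x + y \<in> A"
    and neg: "\<And>x. x \<in> A \<Longrightarrow> - x \<in> A"
  obtains m where "m > 0" "m dvd n" "A = {x. m dvd x}"
proof -
  have zero: "0 \<in> A" using add[OF n(1) neg[OF n(1)]] by simp
  have nat_mult: "int k * x \<in> A" if "x \<in> A" for k x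
    by (induction k) (use zero in \<open>auto simp: distrib_right intro: add that\<close>)
  have mult: "k * x \<in> A" if "x \<in> A" for k x
    using nat_mult[OF that, of "nat k"] nat_mult[OF neg[OF that], of "nat (- k)"]
    by (cases "k \<ge> 0") auto
  have gcd: "gcd x y \<in> A" if xy: "x \<in> A" "y \<in> A" for x y
  proof -
    obtain u v where "u * x + v * y = gcd x y" using bezout_int by blast
    then show ?thesis using add[OF mult[OF xy(1), of u] mult[OF xy(2), of v]] by simp
  qed
  define m where "m = int (LEAST k. k > 0 \<and> int k \<in> A)"
  have ex: "nat n > 0 \<and> int (nat n) \<in> A" using n by simp
  have m: "m > 0" "m \<in> A" using LeastI[of "\<lambda>k. k > 0 \<and> int k \<in> A", OF ex] by (simp_all add: m_def)
  have least: "m \<le> k" if "k > 0" "k \<in> A" for k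
    using Least_le[of "\<lambda>k. k > 0 \<and> int k \<in> A" "nat k"] that by (simp add: m_def)
  have dvd: "m dvd x" if "x \<in> A" for x
  proof -
    have "m \<le> gcd m x" using m that by (intro least gcd) auto
    moreover have "gcd m x \<le> m" using m by (intro zdvd_imp_le) auto
    ultimately show ?thesis by (metis gcd_dvd2 order_antisym)
  qed
  have "A = {x. m dvd x}"
    using dvd mult[OF m(2)] by (auto simp: dvd_def mult.commute)
  then show ?thesis using m dvd[OF n(1)] by (intro that)
qed

section \<open>Rationality of idempotents\<close>

lemma int_prime_dvd_power_diff:
  fixes a :: int
  assumes "prime p"
  shows "int p dvd a ^ p - a"
proof -
  have p: "p > 0" using assms by (rule prime_gt_0_nat)
  \<comment> \<open>Fermat's little theorem is the binomial congruence for a sum of \<open>c\<close>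
    ones.\<close>
  have nat_case: "int p dvd int c ^ p - int c" for c :: nat
    using prime_dvd_power_sum_diff[OF assms, of "{..<c}" "\<lambda>_. 1 :: int"] by simp
  define c where "c = nat (a mod int p)"
  have c: "int c = a mod int p" using p by (simp add: c_def)
  have "a ^ p mod int p = int c ^ p mod int p" by (simp add: c power_mod)
  moreover have "a mod int p = int c mod int p" by (simp add: c)
  ultimately have "(a ^ p - a) mod int p = (int c ^ p - int c) mod int p"
    by (metis mod_diff_cong)
  then show ?thesis using nat_case[of c] by (simp add: dvd_eq_mod_eq_0)
qed

lemma int_eq_0_of_prime_powers_dvd:
  fixes a :: int
  assumes "prime p" "\<And>j. int p ^ Suc j dvd a"
  shows "a = 0"
proof (rule ccontr)
  assume "a \<noteq> 0"
  define j where "j = nat \<bar>a\<bar>"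
  have "int p ^ Suc j \<le> \<bar>a\<bar>"
    using assms(2)[of j] \<open>a \<noteq> 0\<close> by (meson dvd_imp_le_int abs_ge_zero dual_order.trans dvd_abs_iff zdvd_imp_le zero_less_abs_iff)
  moreover have "j < p ^ Suc j"
    using power_gt_expt[of p "Suc j"] prime_gt_1_nat[OF assms(1)] by linarith
  then have "\<bar>a\<bar> < int p ^ Suc j"
    unfolding j_def by (metis nat_less_iff abs_ge_zero of_nat_power)
  ultimately show False by simp
qed

lemma conv_dvd:
  fixes f g :: "int \<Rightarrow> int"
  assumes "\<And>x. a dvd f x" "\<And>x. b dvd g x"
  shows "a * b dvd conv n f g x"
  unfolding conv_def by (intro dvd_sum mult_dvd_mono assms)

text \<open>The hypothesis is what idempotency of \<open>e\<close> becomes for the integral function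
  \<open>f = D e\<close>.\<close>

lemma conv_power_of_quasi_idempotent:
  assumes "n > 0" "periodic n f" "conv n f f = (\<lambda>x. D * f x)"
  shows "conv_power n f (Suc k) = (\<lambda>x. D ^ k * f x)"
proof (induction k)
  case 0
  then show ?case using conv_power_one[OF assms(1,2)] by simp
next
  case (Suc k)
  have "conv_power n f (Suc (Suc k)) = conv n f (\<lambda>x. D ^ k * f x)"
    using Suc by simp
  then show ?case by (simp only: conv_scale_right assms(3)) (simp add: mult_ac)
qed

text \<open>The \<open>p\<close>-th power of \<open>f\<close> has at \<open>p x\<close> the
  coefficient \<open>D^(p-1) f(p x)\<close> by the quadratic relation, and a coefficient congruent
  to \<open>f(x)^p\<close> by Frobenius, as \<open>p\<close> is invertible modulo \<open>n\<close>.
  Fermat removes the exponents and \<open>D\<close> cancels.\<close>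

lemma quasi_idempotent_dilate_cong:
  fixes f :: "int \<Rightarrow> int"
  assumes n: "n > 0" and f: "periodic n f" and idem: "conv n f f = (\<lambda>x. D * f x)"
    and p: "prime p" "\<not> int p dvd n" "\<not> int p dvd D"
  shows "int p dvd f (int p * x) - f x"
proof -
  have cop: "coprime (int p) n" using p by (simp add: prime_imp_coprime)
  have p0: "p > 0" using p by (simp add: prime_gt_0_nat)
  have "(\<Sum>y\<in>{0..<n}. if n dvd int p * x - int p * y then f y ^ p else 0)
     = (\<Sum>y\<in>{0..<n}. if y = x mod n then f y ^ p else 0)"
  proof (rule sum.cong[OF refl])
    fix y assume y: "y \<in> {0..<n}"
    have "n dvd int p * x - int p * y \<longleftrightarrow> n dvd x - y"
      using cop by (simp add: coprime_commute coprime_dvd_mult_right_iff flip: right_diff_distrib)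
    also have "\<dots> \<longleftrightarrow> y = x mod n"
      using y n by (metis atLeastLessThan_iff mod_eq_dvd_iff mod_pos_pos_trivial)
    finally show "(if n dvd int p * x - int p * y then f y ^ p else 0)
      = (if y = x mod n then f y ^ p else 0)" by simp
  qed
  also have "\<dots> = f x ^ p" using n by (simp add: periodic_mod[OF f])
  finally have "int p dvd conv_power n f p (int p * x) - f x ^ p"
    using conv_power_prime[OF p(1), of n f "int p * x"] by simp
  moreover have "conv_power n f p = (\<lambda>x. D ^ (p - 1) * f x)"
    using conv_power_of_quasi_idempotent[OF n f idem, of "p - 1"] p0 by simp
  \<comment> \<open>The extra factor \<open>D\<close> completes the exponent to \<open>p\<close>, so
    that Fermat applies to \<open>D\<close> as well.\<close>
  ultimately have "int p dvd D * (D ^ (p - 1) * f (int p * x) - f x ^ p)"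
    by simp
  moreover have "D * (D ^ (p - 1) * f (int p * x)) = D ^ p * f (int p * x)"
    using p0 by (simp add: power_eq_if[of D p])
  ultimately have "int p dvd D ^ p * f (int p * x) - D * f x ^ p"
    by (simp only: right_diff_distrib)
  moreover have "int p dvd (D ^ p - D) * f (int p * x)" "int p dvd D * (f x ^ p - f x)"
    using int_prime_dvd_power_diff[OF p(1)] by simp_all
  ultimately have "int p dvd (D ^ p * f (int p * x) - D * f x ^ p)
      - (D ^ p - D) * f (int p * x) + D * (f x ^ p - f x)"
    by (meson dvd_add dvd_diff)
  then have "int p dvd D * (f (int p * x) - f x)" by (simp add: algebra_simps)
  then show ?thesis using p by (simp add: prime_dvd_mult_iff)
qed

text \<open>Two commuting idempotents satisfy \<open>(e' - e)\<^sup>3 = e' - e\<close>; hence if they are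
  congruent modulo \<open>p\<close>, they are congruent modulo every power of \<open>p\<close>.\<close>

lemma quasi_idempotent_dilate_prime:
  fixes f :: "int \<Rightarrow> int"
  assumes n: "n > 0" and f: "periodic n f" and idem: "conv n f f = (\<lambda>x. D * f x)"
    and p: "prime p" "\<not> int p dvd n" "\<not> int p dvd D"
  shows "f (int p * x) = f x"
proof -
  have cop: "coprime (int p) n" using p by (simp add: prime_imp_coprime)
  define f' where "f' = (\<lambda>x. f (int p * x))"
  define c where "c = conv n f f'"
  define g where "g = (\<lambda>x. f' x - f x)"
  have f': "periodic n f'" unfolding f'_def by (rule periodic_dilate[OF f])
  have idem': "conv n f' f' = (\<lambda>x. D * f' x)"
    using conv_dilate[OF n f f cop] by (auto simp: f'_def idem)
  have c': "conv n f' f = c" unfolding c_def by (rule conv_commute[OF n f' f])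
  have fc: "conv n f c = (\<lambda>x. D * c x)"
    unfolding c_def conv_assoc[OF n f f f', symmetric] idem conv_scale_left ..
  have f'c: "conv n f' c = (\<lambda>x. D * c x)"
    unfolding c'[symmetric] conv_assoc[OF n f' f' f, symmetric] idem' conv_scale_left ..
  have gg: "conv n g g = (\<lambda>x. (D * f' x - c x) - (c x - D * f x))"
    unfolding g_def conv_diff_left conv_diff_right idem idem' c' c_def[symmetric] ..
  \<comment> \<open>With \<open>f = D e\<close> and \<open>f' = D e'\<close> this is the cube
    identity for \<open>e' - e\<close>, multiplied by \<open>D^3\<close>.\<close>
  have ggg: "conv n g (conv n g g) = (\<lambda>x. D\<^sup>2 * g x)"
    unfolding gg
    unfolding g_def conv_diff_left conv_diff_right conv_scale_right idem idem' c' c_def[symmetric] fc f'c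
    by (auto simp: algebra_simps power2_eq_square)
  have "int p ^ Suc j dvd g x" for j x
  proof (induction j arbitrary: x)
    case 0
    then show ?case
      using quasi_idempotent_dilate_cong[OF n f idem p] by (simp add: g_def f'_def)
  next
    case (Suc j)
    \<comment> \<open>Cubing triples the exponent of \<open>p\<close> dividing \<open>g\<close>, and
      \<open>D^2\<close> is prime to \<open>p\<close>; hence \<open>g\<close> itself gains
      divisibility.\<close>
    have "int p ^ Suc j * (int p ^ Suc j * int p ^ Suc j) dvd conv n g (conv n g g) x"
      by (intro conv_dvd Suc)
    then have "int p ^ (Suc j + (Suc j + Suc j)) dvd D\<^sup>2 * g x" by (simp only: ggg power_add)
    moreover have "coprime (int p ^ (Suc j + (Suc j + Suc j))) (D\<^sup>2)"
      using p by (simp add: prime_imp_coprime)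
    ultimately have "int p ^ (Suc j + (Suc j + Suc j)) dvd g x"
      by (simp only: coprime_dvd_mult_right_iff)
    moreover have "int p ^ Suc (Suc j) dvd int p ^ (Suc j + (Suc j + Suc j))"
      by (rule le_imp_power_dvd) simp
    ultimately show ?case by (rule dvd_trans[rotated])
  qed
  then have "g x = 0" by (rule int_eq_0_of_prime_powers_dvd[OF p(1)])
  then show ?thesis by (simp add: g_def f'_def)
qed

lemma quasi_idempotent_dilate_nat:
  fixes f :: "int \<Rightarrow> int"
  assumes n: "n > 0" and f: "periodic n f" and idem: "conv n f f = (\<lambda>x. D * f x)"
  shows "k > 0 \<Longrightarrow> coprime (int k) (n * D) \<Longrightarrow> f (int k * x) = f x"
proof (induction k arbitrary: x rule: less_induct)
  case (less k)
  show ?case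
  proof (cases "k = 1")
    case True
    then show ?thesis by simp
  next
    case False
    then obtain p where p: "prime p" "p dvd k" using prime_factor_nat by blast
    then obtain m where m: "k = p * m" by (elim dvdE)
    have cop: "coprime (int p) n" "coprime (int p) D" "coprime (int m) (n * D)"
      using less.prems(2) by (simp_all add: m)
    have "\<not> is_unit (int p)"
      using prime_gt_1_nat[OF p(1)] by simp
    then have ndvd: "\<not> int p dvd n" "\<not> int p dvd D"
      using cop(1,2) coprime_absorb_left by blast+
    have "m > 0" using m less.prems(1) by (cases m) auto
    then have "m < k" using m prime_gt_1_nat[OF p(1)] by simp
    have "f (int p * (int m * x)) = f (int m * x)"
      by (rule quasi_idempotent_dilate_prime[OF n f idem p(1) ndvd])
    moreover have "f (int m * x) = f x"
      by (rule less.IH[OF \<open>m < k\<close> \<open>m > 0\<close> cop(3)])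
    ultimately have "f (int p * (int m * x)) = f x" by simp
    then show ?thesis by (simp add: m mult.assoc)
  qed
qed

text \<open>Units modulo \<open>n\<close> lift to units modulo \<open>n D\<close>: add to
  \<open>k\<close> the product of \<open>n\<close> with those primes of \<open>D\<close> that do not
  divide \<open>k\<close>. Every prime of \<open>n D\<close> then divides exactly one of the two
  summands.\<close>

lemma coprime_lift:
  fixes k n D :: int
  assumes "coprime k n" and n: "n > 0" and "D > 0"
  obtains k' where "coprime k' (n * D)" "n dvd k' - k"
proof -
  define Q where "Q = {q \<in> prime_factors D. \<not> q dvd k}"
  define k' where "k' = k + n * \<Prod>Q"
  have fin: "finite Q" by (simp add: Q_def)
  have "\<not> q dvd k'" if q: "prime q" "q dvd n * D" for q
  proof (cases "q dvd n")
    case True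
    then have "\<not> q dvd k"
      using assms(1) q(1) by (metis coprime_common_divisor not_prime_unit)
    then show ?thesis using True by (simp add: k'_def dvd_add_left_iff)
  next
    case nqn: False
    then have "q dvd D" using q by (simp add: prime_dvd_mult_iff)
    then have qD: "q \<in> prime_factors D" using q assms(3) by (auto simp: in_prime_factors_iff)
    show ?thesis
    proof (cases "q dvd k")
      case True
      have "\<not> q dvd \<Prod>Q"
      proof
        assume "q dvd \<Prod>Q"
        then obtain r where "r \<in> Q" "q dvd r"
          using q fin by (auto simp: prime_dvd_prod_iff)
        then have "q = r" using q by (auto simp: Q_def intro: primes_dvd_imp_eq)
        then show False using \<open>r \<in> Q\<close> True by (simp add: Q_def)
      qed
      then show ?thesis using True nqn q by (simp add: k'_def dvd_add_right_iff prime_dvd_mult_iff)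
    next
      case False
      then have "q dvd \<Prod>Q" using qD fin by (intro dvd_prodI) (auto simp: Q_def)
      then show ?thesis using False by (simp add: k'_def dvd_add_left_iff)
    qed
  qed
  then have "coprime k' (n * D)"
    using prime_divisor_exists[of "gcd k' (n * D)"] n assms(3)
    by (metis coprime_iff_gcd_eq_1 gcd_eq_0_iff gcd_greatest_iff is_unit_gcd_iff mult_eq_0_iff order_less_irrefl)
  then show ?thesis by (rule that) (simp add: k'_def)
qed

lemma quasi_idempotent_dilate:
  fixes f :: "int \<Rightarrow> int"
  assumes n: "n > 0" and f: "periodic n f" and idem: "conv n f f = (\<lambda>x. D * f x)"
    and D: "D > 0" and k: "coprime k n"
  shows "f (k * x) = f x"
proof -
  obtain k' where k': "coprime k' (n * D)" "n dvd k' - k"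
    using coprime_lift[OF k n D] .
  \<comment> \<open>A positive representative of \<open>k'\<close> modulo \<open>n D\<close>, since
    the multiplicative induction runs over natural numbers.\<close>
  define m where "m = nat (k' + n * D * (\<bar>k'\<bar> + 1))"
  have "n * D * (\<bar>k'\<bar> + 1) \<ge> 1 * (\<bar>k'\<bar> + 1)"
    using n D by (intro mult_right_mono) (simp_all add: int_one_le_iff_zero_less)
  then have pos: "k' + n * D * (\<bar>k'\<bar> + 1) > 0"
    using abs_ge_minus_self[of k'] by (simp only: mult_1)
  then have m: "int m = k' + n * D * (\<bar>k'\<bar> + 1)" "m > 0" by (simp_all add: m_def)
  have "coprime (int m) (n * D)"
    using k'(1) gcd_add_mult[of "n * D" "\<bar>k'\<bar> + 1" k']
    by (simp only: m coprime_iff_gcd_eq_1 gcd.commute[of _ "n * D"] add.commute[of k'] mult.commute[of "n * D"])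
  then have "f (int m * x) = f x"
    by (rule quasi_idempotent_dilate_nat[OF n f idem m(2)])
  moreover have "n dvd int m * x - k * x"
  proof -
    have eq: "int m - k = (k' - k) + n * (D * (\<bar>k'\<bar> + 1))" by (simp add: m)
    have "n dvd int m - k" unfolding eq using k'(2) by (intro dvd_add) simp_all
    then show ?thesis by (simp flip: left_diff_distrib)
  qed
  ultimately show ?thesis using periodicD[OF f] by metis
qed

text \<open>Two generators of the same subgroup of Z/n differ by a unit. After division by the
  common gcd \<open>g\<close> the quotient of the generators is a unit modulo \<open>n / g\<close>,
  which \<open>coprime_lift\<close> raises to a unit modulo \<open>n\<close>.\<close>

lemma coprime_multiplier:
  fixes x y n :: int
  assumes "n > 0" "gcd x n = gcd y n"
  obtains u where "coprime u n" "n dvd u * y - x"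
proof -
  define g where "g = gcd x n"
  have g: "g > 0" using assms(1) by (simp add: g_def)
  obtain x' n' where xn: "x = x' * g" "n = n' * g" "coprime x' n'"
    using gcd_coprime_exists[of x n] g unfolding g_def by (metis less_irrefl)
  obtain y' n'' where yn: "y = y' * g" "n = n'' * g" "coprime y' n''"
    using gcd_coprime_exists[of y n] g unfolding g_def assms(2) by (metis less_irrefl)
  have [simp]: "n'' = n'" using xn yn g by simp
  have n': "n' > 0" using xn g assms(1) by (simp add: zero_less_mult_iff)
  \<comment> \<open>\<open>s\<close> is an inverse of \<open>y'\<close> modulo \<open>n'\<close>, so
    \<open>s * x'\<close> is the wanted quotient.\<close>
  obtain s t where st: "s * y' + t * n' = 1"
    using bezout_int[of y' n'] yn(3) by (auto simp: coprime_iff_gcd_eq_1)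
  have "coprime s n'"
  proof (rule coprimeI)
    fix d assume "d dvd s" "d dvd n'"
    then have "d dvd s * y' + t * n'" by simp
    then show "is_unit d" by (simp only: st)
  qed
  then have "coprime (s * x') n'" using xn by simp
  then obtain u where u: "coprime u (n' * g)" "n' dvd u - s * x'"
    using coprime_lift n' g by blast
  have "u * y' - x' = (u - s * x') * y' + x' * (s * y' + t * n' - 1) - x' * t * n'"
    by (simp add: algebra_simps)
  then have "u * y' - x' = (u - s * x') * y' - x' * t * n'" using st by simp
  then have "n' dvd u * y' - x'" using u(2) by simp
  then have "n' * g dvd (u * y' - x') * g" by (rule mult_dvd_mono) simp
  then have "n dvd u * y - x" by (simp add: xn yn algebra_simps)
  then show ?thesis using u(1) by (intro that) (simp_all add: xn)
qed

section \<open>Rational Schur rings over cyclic groups\<close>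

definition class_constant :: "(int \<Rightarrow> int \<Rightarrow> bool) \<Rightarrow> (int \<Rightarrow> 'a) \<Rightarrow> bool" where
  "class_constant E f \<longleftrightarrow> (\<forall>x y. E x y \<longrightarrow> f x = f y)"

lemma class_constantD: "class_constant E f \<Longrightarrow> E x y \<Longrightarrow> f x = f y"
  by (auto simp: class_constant_def)

text \<open>The basic sets of a Schur ring over \<open>\<int>/n\<close> are encoded by the equivalence relation \<open>E\<close>
  that they induce on \<open>\<int>\<close>. The Schur ring is rational, i.e. its basic sets are unions of sets of
  elements of equal order.\<close>

locale rational_schur =
  fixes n :: int and E :: "int \<Rightarrow> int \<Rightarrow> bool"
  assumes n_pos: "n > 0"
    and E_equivp: "equivp E"
    and E_gcd: "gcd x n = gcd y n \<Longrightarrow> E x y"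
    and E_zero: "E x 0 \<Longrightarrow> n dvd x"
    and E_conv: "class_constant E f \<Longrightarrow> class_constant E g \<Longrightarrow> class_constant E (conv n f g :: int \<Rightarrow> int)"
begin

lemma E_refl [simp]: "E x x"
  using E_equivp by (rule equivp_reflp)

lemma E_sym: "E x y \<Longrightarrow> E y x"
  using E_equivp by (rule equivp_symp)

lemma E_trans [trans]: "E x y \<Longrightarrow> E y z \<Longrightarrow> E x z"
  using E_equivp by (rule equivp_transp)

lemma E_dvd_diff: "n dvd x - y \<Longrightarrow> E x y"
  by (rule E_gcd) (metis gcd.commute gcd_mod_right mod_eq_dvd_iff n_pos less_irrefl)

lemma E_uminus: "E (- x) x"
  by (rule E_gcd) simp

lemma class_constant_periodic: "class_constant E f \<Longrightarrow> periodic n f"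
  unfolding periodic_def using E_dvd_diff class_constantD by metis

text \<open>The unions of basic sets: their indicator functions are the 0-1 elements of the Schur
  ring.\<close>

definition saturated :: "int set \<Rightarrow> bool" where
  "saturated A \<longleftrightarrow> (\<forall>x y. E x y \<longrightarrow> x \<in> A \<longrightarrow> y \<in> A)"

lemma saturatedD: "saturated A \<Longrightarrow> E x y \<Longrightarrow> x \<in> A \<Longrightarrow> y \<in> A"
  by (auto simp: saturated_def)

lemma saturated_class: "saturated {y. E x y}"
  unfolding saturated_def using E_trans by blast

lemma saturated_Compl: "saturated A \<Longrightarrow> saturated (- A)"
  unfolding saturated_def using E_sym by blast

lemma saturated_Int: "saturated A \<Longrightarrow> saturated B \<Longrightarrow> saturated (A \<inter> B)"
  unfolding saturated_def by blast

lemma saturated_Diff: "saturated A \<Longrightarrow> saturated B \<Longrightarrow> saturated (A - B)"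
  unfolding saturated_def using E_sym by blast

lemma saturated_UN: "(\<And>i. i \<in> I \<Longrightarrow> saturated (A i)) \<Longrightarrow> saturated (\<Union>i\<in>I. A i)"
  unfolding saturated_def by blast

lemma saturated_zero: "saturated {x. n dvd x}"
proof -
  have "E x y \<Longrightarrow> n dvd x \<Longrightarrow> n dvd y" for x y
  proof -
    assume "E x y" "n dvd x"
    then have "E y 0" using E_sym E_trans E_dvd_diff[of x 0] by (metis diff_zero)
    then show "n dvd y" by (rule E_zero)
  qed
  then show ?thesis by (auto simp: saturated_def)
qed

lemma class_constant_of_bool: "class_constant E (\<lambda>x. of_bool (x \<in> A) :: int) \<longleftrightarrow> saturated A"
  unfolding class_constant_def saturated_def using E_sym by (auto simp: of_bool_def)

lemma saturated_vimage: "class_constant E f \<Longrightarrow> saturated {x. f x \<in> T}"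
  unfolding class_constant_def saturated_def by auto

lemma conv_of_bool:
  "conv n (\<lambda>x. of_bool (x \<in> A)) (\<lambda>x. of_bool (x \<in> B)) x
     = (int (card {y \<in> {0..<n}. y \<in> A \<and> x - y \<in> B}))"
proof -
  have "(\<Sum>y\<in>{0..<n}. of_bool (y \<in> A) * of_bool (x - y \<in> B) :: int)
     = (\<Sum>y\<in>{0..<n}. if y \<in> A \<and> x - y \<in> B then 1 else 0)"
    by (rule sum.cong) auto
  then show ?thesis unfolding conv_def by (simp add: sum.If_cases Int_def)
qed

text \<open>These numbers are the coefficients of a product of two indicator functions. Their
  constancy on classes is used as a counting principle.\<close>

lemma saturated_card:
  assumes "saturated A" "saturated B" "E x x'"
  shows "card {y \<in> {0..<n}. y \<in> A \<and> x - y \<in> B} = card {y \<in> {0..<n}. y \<in> A \<and> x' - y \<in> B}"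
  using class_constantD[OF E_conv[OF class_constant_of_bool[THEN iffD2, OF assms(1)]
        class_constant_of_bool[THEN iffD2, OF assms(2)]] assms(3)]
  by (simp add: conv_of_bool)

lemma saturated_mod: "saturated A \<Longrightarrow> x mod n \<in> A \<longleftrightarrow> x \<in> A"
  using E_dvd_diff[of x "x mod n"] E_sym saturatedD by (metis mod_eq_dvd_iff mod_mod_trivial)

lemma saturated_diff_mod: "saturated A \<Longrightarrow> x - y mod n \<in> A \<longleftrightarrow> x - y \<in> A"
  by (metis mod_diff_right_eq saturated_mod)

lemma saturated_uminus: "saturated A \<Longrightarrow> - x \<in> A \<longleftrightarrow> x \<in> A"
  using E_uminus E_sym saturatedD by blast

text \<open>The sum set is the support of a product of indicator functions; the coefficients are
  counts, so nothing cancels.\<close>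

lemma saturated_plus:
  assumes "saturated A" "saturated B"
  shows "saturated {x. \<exists>a\<in>A. x - a \<in> B}"
proof -
  have *: "(\<exists>a\<in>A. x - a \<in> B) \<longleftrightarrow> card {y \<in> {0..<n}. y \<in> A \<and> x - y \<in> B} \<noteq> 0" for x
  proof -
    define C where "C = {y \<in> {0..<n}. y \<in> A \<and> x - y \<in> B}"
    have "(\<exists>a\<in>A. x - a \<in> B) \<longleftrightarrow> C \<noteq> {}"
    proof
      assume "\<exists>a\<in>A. x - a \<in> B"
      then obtain a where a: "a \<in> A" "x - a \<in> B" by blast
      have "a mod n \<in> C"
        using a n_pos saturated_mod[OF assms(1)] saturated_diff_mod[OF assms(2)] by (simp add: C_def)
      then show "C \<noteq> {}" by blast
    qed (auto simp: C_def)
    moreover have "finite C"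
      unfolding C_def by (rule finite_subset[of _ "{0..<n}"]) auto
    ultimately show ?thesis unfolding C_def[symmetric] by simp
  qed
  show ?thesis
    unfolding saturated_def mem_Collect_eq *
  proof (intro allI impI)
    fix x y assume "E x y" and x: "card {z \<in> {0..<n}. z \<in> A \<and> x - z \<in> B} \<noteq> 0"
    then show "card {z \<in> {0..<n}. z \<in> A \<and> y - z \<in> B} \<noteq> 0"
      by (simp only: saturated_card[OF assms] not_False_eq_True)
  qed
qed

lemma saturated_multiples_eq:
  assumes sat: "saturated A" and zero: "0 \<in> A" and add: "\<And>x y. x \<in> A \<Longrightarrow> y \<in> A \<Longrightarrow> x + y \<in> A"
  obtains m where "m > 0" "m dvd n" "A = {x. m dvd x}"
proof -
  have n: "n \<in> A" using saturatedD[OF sat E_dvd_diff[of 0 n] zero] by simp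
  have "- x \<in> A" if "x \<in> A" for x using that saturated_uminus[OF sat] by blast
  then show ?thesis using int_subgroup_multiples[OF n n_pos add] that by blast
qed

text \<open>The iterated sum sets of \<open>A\<close> are saturated, hence so is their union, which
  is the subgroup generated by \<open>A\<close>. The last clause expresses its minimality: a
  subgroup of multiples of \<open>k\<close> that contains \<open>A\<close> contains it too.\<close>

lemma generated_multiples:
  assumes "saturated A"
  obtains m where "m > 0" "m dvd n" "saturated {x. m dvd x}" "\<forall>x\<in>A. m dvd x"
    "\<forall>k. k dvd n \<longrightarrow> (\<forall>x\<in>A. k dvd x) \<longrightarrow> k dvd m"
proof -
  \<comment> \<open>\<open>W i\<close> consists of the sums of \<open>i\<close> elements of
    \<open>A\<close>, modulo \<open>n\<close>.\<close>
  define W where "W = rec_nat {x. n dvd x} (\<lambda>_ B. {x. \<exists>b\<in>B. x - b \<in> A})"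
  have W0: "W 0 = {x. n dvd x}" and WS: "W (Suc i) = {x. \<exists>b\<in>W i. x - b \<in> A}" for i
    by (simp_all add: W_def)
  have satW: "saturated (W i)" for i
    by (induction i) (use saturated_zero saturated_plus[OF _ assms] in \<open>simp_all add: W0 WS\<close>)
  have sat: "saturated (\<Union>i. W i)" using satW by (intro saturated_UN) auto
  have W_add: "x + y \<in> W (i + j)" if "x \<in> W i" "y \<in> W j" for x y i j
    using that(2)
  proof (induction j arbitrary: y)
    case 0
    then have "E x (x + y)" by (intro E_dvd_diff) (simp add: W0)
    then show ?case using that(1) satW saturatedD by auto
  next
    case (Suc j)
    then obtain b where b: "b \<in> W j" "y - b \<in> A" by (auto simp: WS)
    then have "x + b \<in> W (i + j)" "(x + y) - (x + b) \<in> A" using Suc.IH by simp_all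
    then show ?case unfolding add_Suc_right WS by blast
  qed
  obtain m where m: "m > 0" "m dvd n" "(\<Union>i. W i) = {x. m dvd x}"
  proof (rule saturated_multiples_eq[OF sat])
    show "0 \<in> (\<Union>i. W i)" using W0 by auto
    show "x + y \<in> (\<Union>i. W i)" if "x \<in> (\<Union>i. W i)" "y \<in> (\<Union>i. W i)" for x y
      using that W_add by blast
  qed
  show ?thesis
  proof (rule that[OF m(1,2)])
    show "saturated {x. m dvd x}" using sat by (simp add: m)
    show "\<forall>x\<in>A. m dvd x"
    proof
      fix x assume "x \<in> A"
      then have "x \<in> W 1" by (auto simp: WS W0 intro: bexI[of _ 0])
      then show "m dvd x" using m(3) by blast
    qed
    show "\<forall>k. k dvd n \<longrightarrow> (\<forall>x\<in>A. k dvd x) \<longrightarrow> k dvd m"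
    proof (intro allI impI)
      fix k assume k: "k dvd n" "\<forall>x\<in>A. k dvd x"
      have "x \<in> W i \<Longrightarrow> k dvd x" for x i
      proof (induction i arbitrary: x)
        case 0
        then show ?case using k(1) by (auto simp: W0 intro: dvd_trans)
      next
        case (Suc i)
        then obtain b where "b \<in> W i" "x - b \<in> A" by (auto simp: WS)
        then have "k dvd b" "k dvd x - b" using Suc.IH k(2) by auto
        then have "k dvd b + (x - b)" by (rule dvd_add)
        then show ?case by simp
      qed
      moreover have "m \<in> (\<Union>i. W i)" using m(3) by simp
      ultimately show "k dvd m" by blast
    qed
  qed
qed

lemma saturated_multiples_lcm:
  assumes "saturated {x. a dvd x}" "saturated {x. b dvd x}"
  shows "saturated {x. lcm a b dvd x}"
proof -
  have "{x. lcm a b dvd x} = {x. a dvd x} \<inter> {x. b dvd x}" by auto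
  then show ?thesis using saturated_Int[OF assms] by simp
qed

end

section \<open>Quotients and subgroups of rational Schur rings\<close>

lemma sum_periodic_multiple:
  fixes F :: "int \<Rightarrow> int"
  assumes "m > 0" "periodic m F"
  shows "(\<Sum>y\<in>{0..<m * int k}. F y) = int k * (\<Sum>y\<in>{0..<m}. F y)"
proof (induction k)
  case (Suc k)
  have "bij_betw (\<lambda>y. y + m * int k) {0..<m} {m * int k..<m * int k + m}"
    by (rule bij_betw_byWitness[where f' = "\<lambda>y. y - m * int k"]) auto
  then have "(\<Sum>y\<in>{m * int k..<m * int k + m}. F y) = (\<Sum>y\<in>{0..<m}. F (y + m * int k))"
    by (rule sum.reindex_bij_betw[symmetric])
  also have "\<dots> = (\<Sum>y\<in>{0..<m}. F y)"
    by (rule sum_periodic_shift[OF assms])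
  finally have "(\<Sum>y\<in>{m * int k..<m * int k + m}. F y) = (\<Sum>y\<in>{0..<m}. F y)" .
  moreover have "{0..<m * int (Suc k)} = {0..<m * int k} \<union> {m * int k..<m * int k + m}"
    using assms(1) by (simp add: ivl_disj_un_two(3) distrib_left add.commute)
  moreover have "{0..<m * int k} \<inter> {m * int k..<m * int k + m} = {}" by auto
  ultimately show ?case using Suc by (simp add: sum.union_disjoint distrib_right)
qed simp

context rational_schur
begin

lemma saturated_coset:
  assumes "saturated {x. m dvd x}"
  shows "saturated {w. \<exists>a. E x a \<and> m dvd w - a}"
  using saturated_plus[OF saturated_class assms, of x] by simp

text \<open>Functions that are constant on the new classes are the \<open>m\<close>-periodic class
  functions of \<open>E\<close>. On them convolution modulo \<open>n\<close> is \<open>n / m\<close>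
  times convolution modulo \<open>m\<close>, and the factor can be divided out.\<close>

lemma quotient:
  assumes m: "m > 0" "m dvd n" and sat: "saturated {x. m dvd x}"
  shows "rational_schur m (\<lambda>x y. \<exists>z. E x z \<and> m dvd y - z)"
proof
  let ?E = "\<lambda>x y. \<exists>z. E x z \<and> m dvd y - z"
  have EE: "?E x y" if "E x y" for x y
    using that by (intro exI[of _ y]) simp
  have dvdE: "?E x y" if "m dvd x - y" for x y
    using that by (intro exI[of _ x]) (simp add: dvd_diff_commute)
  have const: "class_constant E f \<and> periodic m f" if "class_constant ?E f" for f :: "int \<Rightarrow> int"
    using that EE dvdE unfolding class_constant_def periodic_def by blast
  have const': "class_constant ?E f" if "class_constant E f" "periodic m f" for f :: "int \<Rightarrow> int"
    using that unfolding class_constant_def periodic_def by metis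
  have satD: "?E x z" if "?E x y" "E y z" for x y z
    using saturatedD[OF saturated_coset[OF sat, of x] that(2)] that(1) by blast
  have dvd: "?E x z" if xy: "?E x y" and yz: "m dvd y - z" for x y z
  proof -
    obtain w where w: "E x w" "m dvd y - w" using xy by blast
    have "m dvd (y - w) - (y - z)" using w(2) yz by (rule dvd_diff)
    then show ?thesis using w(1) by (intro exI[of _ w]) simp
  qed
  show "m > 0" by (rule m(1))
  show "equivp ?E"
  proof (rule equivpI)
    show "reflp ?E" by (rule reflpI) (rule EE, simp)
    show "symp ?E"
    proof (rule sympI)
      fix x y assume "?E x y"
      then obtain z where z: "E x z" "m dvd y - z" by blast
      show "?E y x" by (rule satD[OF dvdE[OF z(2)] E_sym[OF z(1)]])
    qed
    show "transp ?E"
    proof (rule transpI)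
      fix x y v assume "?E x y" "?E y v"
      then obtain w where w: "E y w" "m dvd v - w" by blast
      then have "m dvd w - v" by (simp add: dvd_diff_commute)
      then show "?E x v" by (rule dvd[OF satD[OF \<open>?E x y\<close> w(1)]])
    qed
  qed
  show "?E x y" if xy: "gcd x m = gcd y m" for x y
  proof -
    obtain u where u: "coprime u m" "m dvd u * x - y"
      using coprime_multiplier[OF m(1) xy[symmetric]] .
    have pos: "n div m > 0" using m n_pos by (metis dvd_mult_div_cancel zero_less_mult_pos)
    \<comment> \<open>The unit relating \<open>x\<close> and \<open>y\<close> modulo
      \<open>m\<close> is lifted to a unit modulo \<open>n\<close>, which \<open>E\<close>
      respects.\<close>
    obtain u' where u': "coprime u' (m * (n div m))" "m dvd u' - u"
      using coprime_lift[OF u(1) m(1) pos] .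
    then have "coprime u' n" using m(2) by simp
    then have "gcd (u' * x) n = gcd x n"
      by (intro gcd_mult_left_left_cancel) (simp add: coprime_commute)
    then have "E x (u' * x)" by (intro E_gcd) simp
    moreover have "m dvd (u' - u) * x + (u * x - y)" using u' u by (intro dvd_add) simp_all
    then have "m dvd u' * x - y" by (simp add: algebra_simps)
    then have "m dvd y - u' * x" by (simp only: dvd_diff_commute)
    ultimately show ?thesis by blast
  qed
  show "m dvd x" if "?E x 0" for x
  proof -
    obtain z where z: "E x z" "m dvd z" using \<open>?E x 0\<close> by auto
    then show ?thesis using saturatedD[OF sat E_sym[OF z(1)]] by simp
  qed
  show "class_constant ?E (conv m f g)" if f: "class_constant ?E f" and g: "class_constant ?E g"
    for f g :: "int \<Rightarrow> int"
  proof -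
    define k where "k = nat (n div m)"
    have pos: "n div m > 0" using m n_pos by (metis dvd_mult_div_cancel zero_less_mult_pos)
    then have k: "n = m * int k" "k > 0" using m by (simp_all add: k_def)
    have fg: "class_constant E f" "periodic m f" "class_constant E g" "periodic m g"
      using const[OF f] const[OF g] by simp_all
    have eq: "conv n f g x = int k * conv m f g x" for x
      unfolding conv_def k(1)
      by (rule sum_periodic_multiple[OF m(1) periodic_mult_reflect[OF fg(2,4)]])
    have "class_constant E (conv n f g)" by (rule E_conv[OF fg(1,3)])
    then have "class_constant E (conv m f g)"
      using k(2) unfolding class_constant_def eq by simp
    moreover have "periodic m (conv m f g)" by (rule periodic_conv[OF fg(4)])
    ultimately show ?thesis by (rule const')
  qed
qed

text \<open>Multiplication by \<open>d\<close> identifies Z/(n/d) with a subgroup of Z/n. As that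
  subgroup is saturated, extension by zero keeps functions constant on classes, and the convolution
  of two functions supported on it only involves its elements.\<close>

lemma subgroup_restrict:
  assumes d: "d > 0" "d dvd n" and sat: "saturated {x. d dvd x}"
  shows "rational_schur (n div d) (\<lambda>x y. E (d * x) (d * y))"
proof
  let ?E = "\<lambda>x y. E (d * x) (d * y)"
  have n: "n = d * (n div d)" using d by simp
  show pos: "n div d > 0" using d n_pos by (metis dvd_mult_div_cancel zero_less_mult_pos)
  show "equivp ?E"
    by (rule equivpI) (auto intro!: reflpI sympI transpI dest: E_sym E_trans)
  show "?E x y" if "gcd x (n div d) = gcd y (n div d)" for x y
  proof (rule E_gcd)
    have "gcd (d * x) (d * (n div d)) = gcd (d * y) (d * (n div d))"
      using that by (simp add: gcd_mult_left)
    then show "gcd (d * x) n = gcd (d * y) n" by (simp flip: n)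
  qed
  show "n div d dvd x" if "?E x 0" for x
    using E_zero[of "d * x"] that d n by (metis mult_zero_right dvd_mult_cancel_left less_irrefl)
  show "class_constant ?E (conv (n div d) f g)"
    if f: "class_constant ?E f" and g: "class_constant ?E g" for f g :: "int \<Rightarrow> int"
  proof -
    define ext where "ext = (\<lambda>(f::int\<Rightarrow>int) z. if d dvd z then f (z div d) else 0)"
    have ext: "class_constant E (ext f)" if f: "class_constant ?E f" for f
      unfolding class_constant_def
    proof (intro allI impI)
      fix x y assume xy: "E x y"
      have iff: "d dvd x \<longleftrightarrow> d dvd y"
        using saturatedD[OF sat xy] saturatedD[OF sat E_sym[OF xy]] by blast
      show "ext f x = ext f y"
      proof (cases "d dvd x")
        case True
        then have "E (d * (x div d)) (d * (y div d))" using xy iff by simp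
        then show ?thesis using True iff class_constantD[OF f] by (simp add: ext_def)
      qed (use iff in \<open>simp add: ext_def\<close>)
    qed
    have "conv n (ext f) (ext g) (d * x) = conv (n div d) f g x" for x
    proof -
      have inj: "inj_on ((*) d) {0..<n div d}" using d by (auto simp: inj_on_def)
      have "conv n (ext f) (ext g) (d * x) = (\<Sum>y\<in>(*) d ` {0..<n div d}. ext f y * ext g (d * x - y))"
        unfolding conv_def
      proof (rule sum.mono_neutral_right)
        show "(*) d ` {0..<n div d} \<subseteq> {0..<n}"
        proof
          fix y assume "y \<in> (*) d ` {0..<n div d}"
          then obtain z where z: "y = d * z" "z \<in> {0..<n div d}" by blast
          then have "d * z < d * (n div d)" using d(1) by (intro mult_strict_left_mono) simp_all
          then show "y \<in> {0..<n}" using z d(1) n by simp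
        qed
        show "\<forall>y\<in>{0..<n} - (*) d ` {0..<n div d}. ext f y * ext g (d * x - y) = 0"
        proof
          fix y assume y: "y \<in> {0..<n} - (*) d ` {0..<n div d}"
          have "\<not> d dvd y"
          proof
            assume "d dvd y"
            then obtain z where z: "y = d * z" by (elim dvdE)
            then have "0 \<le> d * z" "d * z < d * (n div d)" using y n by auto
            then have "z \<in> {0..<n div d}"
              using d(1) by (simp add: zero_le_mult_iff mult_less_cancel_left_pos)
            then show False using y z by blast
          qed
          then show "ext f y * ext g (d * x - y) = 0" by (simp add: ext_def)
        qed
      qed simp
      also have "\<dots> = (\<Sum>y\<in>{0..<n div d}. f y * g (x - y))"
        unfolding sum.reindex[OF inj] using d(1)
        by (intro sum.cong) (auto simp: ext_def simp flip: right_diff_distrib)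
      finally show ?thesis by (simp add: conv_def)
    qed
    then show ?thesis
      using E_conv[OF ext[OF f] ext[OF g]] unfolding class_constant_def by metis
  qed
qed

end

section \<open>The Frobenius congruence at a prime dividing the order\<close>

lemma gcd_mult_coprime_right:
  fixes y q r :: int
  assumes "coprime q r"
  shows "gcd y (q * r) = gcd y q * gcd y r"
proof (rule zdvd_antisym_nonneg)
  obtain a b where ab: "a * q + b * y = gcd y q"
    using bezout_int[of q y] by (auto simp: gcd.commute)
  obtain c d where cd: "c * r + d * y = gcd y r"
    using bezout_int[of r y] by (auto simp: gcd.commute)
  have "gcd y (q * r) dvd (a * c) * (q * r) + y * (a * q * d + b * c * r + b * d * y)"
    by (intro dvd_add) (auto intro: dvd_mult dvd_mult2)
  also have "\<dots> = (a * q + b * y) * (c * r + d * y)" by (simp add: algebra_simps)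
  finally show "gcd y (q * r) dvd gcd y q * gcd y r" by (simp only: ab cd)
  have "coprime (gcd y q) (gcd y r)"
    using assms by (meson coprime_divisors gcd_dvd2)
  then have "gcd y q * gcd y r dvd y" by (intro divides_mult) auto
  then show "gcd y q * gcd y r dvd gcd y (q * r)" by (auto intro: mult_dvd_mono)
qed simp_all

context rational_schur
begin

lemma class_constant_conv_power:
  fixes f :: "int \<Rightarrow> int"
  assumes "class_constant E f"
  shows "class_constant E (conv_power n f k)"
proof (induction k)
  case 0
  have "class_constant E (\<lambda>x. of_bool (x \<in> {x. n dvd x}) :: int)"
    by (simp only: class_constant_of_bool saturated_zero)
  then show ?case by (simp add: of_bool_def)
next
  case (Suc k)
  then show ?case using E_conv[OF assms] by simp
qed

context
  fixes p k :: nat and r :: int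
  assumes p: "prime p" and n_eq: "n = int p ^ Suc k * r" and r: "\<not> int p dvd r"
begin

lemma coprime_p_r: "coprime (int p) r"
  using p r by (simp add: prime_imp_coprime)

lemma E_of_gcd_parts:
  assumes "gcd x (int p ^ Suc k) = gcd y (int p ^ Suc k)" "gcd x r = gcd y r"
  shows "E x y"
proof (rule E_gcd)
  have "coprime (int p ^ Suc k) r" using coprime_p_r by simp
  then show "gcd x n = gcd y n" by (simp only: n_eq gcd_mult_coprime_right assms)
qed

lemma gcd_shift_r: "gcd (x + j * (int p ^ k * r)) r = gcd x r"
proof -
  have eq: "x + j * (int p ^ k * r) = j * int p ^ k * r + x" by simp
  show ?thesis unfolding eq gcd.commute[of _ r] by (rule gcd_add_mult)
qed

text \<open>The element \<open>p^k r = n / p\<close> generates the subgroup of order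
  \<open>p\<close>. If \<open>p^k\<close> does not divide \<open>y\<close>, the
  \<open>p\<close>-part of \<open>gcd y n\<close> is a smaller power of \<open>p\<close>, which a
  multiple of \<open>p^k\<close> cannot change; the whole coset of \<open>y\<close> lies in one
  class.\<close>

lemma E_shift_not_dvd:
  assumes "\<not> int p ^ k dvd y"
  shows "E y (y + j * (int p ^ k * r))"
proof (rule E_of_gcd_parts)
  have pr: "prime (int p)" using p by simp
  have dvd: "gcd x (int p ^ Suc k) dvd int p ^ k" if "\<not> int p ^ k dvd x" for x
  proof -
    obtain i where i: "gcd x (int p ^ Suc k) = int p ^ i"
      using divides_primepow[OF pr, of "gcd x (int p ^ Suc k)" "Suc k"] by (auto simp: normalize_idem_imp_is_unit_iff)
    have "i < k"
    proof (rule ccontr)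
      assume "\<not> i < k"
      then have "int p ^ k dvd int p ^ i" by (simp add: le_imp_power_dvd)
      then show False using that i by (metis dvd_trans gcd_dvd1)
    qed
    then show ?thesis unfolding i by (intro le_imp_power_dvd) simp
  qed
  have *: "gcd x (int p ^ Suc k) dvd gcd (x + j * (int p ^ k * r)) (int p ^ Suc k)"
    if "\<not> int p ^ k dvd x" for x j
    using dvd[OF that] by (intro gcd_greatest dvd_add) (auto intro: dvd_mult dvd_mult2)
  have "\<not> int p ^ k dvd y + j * (int p ^ k * r)"
    using assms by (simp add: dvd_add_left_iff)
  from *[OF this, of "- j"] *[OF assms, of j]
  show "gcd y (int p ^ Suc k) = gcd (y + j * (int p ^ k * r)) (int p ^ Suc k)"
    by (intro zdvd_antisym_nonneg) simp_all
qed (simp add: gcd_shift_r)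

lemma gcd_shift_p:
  assumes "int p ^ Suc k dvd v" "\<not> int p dvd j"
  shows "gcd (v + j * (int p ^ k * r)) (int p ^ Suc k) = int p ^ k"
proof -
  obtain w where w: "v = int p ^ Suc k * w" using assms(1) by (elim dvdE)
  have "gcd (v + j * (int p ^ k * r)) (int p ^ Suc k) = gcd (int p ^ k * (int p * w + j * r)) (int p ^ k * int p)"
    by (simp add: w algebra_simps)
  also have "\<dots> = int p ^ k * gcd (int p * w + j * r) (int p)"
    by (simp add: gcd_mult_left)
  also have "gcd (int p * w + j * r) (int p) = gcd (int p) (j * r)"
    using gcd_add_mult[of "int p" w "j * r"] by (simp add: gcd.commute mult.commute)
  also have "\<dots> = 1"
    using p r assms(2) by (simp add: coprime_iff_gcd_eq_1[symmetric] prime_imp_coprime)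
  finally show ?thesis by simp
qed

text \<open>In the coset of \<open>v\<close> under the subgroup of order \<open>p\<close>, all
  elements other than \<open>v\<close> have exactly \<open>p^k\<close> as \<open>p\<close>-part of
  their gcd with \<open>n\<close>. A saturated set therefore meets this coset in a way determined by
  \<open>v\<close> and \<open>v + n/p\<close> alone.\<close>

lemma E_shift_dvd:
  assumes "int p ^ Suc k dvd v" "\<not> int p dvd j"
  shows "E (v + j * (int p ^ k * r)) (v + int p ^ k * r)"
proof (rule E_of_gcd_parts)
  have "\<not> int p dvd 1" using prime_gt_1_nat[OF p] by simp
  then show "gcd (v + j * (int p ^ k * r)) (int p ^ Suc k) = gcd (v + int p ^ k * r) (int p ^ Suc k)"
    using gcd_shift_p[OF assms] gcd_shift_p[OF assms(1), of 1] by simp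
  show "gcd (v + j * (int p ^ k * r)) r = gcd (v + int p ^ k * r) r"
    using gcd_shift_r[of v j] gcd_shift_r[of v 1] by simp
qed

lemma gcd_p_mult_r: "gcd (int p * z) r = gcd z r"
  using coprime_p_r by (intro gcd_mult_left_left_cancel) (simp add: coprime_commute)

text \<open>The multiples of \<open>p^(k+1)\<close> form a subgroup of order \<open>r\<close> in
  Z/n. Its order is prime to \<open>p\<close>, so multiplication by \<open>p\<close> permutes it and
  preserves orders.\<close>

lemma E_p_mult:
  assumes "int p ^ Suc k dvd v"
  shows "E (int p * v) v" "E (int p * v + int p ^ k * r) (v + int p ^ k * r)"
proof -
  have pv: "int p ^ Suc k dvd int p * v" using assms by (rule dvd_mult)
  show "E (int p * v) v"
    using gcd_p_mult_r assms pv by (intro E_of_gcd_parts) (simp_all add: gcd_proj2_if_dvd del: power_Suc)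
  have "\<not> int p dvd 1" using prime_gt_1_nat[OF p] by simp
  then have "gcd (int p * v + int p ^ k * r) (int p ^ Suc k) = gcd (v + int p ^ k * r) (int p ^ Suc k)"
    using gcd_shift_p[OF assms, of 1] gcd_shift_p[OF pv, of 1] by simp
  moreover have "gcd (int p * v + int p ^ k * r) r = gcd (v + int p ^ k * r) r"
    using gcd_shift_r[of v 1] gcd_shift_r[of "int p * v" 1] gcd_p_mult_r by simp
  ultimately show "E (int p * v + int p ^ k * r) (v + int p ^ k * r)"
    by (rule E_of_gcd_parts)
qed

text \<open>The solutions \<open>y\<close> of \<open>p y = p y0\<close> in Z/n form the coset of
  \<open>y0\<close> under the subgroup of order \<open>p\<close>; this lists them.\<close>

lemma sum_pth_roots:
  assumes sat: "saturated A"
  shows "(\<Sum>y\<in>{0..<n}. if n dvd int p * y0 - int p * y then of_bool (y \<in> A) else 0)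
       = (\<Sum>j<p. of_bool (y0 + int j * (int p ^ k * r) \<in> A) :: int)"
proof -
  define s where "s = int p ^ k * r"
  have p0: "int p > 0" using prime_gt_0_nat[OF p] by simp
  have n: "n = int p * s" by (simp add: n_eq s_def)
  have s0: "s > 0" using n n_pos p0 by (simp add: zero_less_mult_iff)
  have iff: "n dvd int p * y0 - int p * y \<longleftrightarrow> s dvd y0 - y" for y
    using p0 by (simp add: n flip: right_diff_distrib)
  have "bij_betw (\<lambda>j. (y0 + int j * s) mod n) {..<p} {y \<in> {0..<n}. s dvd y0 - y}"
  proof (rule bij_betwI')
    fix i j assume ij: "i \<in> {..<p}" "j \<in> {..<p}"
    show "((y0 + int i * s) mod n = (y0 + int j * s) mod n) = (i = j)"
    proof
      assume "(y0 + int i * s) mod n = (y0 + int j * s) mod n"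
      then have "int p * s dvd (int i - int j) * s"
        by (simp add: mod_eq_dvd_iff n left_diff_distrib)
      then have "int p dvd int i - int j" using s0 by simp
      then have "int i = int j" by (rule dvd_diff_0_less_eq) (use ij in auto)
      then show "i = j" by simp
    qed simp
  next
    fix i assume "i \<in> {..<p}"
    have "s dvd y0 - (y0 + int i * s) mod n"
    proof -
      have "s dvd n" by (simp add: n)
      moreover have "n dvd (y0 + int i * s) - (y0 + int i * s) mod n"
        by (rule dvd_minus_mod)
      ultimately have "s dvd (y0 + int i * s) - (y0 + int i * s) mod n"
        by (rule dvd_trans)
      then have "s dvd ((y0 + int i * s) - (y0 + int i * s) mod n) - int i * s"
        by (rule dvd_diff) simp
      also have "\<dots> = y0 - (y0 + int i * s) mod n" by simp
      finally show ?thesis .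
    qed
    then show "(y0 + int i * s) mod n \<in> {y \<in> {0..<n}. s dvd y0 - y}"
      using n_pos by simp
  next
    fix y assume y: "y \<in> {y \<in> {0..<n}. s dvd y0 - y}"
    then have "s dvd y - y0" using dvd_diff_commute[of s y y0] by blast
    then obtain t where t: "y - y0 = s * t" by (elim dvdE)
    define j where "j = nat (t mod int p)"
    have j: "int j = t mod int p" using p0 by (simp add: j_def)
    then have "j < p" using pos_mod_bound[OF p0, of t] by linarith
    have "n dvd (y0 + int j * s) - y"
    proof -
      have "(y0 + int j * s) - y = s * (t mod int p - t)" using t by (simp add: j algebra_simps)
      moreover have "int p dvd t mod int p - t" by (simp add: mod_eq_dvd_iff[symmetric])
      ultimately show ?thesis by (simp only: n mult.commute[of "int p"] mult_dvd_mono dvd_refl)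
    qed
    then have "(y0 + int j * s) mod n = y mod n" by (simp add: mod_eq_dvd_iff)
    also have "y mod n = y" using y by simp
    finally have "y = (y0 + int j * s) mod n" by (rule sym)
    then show "\<exists>j\<in>{..<p}. y = (y0 + int j * s) mod n" using \<open>j < p\<close> by blast
  qed
  then have "(\<Sum>j<p. of_bool ((y0 + int j * s) mod n \<in> A) :: int)
      = (\<Sum>y\<in>{y \<in> {0..<n}. s dvd y0 - y}. of_bool (y \<in> A))"
    by (rule sum.reindex_bij_betw)
  moreover have "(\<Sum>y\<in>{0..<n}. if s dvd y0 - y then of_bool (y \<in> A) else 0 :: int)
      = (\<Sum>y\<in>{y \<in> {0..<n}. s dvd y0 - y}. of_bool (y \<in> A))"
    by (rule sum.inter_filter[symmetric]) simp
  ultimately show ?thesis by (simp add: iff saturated_mod[OF sat] s_def)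
qed

text \<open>Up to the automorphisms of \<open>\<int>/n\<close>, this is the set of those \<open>p\<close>-th powers that occur
  in \<open>{x\<^sup>p | x \<in> A}\<close> with multiplicity prime to \<open>p\<close>.\<close>

lemma saturated_frobenius:
  assumes sat: "saturated A"
  shows "saturated {z. int p ^ Suc k dvd z \<and> (z \<in> A) \<noteq> (z + int p ^ k * r \<in> A)}"
proof -
  define f where "f = (\<lambda>x. of_bool (x \<in> A) :: int)"
  define s where "s = int p ^ k * r"
  have p0: "p > 0" and p1: "p > 1" using prime_gt_0_nat[OF p] prime_gt_1_nat[OF p] by simp_all
  have n: "n = int p * s" by (simp add: n_eq s_def)
  have f: "class_constant E f" unfolding f_def class_constant_of_bool by (rule sat)
  define c where "c = (\<lambda>z. \<Sum>y\<in>{0..<n}. if n dvd z - int p * y then f y else 0)"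
  \<comment> \<open>The values are 0 and 1, so the \<open>p\<close>-th powers in the Frobenius
    congruence disappear.\<close>
  have fp: "f y ^ p = f y" for y using p0 by (simp add: f_def)
  have cong: "int p dvd conv_power n f p z - c z" for z
    using conv_power_prime[OF p, of n f z] by (simp only: fp c_def)
  then have iff: "int p dvd conv_power n f p z \<longleftrightarrow> int p dvd c z" for z
    by (metis dvd_diff_commute dvd_diff_right_iff)
  have c_p: "c (int p * y) = (\<Sum>j<p. f (y + int j * s))" for y
    unfolding c_def f_def s_def by (rule sum_pth_roots[OF sat])
  have "int p dvd c z \<longleftrightarrow> \<not> (int p ^ Suc k dvd z \<and> (z \<in> A) \<noteq> (z + s \<in> A))" for z
  proof (cases "int p ^ Suc k dvd z")
    case True
    then obtain z' where z': "z = int p ^ Suc k * z'" by (elim dvdE)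
    \<comment> \<open>\<open>a\<close> inverts \<open>p\<close> modulo \<open>r\<close> and yields a
      \<open>p\<close>-th root \<open>v\<close> of \<open>z\<close> within the subgroup of multiples
      of \<open>p^(k+1)\<close>.\<close>
    obtain a b where ab: "a * int p + b * r = 1"
      using bezout_int[of "int p" r] coprime_p_r by (auto simp: coprime_iff_gcd_eq_1)
    define v where "v = int p ^ Suc k * (a * z')"
    have v: "int p ^ Suc k dvd v" by (simp add: v_def)
    have "z - int p * v = int p ^ Suc k * z' * (a * int p + b * r) - int p * v"
      by (simp only: ab z' mult_1_right)
    also have "\<dots> = n * (b * z')" by (simp add: v_def n_eq algebra_simps)
    finally have zv: "n dvd z - int p * v" by simp
    then have zvs: "n dvd (z + s) - (int p * v + s)" by simp
    have Ezv: "E z v" using E_dvd_diff[OF zv] E_p_mult(1)[OF v] by (rule E_trans)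
    have Ezvs: "E (z + s) (v + s)"
      using E_dvd_diff[OF zvs] E_p_mult(2)[OF v] unfolding s_def by (rule E_trans)
    have zA: "z \<in> A \<longleftrightarrow> v \<in> A" "z + s \<in> A \<longleftrightarrow> v + s \<in> A"
      using saturatedD[OF sat] Ezv Ezvs E_sym[OF Ezv] E_sym[OF Ezvs] by blast+
    have "periodic n (conv_power n f p)" by (rule periodic_conv_power)
    then have "int p dvd c z \<longleftrightarrow> int p dvd c (int p * v)"
      using zv by (simp only: iff[symmetric] periodicD)
    \<comment> \<open>Of the \<open>p\<close> roots of \<open>p v\<close> all but \<open>v\<close>
      are equivalent to \<open>v + s\<close>, so the count is congruent to
      \<open>f v - f (v + s)\<close>, which lies between -1 and 1.\<close>
    also have "c (int p * v) = f v + (\<Sum>j\<in>{1..<p}. f (v + int j * s))"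
      using p0 by (simp add: c_p lessThan_atLeast0 sum.atLeast_Suc_lessThan)
    also have "(\<Sum>j\<in>{1..<p}. f (v + int j * s)) = (\<Sum>j\<in>{1..<p}. f (v + s))"
    proof (rule sum.cong[OF refl])
      fix j assume j: "j \<in> {1..<p}"
      then have "\<not> int p dvd int j" by (auto dest: dvd_imp_le)
      then show "f (v + int j * s) = f (v + s)"
        unfolding s_def by (intro class_constantD[OF f] E_shift_dvd[OF v])
    qed
    also have "f v + (\<Sum>j\<in>{1..<p}. f (v + s)) = f v - f (v + s) + int p * f (v + s)"
      using p1 by (simp add: of_nat_diff left_diff_distrib)
    also have "int p dvd \<dots> \<longleftrightarrow> int p dvd f v - f (v + s)"
      by (simp add: dvd_add_left_iff)
    also have "\<dots> \<longleftrightarrow> (v \<in> A) = (v + s \<in> A)"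
      using p1 by (auto simp: f_def of_bool_def)
    finally show ?thesis using True zA by simp
  next
    case False
    \<comment> \<open>Either \<open>z\<close> has no \<open>p\<close>-th root at all, or its
      \<open>p\<close> roots are equivalent and the count is 0 or \<open>p\<close>.\<close>
    have "int p dvd c z"
    proof (cases "int p dvd z")
      case True
      then obtain y where y: "z = int p * y" by (elim dvdE)
      have "\<not> int p ^ k dvd y" using False y p0 by simp
      then have "f (y + int j * s) = f y" for j
        unfolding s_def using class_constantD[OF f E_shift_not_dvd] by simp
      then show ?thesis by (simp add: y c_p)
    next
      case pz: False
      have "\<not> n dvd z - int p * y" for y
      proof
        assume "n dvd z - int p * y"
        moreover have "int p dvd n" by (simp add: n)
        ultimately have "int p dvd (z - int p * y) + int p * y"
          by (intro dvd_add[OF dvd_trans]) simp_all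
        then show False using pz by simp
      qed
      then show ?thesis by (simp add: c_def)
    qed
    then show ?thesis using False by simp
  qed
  then have "{z. int p ^ Suc k dvd z \<and> (z \<in> A) \<noteq> (z + s \<in> A)}
      = {z. conv_power n f p z \<in> {a. \<not> int p dvd a}}"
    using iff by auto
  then show ?thesis
    unfolding s_def by (simp only: saturated_vimage[OF class_constant_conv_power[OF f]])
qed

end

end

section \<open>A generating class contains a generator\<close>

text \<open>For positive \<open>n\<close> this says that the class of \<open>x\<close> lies in no
  proper subgroup of Z/n. It is stated outside the locale because the induction applies it to other
  moduli and relations.\<close>

definition generating :: "int \<Rightarrow> (int \<Rightarrow> int \<Rightarrow> bool) \<Rightarrow> int \<Rightarrow> bool" where
  "generating n E x \<longleftrightarrow> (\<forall>k. k dvd n \<longrightarrow> (\<forall>y. E x y \<longrightarrow> k dvd y) \<longrightarrow> is_unit k)"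

lemma generatingD: "generating n E x \<Longrightarrow> k dvd n \<Longrightarrow> (\<And>y. E x y \<Longrightarrow> k dvd y) \<Longrightarrow> is_unit k"
  by (auto simp: generating_def)

context rational_schur
begin

text \<open>The stabilizer of a class \<open>X\<close> is saturated because its complement is the
  sum set of \<open>X\<close> and the complement of \<open>X\<close>; here \<open>X = -X\<close>
  enters. Being closed under addition, it is a subgroup.\<close>

lemma stabilizer:
  assumes s: "\<And>y. E x y \<Longrightarrow> E x (y + s)"
  obtains m where "m > 0" "m dvd n" "m dvd s" "saturated {y. m dvd y}"
    "\<And>y t. m dvd t \<Longrightarrow> E x y \<Longrightarrow> E x (y + t)"
proof -
  define R where "R = {t. \<forall>y. E x y \<longrightarrow> E x (y + t)}"
  have R_eq: "R = - {t. \<exists>a\<in>{y. E x y}. t - a \<in> - {y. E x y}}"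
  proof -
    have "(\<forall>y. E x y \<longrightarrow> E x (y + t)) \<longleftrightarrow> (\<forall>a. E x a \<longrightarrow> E x (t - a))" for t
    proof
      assume *: "\<forall>y. E x y \<longrightarrow> E x (y + t)"
      show "\<forall>a. E x a \<longrightarrow> E x (t - a)"
      proof (intro allI impI)
        fix a assume "E x a"
        then have "E x (- a)" using E_sym[OF E_uminus] by (rule E_trans)
        then have "E x (- a + t)" using * by blast
        then show "E x (t - a)" by simp
      qed
    next
      assume *: "\<forall>a. E x a \<longrightarrow> E x (t - a)"
      show "\<forall>y. E x y \<longrightarrow> E x (y + t)"
      proof (intro allI impI)
        fix a assume "E x a"
        then have "E x (- a)" using E_sym[OF E_uminus] by (rule E_trans)
        then have "E x (t - (- a))" using * by blast
        then show "E x (a + t)" by (simp add: add.commute)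
      qed
    qed
    then show ?thesis by (auto simp: R_def)
  qed
  have "saturated R"
    unfolding R_eq by (intro saturated_Compl saturated_plus saturated_class)
  moreover have "0 \<in> R" by (simp add: R_def)
  moreover have "t + u \<in> R" if "t \<in> R" "u \<in> R" for t u
    using that by (simp add: R_def add.assoc[symmetric])
  ultimately obtain m where m: "m > 0" "m dvd n" "R = {x. m dvd x}"
    by (rule saturated_multiples_eq)
  show ?thesis
  proof (rule that[OF m(1,2)])
    have "s \<in> R" using s by (simp add: R_def)
    then show "m dvd s" using m(3) by blast
    show "saturated {y. m dvd y}" using \<open>saturated R\<close> m(3) by simp
    show "E x (y + t)" if "m dvd t" "E x y" for y t
    proof -
      have "t \<in> R" using m(3) that(1) by blast
      then show ?thesis using that(2) by (simp add: R_def)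
    qed
  qed
qed

text \<open>A class with nontrivial stabilizer is a union of cosets of it, so an occurrence of 1 in
  the proper quotient lifts to Z/n.\<close>

lemma E_one_of_periodic:
  assumes IH: "\<forall>m E' x'. m < n \<longrightarrow> rational_schur m E' \<longrightarrow> generating m E' x' \<longrightarrow> E' x' 1"
    and gen: "generating n E x" and s: "0 < s" "s < n" "\<And>y. E x y \<Longrightarrow> E x (y + s)"
  shows "E x 1"
proof -
  obtain m where m: "m > 0" "m dvd n" "m dvd s" "saturated {y. m dvd y}"
    and stab: "\<And>y t. m dvd t \<Longrightarrow> E x y \<Longrightarrow> E x (y + t)"
    using stabilizer[OF s(3)] by blast
  have "m < n" using m(3) s by (meson le_less_trans zdvd_imp_le)
  moreover have "generating m (\<lambda>x y. \<exists>z. E x z \<and> m dvd y - z) x"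
    unfolding generating_def
  proof (intro allI impI)
    fix k assume k: "k dvd m" "\<forall>y. (\<exists>z. E x z \<and> m dvd y - z) \<longrightarrow> k dvd y"
    have "k dvd n" using k(1) m(2) by (rule dvd_trans)
    moreover have "k dvd y" if "E x y" for y
    proof -
      have "E x y \<and> m dvd y - y" using that by simp
      then show ?thesis using k(2) by blast
    qed
    ultimately show "is_unit k" by (rule generatingD[OF gen])
  qed
  ultimately have "\<exists>z. E x z \<and> m dvd 1 - z"
    using IH quotient[OF m(1,2,4)] by blast
  then obtain z where z: "E x z" "m dvd 1 - z" by blast
  then have "E x (z + (1 - z))" using stab by blast
  then show ?thesis by simp
qed

text \<open>The class generates a subgroup, the multiples of some \<open>d\<close>. After division
  by \<open>d\<close> it is a generating class of the restricted Schur ring and so contains 1. The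
  claim is an assumption because this is used both inside the induction and after it.\<close>

lemma class_gcd:
  assumes claim: "\<forall>m E' x'. m \<le> n \<longrightarrow> rational_schur m E' \<longrightarrow> generating m E' x' \<longrightarrow> E' x' 1"
  obtains d where "d > 0" "d dvd n" "saturated {y. d dvd y}" "\<forall>y. E x y \<longrightarrow> d dvd y" "E x d"
proof -
  obtain d where d: "d > 0" "d dvd n" "saturated {y. d dvd y}"
    and dvd: "\<forall>y\<in>{y. E x y}. d dvd y"
    and max: "\<forall>k. k dvd n \<longrightarrow> (\<forall>y\<in>{y. E x y}. k dvd y) \<longrightarrow> k dvd d"
    using generated_multiples[OF saturated_class[of x]] .
  have "d dvd x" using dvd by simp
  then obtain x' where x': "x = d * x'" by (elim dvdE)
  have "E (d * x') (d * 1)"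
  proof (rule claim[rule_format, OF _ subgroup_restrict[OF d]])
    show "n div d \<le> n" using n_pos d(1) zdiv_mono2[of n 1 d] by simp
    show "generating (n div d) (\<lambda>x y. E (d * x) (d * y)) x'"
      unfolding generating_def
    proof (intro allI impI)
      fix k assume k: "k dvd n div d" "\<forall>y. E (d * x') (d * y) \<longrightarrow> k dvd y"
      have "d * k dvd d * (n div d)" using k(1) by (rule mult_dvd_mono[OF dvd_refl])
      then have "d * k dvd n" using d(2) by simp
      moreover have "d * k dvd y" if y: "y \<in> {y. E x y}" for y
      proof -
        obtain y' where y': "y = d * y'" using dvd y by blast
        then have "k dvd y'" using k(2) y x' by simp
        then show ?thesis unfolding y' by (rule mult_dvd_mono[OF dvd_refl])
      qed
      ultimately have "d * k dvd d * 1" using max by simp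
      then show "is_unit k" using d(1) by (simp only: dvd_mult_cancel_left) simp
    qed
  qed
  then show ?thesis using that[OF d] dvd by (simp add: x')
qed

text \<open>\<open>q\<close> is the full power of \<open>p\<close> in \<open>n\<close>, and
  \<open>V\<close> is the Frobenius set of the class of \<open>x\<close>. The second clause is the
  form in which maximality of \<open>q\<close> is used: a subgroup of order divisible by
  \<open>p\<close> is not contained in the multiples of \<open>q\<close>.\<close>

lemma frobenius_class:
  assumes gen: "generating n E x" and p: "prime p" "int p dvd n"
  obtains q V where "q dvd n" "\<forall>d. int p * d dvd n \<longrightarrow> \<not> q dvd d" "saturated V"
    "\<forall>v\<in>V. q dvd v" "\<forall>v\<in>V. E x (v + n div int p)"
    "V = {} \<longrightarrow> (\<forall>y. E x y \<longrightarrow> E x (y + n div int p))"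
proof -
  have p1: "p > 1" using prime_gt_1_nat[OF p(1)] .
  define k where "k = multiplicity (int p) n - 1"
  have prp: "prime (int p)" using p(1) by simp
  have "multiplicity (int p) n > 0"
    using p n_pos prp by (simp add: prime_multiplicity_gt_zero_iff)
  then have Suc_k: "Suc k = multiplicity (int p) n" by (simp add: k_def)
  obtain r where r: "n = int p ^ Suc k * r" "\<not> int p dvd r"
    using multiplicity_decompose'[of n "int p"] n_pos p1 Suc_k by auto
  define q where "q = int p ^ Suc k"
  define s where "s = int p ^ k * r"
  have s: "n div int p = s" using p1 by (simp add: r(1) s_def)
  have n: "n = q * r" "n = int p * s" by (simp_all add: q_def s_def r(1))
  define V where "V = {z. q dvd z \<and> (E x z \<noteq> E x (z + s))}"
  have sat: "saturated V"
    using saturated_frobenius[OF p(1) r saturated_class, of x] by (simp add: V_def q_def s_def)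
  \<comment> \<open>If \<open>V\<close> met the class of \<open>x\<close>, it would contain it, and
    the class would consist of multiples of \<open>p\<close>.\<close>
  have Vx: "\<not> E x v" if "v \<in> V" for v
  proof
    assume v: "E x v"
    have "int p dvd y" if "E x y" for y
    proof -
      have "y \<in> V" using saturatedD[OF sat E_trans[OF E_sym[OF v] that] \<open>v \<in> V\<close>] .
      then show ?thesis by (auto simp: V_def q_def intro: dvd_mult_left)
    qed
    then have "is_unit (int p)" by (rule generatingD[OF gen p(2)])
    then show False using p1 by simp
  qed
  show ?thesis
  proof (rule that)
    show "q dvd n" by (simp add: n(1))
    show "\<forall>d. int p * d dvd n \<longrightarrow> \<not> q dvd d"
    proof (intro allI impI notI)
      fix d assume that: "int p * d dvd n" and "q dvd d"
      from \<open>q dvd d\<close> have "int p * q dvd int p * d" by (rule mult_dvd_mono[OF dvd_refl])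
      then have "q * int p dvd q * r" using that n(1) by (metis dvd_trans mult.commute)
      then show False using r(2) p1 by (simp add: q_def)
    qed
    show "saturated V" by (rule sat)
    show "\<forall>v\<in>V. q dvd v" by (simp add: V_def)
    show "\<forall>v\<in>V. E x (v + n div int p)"
      using Vx by (auto simp: V_def s)
    show "V = {} \<longrightarrow> (\<forall>y. E x y \<longrightarrow> E x (y + n div int p))"
    proof (intro allI impI)
      fix y assume V: "V = {}" and y: "E x y"
      have V': "E x z \<longleftrightarrow> E x (z + s)" if "q dvd z" for z
        using V that by (auto simp: V_def)
      \<comment> \<open>Either the coset of \<open>y\<close> lies in one class, or \<open>y\<close>
        is its special element, or \<open>y\<close> is one of the other elements of a coset that has
        a special element.\<close>
      consider "\<not> int p ^ k dvd y" | "q dvd y" | "int p ^ k dvd y" "\<not> q dvd y" by blast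
      then have "E x (y + s)"
      proof cases
        case 1
        then show ?thesis
          using E_shift_not_dvd[OF p(1) r 1, of 1] y E_trans by (simp add: s_def)
      next
        case 2
        then show ?thesis using V' y by simp
      next
        case 3
        then obtain w where w: "y = int p ^ k * w" by (elim dvdE)
        obtain a b where ab: "a * int p + b * r = 1"
          using bezout_int[of "int p" r] prp r(2) by (auto simp: coprime_iff_gcd_eq_1[symmetric] prime_imp_coprime)
        \<comment> \<open>By Bezout \<open>y\<close> is \<open>j\<close> steps of length
          \<open>s\<close> away from a special element \<open>v\<close>; \<open>p\<close> does not
          divide \<open>j\<close>, since \<open>q\<close> does not divide \<open>y\<close>.\<close>
        define j where "j = w * b"
        define v where "v = q * (w * a)"
        have "v + j * s = int p ^ k * w * (a * int p + b * r)"
          by (simp add: v_def j_def s_def q_def algebra_simps)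
        then have y_eq: "y = v + j * s" by (simp only: ab w mult_1_right)
        have qv: "q dvd v" by (simp add: v_def)
        have "\<not> int p dvd j"
        proof
          assume "int p dvd j"
          then obtain i where "j = int p * i" by (elim dvdE)
          then have "j * s = q * (i * r)" by (simp add: s_def q_def)
          then have "q dvd y" using qv by (simp add: y_eq)
          then show False using 3 by simp
        qed
        then have "E y (v + s)"
          using E_shift_dvd[OF p(1) r, of v j] qv by (simp add: q_def s_def y_eq)
        then have vs: "E x (v + s)" using y E_trans by blast
        \<comment> \<open>One more step leads back to \<open>v\<close> if \<open>p\<close> divides
          \<open>j + 1\<close>, and to another element equivalent to \<open>v + s\<close> otherwise.
          In the first case emptiness of \<open>V\<close> transfers membership from
          \<open>v + s\<close> to \<open>v\<close>.\<close>
        show ?thesis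
        proof (cases "int p dvd j + 1")
          case True
          then obtain i where i: "j + 1 = int p * i" by (elim dvdE)
          have "(y + s) - v = (j + 1) * s" by (simp add: y_eq algebra_simps)
          also have "\<dots> = n * i" by (simp add: i n(2))
          finally have "E (y + s) v" by (intro E_dvd_diff) simp
          moreover have "E x v" using V'[OF qv] vs by simp
          ultimately show ?thesis using E_sym E_trans by blast
        next
          case False
          then have "E (v + (j + 1) * s) (v + s)"
            using E_shift_dvd[OF p(1) r, of v "j + 1"] qv by (simp add: q_def s_def)
          moreover have "v + (j + 1) * s = y + s" by (simp add: y_eq algebra_simps)
          ultimately show ?thesis using vs E_sym E_trans by metis
        qed
      qed
      then show "E x (y + n div int p)" by (simp add: s)
    qed
  qed
qed

end

text \<open>If the stabilizer of the class of \<open>x\<close> is trivial, take a minimal nontrivial subgroup \<open>d\<int>/n\<close> of the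
  Schur ring. For a prime \<open>p\<close> dividing its order, the set \<open>V\<close> of lemma \<open>frobenius_class\<close> generates a
  subgroup meeting it trivially, hence a complement \<open>h\<int>/n\<close>. By induction the nonzero elements
  of \<open>d\<int>/n\<close> form a single class and \<open>h \<in> V\<close>. As \<open>V\<close> translated by an element of order \<open>p\<close> lies in
  the class of \<open>x\<close>, counting shows that the generator \<open>d + h\<close> does too.\<close>

lemma (in rational_schur) E_one_step:
  assumes IH: "\<forall>m E' x'. m < n \<longrightarrow> rational_schur m E' \<longrightarrow> generating m E' x' \<longrightarrow> E' x' 1"
    and gen: "generating n E x"
  shows "E x 1"
proof (cases "n = 1")
  case True
  then show ?thesis by (intro E_gcd) simp
next
  case False
  then have n1: "n > 1" using n_pos by simp
  \<comment> \<open>A larger \<open>d\<close> gives a smaller subgroup, and \<open>n\<close>, the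
    trivial one, is excluded; so the maximum is a minimal nontrivial subgroup.\<close>
  define D where "D = {d. 0 < d \<and> d < n \<and> d dvd n \<and> saturated {y. d dvd y}}"
  have "1 \<in> D" using n1 by (simp add: D_def saturated_def)
  moreover have "finite D" by (rule finite_subset[of _ "{0..n}"]) (auto simp: D_def)
  ultimately have "Max D \<in> D" "\<And>e. e \<in> D \<Longrightarrow> e \<le> Max D" by (auto intro: Max_in)
  then obtain d where d: "0 < d" "d < n" "d dvd n" "saturated {y. d dvd y}"
    and maxD: "\<And>e. e \<in> D \<Longrightarrow> e \<le> d" by (auto simp: D_def)
  have max: "e = d \<or> e = n" if "d dvd e" "e dvd n" "saturated {y. e dvd y}" "e > 0" for e
  proof (cases "e < n")
    case True
    then have "e \<in> D" using that by (simp add: D_def)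
    then show ?thesis using maxD[of e] that zdvd_imp_le[of d e] by simp
  next
    case False
    then show ?thesis using that n_pos zdvd_imp_le[of e n] by simp
  qed
  define h where "h = n div d"
  have n_dh: "n = d * h" using d by (simp add: h_def)
  have h1: "h > 1"
  proof -
    have "h > 0" using n_dh n_pos d(1) by (simp add: zero_less_mult_iff)
    moreover have "h \<noteq> 1" using n_dh d(2) by auto
    ultimately show ?thesis by simp
  qed
  then obtain p' where p': "prime p'" "p' dvd h"
    using prime_divisor_exists[of h] by auto
  define p where "p = nat p'"
  have p: "prime p" "int p dvd h" using p' by (simp_all add: p_def prime_ge_0_int)
  have p1: "p > 1" using prime_gt_1_nat[OF p(1)] .
  define s where "s = n div int p"
  have pdn: "int p * d dvd n" using p(2) by (simp add: n_dh mult.commute)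
  have pn: "int p dvd n" using p(2) by (simp add: n_dh)
  then have n_ps: "n = int p * s" by (simp add: s_def)
  have s: "0 < s" using n_ps n_pos p1 by (simp add: zero_less_mult_iff)
  then have sn: "s < n" using n_ps p1 by simp
  have n_s: "\<not> n dvd s" using s sn zdvd_imp_le[of n s] by auto
  have d_s: "d dvd s"
    using pdn n_ps p1 by (simp add: mult.commute[of _ d] mult.commute[of _ s])
  show ?thesis
  proof (cases "d = 1")
    case True
    \<comment> \<open>There are no proper nontrivial subgroups here. Every generating class is shown
      to be the class of \<open>s\<close>, and this applies to the class of 1 as well. If
      \<open>V\<close> is empty, the stabilizer is all of Z/n; otherwise \<open>V\<close> generates
      the trivial subgroup, and the translate of 0 by \<open>s\<close> lies in the class.\<close>
    have *: "E z s" if z: "generating n E z" for z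
    proof -
      have nonzero: "\<not> E z 0"
      proof
        assume "E z 0"
        then have "n dvd y" if "E z y" for y using that E_zero E_sym E_trans by blast
        then have "is_unit n" by (rule generatingD[OF z dvd_refl])
        then show False using n1 by simp
      qed
      obtain q V where q: "q dvd n" "\<forall>d. int p * d dvd n \<longrightarrow> \<not> q dvd d" and V: "saturated V"
        "\<forall>v\<in>V. q dvd v" "\<forall>v\<in>V. E z (v + s)"
        "V = {} \<longrightarrow> (\<forall>y. E z y \<longrightarrow> E z (y + s))"
        using frobenius_class[OF z p(1) pn] unfolding s_def .
      show ?thesis
      proof (cases "V = {}")
        case True
        obtain m where m: "m > 0" "m dvd n" "m dvd s" "saturated {y. m dvd y}"
          and stab: "\<And>y t. m dvd t \<Longrightarrow> E z y \<Longrightarrow> E z (y + t)"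
          using stabilizer[of z s] V(4) True by blast
        have "m \<le> s" using m(3) s by (rule zdvd_imp_le)
        then have "m = 1" using max[of m] m \<open>d = 1\<close> sn by auto
        then have "E z (z + (- z))" by (intro stab) simp_all
        then show ?thesis using nonzero by simp
      next
        case False
        then obtain v where v: "v \<in> V" by blast
        obtain e where e: "e > 0" "e dvd n" "saturated {y. e dvd y}" "\<forall>x\<in>V. e dvd x"
          "\<forall>k. k dvd n \<longrightarrow> (\<forall>x\<in>V. k dvd x) \<longrightarrow> k dvd e"
          using generated_multiples[OF V(1)] .
        have "\<not> q dvd 1" using q(2)[rule_format, of 1] pn by simp
        moreover have "q dvd e" using q(1) V(2) e(5) by blast
        ultimately have "e = n" using max[of e] e \<open>d = 1\<close> by auto
        then have "n dvd v" using e(4) v by blast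
        then have "E (v + s) s" by (intro E_dvd_diff) simp
        then show ?thesis using V(3) v E_trans by blast
      qed
    qed
    have "generating n E 1"
      unfolding generating_def using E_refl by blast
    then have "E 1 s" by (rule *)
    then show ?thesis using *[OF gen] E_sym E_trans by blast
  next
    case False
    then have d1: "d > 1" using d(1) by simp
    then have hn: "h < n" using n_dh h1 by simp
    obtain q V where q: "q dvd n" "\<forall>d. int p * d dvd n \<longrightarrow> \<not> q dvd d" and V: "saturated V"
      "\<forall>v\<in>V. q dvd v" "\<forall>v\<in>V. E x (v + s)"
      "V = {} \<longrightarrow> (\<forall>y. E x y \<longrightarrow> E x (y + s))"
      using frobenius_class[OF gen p(1) pn] unfolding s_def .
    show ?thesis
    proof (cases "V = {}")
      case True
      then show ?thesis using V(4) by (intro E_one_of_periodic[OF IH gen s sn]) blast+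
    next
      case False
      then obtain v0 where v0: "v0 \<in> V" by blast
      obtain e where e: "e > 0" "e dvd n" "saturated {y. e dvd y}" "\<forall>x\<in>V. e dvd x"
        "\<forall>k. k dvd n \<longrightarrow> (\<forall>x\<in>V. k dvd x) \<longrightarrow> k dvd e"
        using generated_multiples[OF V(1)] .
      \<comment> \<open>\<open>q\<close> separates the two subgroups: it divides \<open>e\<close>,
        but not \<open>d\<close>, whose multiples have order divisible by \<open>p\<close>.
        Minimality then makes the intersection trivial.\<close>
      have "\<not> q dvd d" using q(2) pdn by blast
      moreover have "q dvd e" using q(1) V(2) e(5) by blast
      ultimately have "\<not> e dvd d" using dvd_trans by blast
      then have "lcm d e \<noteq> d" by (metis dvd_lcm2)
      moreover have "lcm d e > 0" using d(1) e(1) by (simp add: lcm_pos_int)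
      ultimately have lcm: "lcm d e = n"
        using max[OF _ _ saturated_multiples_lcm[OF d(4) e(3)]] d(3) e(2) by auto
      \<comment> \<open>\<open>V\<close> plus the nonzero multiples of \<open>d\<close> is a
        saturated set containing \<open>v0 + s\<close>, hence the whole class of
        \<open>x\<close>.\<close>
      have satK: "saturated ({y. d dvd y} - {y. n dvd y})"
        by (intro saturated_Diff d(4) saturated_zero)
      have "v0 + s \<in> {w. \<exists>v\<in>V. w - v \<in> {y. d dvd y} - {y. n dvd y}}"
        using v0 d_s n_s by (auto intro!: bexI[of _ v0])
      moreover have "E x (v0 + s)" using V(3) v0 by blast
      ultimately have XW: "\<exists>v\<in>V. d dvd y - v" if "E x y" for y
        using saturatedD[OF saturated_plus[OF V(1) satK] E_trans[OF E_sym that]] by blast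
      \<comment> \<open>The class of \<open>x\<close> lies in the sum of the two subgroups and
        generates Z/n, so they are complementary.\<close>
      have "is_unit (gcd d e)"
      proof (rule generatingD[OF gen])
        show "gcd d e dvd n" using d(3) by (meson dvd_trans gcd_dvd1)
        fix y assume "E x y"
        then obtain v where v: "v \<in> V" "d dvd y - v" using XW by blast
        then have "gcd d e dvd (y - v) + v"
          using e(4) by (intro dvd_add) (meson dvd_trans gcd_dvd1 gcd_dvd2)+
        then show "gcd d e dvd y" by simp
      qed
      then have cop: "coprime d e" by (simp add: coprime_iff_gcd_eq_1 is_unit_gcd_iff)
      then have "d * e = n" using lcm d(1) e(1) by (simp add: lcm_coprime)
      then have e_h: "e = h" using n_dh d(1) by simp
      have cop: "coprime d h" and hV: "\<And>v. v \<in> V \<Longrightarrow> h dvd v" and satH: "saturated {y. h dvd y}"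
        and hn': "h dvd n" "h > 0"
        using cop e e_h by auto
      have n_div_h: "n div h = d" using n_dh hn' by simp
      interpret K: rational_schur h "\<lambda>a b. E (d * a) (d * b)"
        unfolding h_def by (rule subgroup_restrict[OF d(1,3,4)])
      interpret H: rational_schur d "\<lambda>a b. E (h * a) (h * b)"
        using subgroup_restrict[OF hn'(2,1) satH] by (simp only: n_div_h)
      \<comment> \<open>The class of \<open>t\<close> generates the multiples of some
        \<open>d * c\<close> and contains \<open>d * c\<close>; minimality of \<open>d\<close>
        leaves only \<open>c = 1\<close>.\<close>
      have K_atom: "E t d" if t: "d dvd t" "\<not> n dvd t" for t
      proof -
        obtain t' where t': "t = d * t'" using t(1) by (elim dvdE)
        obtain c where c: "c > 0" "c dvd h" "K.saturated {y. c dvd y}"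
          "\<forall>y. E (d * t') (d * y) \<longrightarrow> c dvd y" "E (d * t') (d * c)"
          using K.class_gcd[of t'] IH hn by (metis le_less_trans)
        have "saturated {y. d * c dvd y}"
          unfolding saturated_def
        proof (intro allI impI)
          fix a b assume ab: "E a b" and "a \<in> {y. d * c dvd y}"
          then obtain a' where a': "a = d * a'" "c dvd a'" using d(1) by (auto simp: dvd_def mult.assoc)
          then have "d dvd b" using saturatedD[OF d(4) ab] by simp
          then obtain b' where b': "b = d * b'" by (elim dvdE)
          have "c dvd b'" using K.saturatedD[OF c(3), of a' b'] ab a' b' by simp
          then show "b \<in> {y. d * c dvd y}" by (simp add: b' mult_dvd_mono)
        qed
        moreover have "d * c dvd n" unfolding n_dh using c(2) by (rule mult_dvd_mono[OF dvd_refl])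
        ultimately have "d * c = d \<or> d * c = n" using max[of "d * c"] d(1) c(1) by simp
        then have "c = 1 \<or> c = h" using d(1) n_dh by auto
        moreover have "c \<noteq> h"
        proof
          assume "c = h"
          then have "h dvd t'" using c(4) by simp
          then show False using t(2) by (simp add: t' n_dh)
        qed
        ultimately show ?thesis using c(5) t' by simp
      qed
      obtain v where v: "v \<in> V" "d dvd x - v" using XW[OF E_refl] by blast
      obtain v' where v': "v = h * v'" using hV[OF v(1)] by (elim dvdE)
      obtain c where c: "c > 0" "c dvd d" 
          "\<forall>y. E (h * v') (h * y) \<longrightarrow> c dvd y" "E (h * v') (h * c)"
        using H.class_gcd[of v'] IH d(2) by (metis le_less_trans)
      \<comment> \<open>Modulo \<open>d\<close> every element of the class of \<open>x\<close>
        agrees with one of the class of \<open>v\<close>. So \<open>c\<close>, which divides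
        \<open>d\<close> and the class of \<open>v\<close>, divides the class of
        \<open>x\<close>.\<close>
      have "is_unit c"
      proof (rule generatingD[OF gen])
        show "c dvd n" using c(2) d(3) by (rule dvd_trans)
        fix y assume y: "E x y"
        have "x \<in> {w. \<exists>a. E v a \<and> d dvd w - a}" using v(2) E_refl[of v] by blast
        then obtain a where a: "E v a" "d dvd y - a"
          using saturatedD[OF saturated_coset[OF d(4)] y] by blast
        have "h dvd a" using saturatedD[OF satH a(1)] hV[OF v(1)] by simp
        then obtain a' where a': "a = h * a'" by (elim dvdE)
        have "c dvd a'" using c(3) a(1) v' a' by simp
        then have "c dvd a" unfolding a' by (rule dvd_mult)
        with dvd_trans[OF c(2) a(2)] have "c dvd (y - a) + a" by (rule dvd_add)
        then show "c dvd y" by simp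
      qed
      then have "c = 1" using c(1) by simp
      then have "E v h" using c(4) v' by simp
      then have hV': "h \<in> V" using saturatedD[OF V(1)] v(1) by blast
      define C where "C = {c. E h c}"
      have satC: "saturated C" unfolding C_def by (rule saturated_class)
      have CV: "C \<subseteq> V" using saturatedD[OF V(1) _ hV'] by (auto simp: C_def)
      have Cneg: "- c \<in> C \<longleftrightarrow> c \<in> C" for c by (rule saturated_uminus[OF satC])
      \<comment> \<open>These sets record the ways to write \<open>k\<close> as a sum of an element
        of \<open>C\<close> and an element of the class of \<open>x\<close>. For
        \<open>k = s\<close> all of \<open>C\<close> occurs. As \<open>s\<close> and
        \<open>d\<close> are equivalent, the same number occurs for \<open>k = d\<close>, hence
        again all of \<open>C\<close>, in particular \<open>-h\<close>.\<close>
      let ?S = "\<lambda>k. {y \<in> {0..<n}. y \<in> C \<and> k - y \<in> {z. E x z}}"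
      have "E x (s - c)" if "c \<in> C" for c
      proof -
        have "- c \<in> V" using that CV Cneg by blast
        then have "E x (- c + s)" using V(3) by blast
        then show ?thesis by simp
      qed
      then have Ss: "?S s = {y \<in> {0..<n}. y \<in> C}" by auto
      have "E s d" using K_atom[OF d_s n_s] .
      then have "card (?S s) = card (?S d)" by (rule saturated_card[OF satC saturated_class])
      then have "card (?S d) = card {y \<in> {0..<n}. y \<in> C}" by (simp only: Ss)
      moreover have "finite {y \<in> {0..<n}. y \<in> C}" by (rule finite_subset[of _ "{0..<n}"]) auto
      ultimately have Sd: "?S d = {y \<in> {0..<n}. y \<in> C}" by (intro card_subset_eq) auto
      have "h \<in> C" by (simp add: C_def)
      then have "(- h) mod n \<in> {y \<in> {0..<n}. y \<in> C}"
        using Cneg saturated_mod[OF satC] n_pos by simp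
      then have "(- h) mod n \<in> ?S d" by (simp only: Sd)
      then have "E x (d - (- h) mod n)" by blast
      then have "E x (d - (- h))"
        using saturated_diff_mod[OF saturated_class, of d "- h" x] by simp
      moreover have "gcd (d + h) n = gcd 1 n"
      proof -
        have "gcd d h = 1" using cop by (simp only: coprime_iff_gcd_eq_1)
        then have "gcd (d + h) d = 1" "gcd (d + h) h = 1"
          using gcd_add1[of h d] gcd_add1[of d h] gcd.commute[of d h] by (simp_all only: add.commute[of h d])
        then have "coprime (d + h) (d * h)"
          by (intro coprime_mult_right_iff[THEN iffD2] conjI) (simp_all only: coprime_iff_gcd_eq_1)
        then show ?thesis by (simp add: n_dh)
      qed
      then have "E (d + h) 1" by (rule E_gcd)
      ultimately show ?thesis using E_trans by simp
    qed
  qed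
qed

theorem rational_schur_class_contains_one:
  assumes "rational_schur n E" "generating n E x"
  shows "E x 1"
  using assms
proof (induction "nat n" arbitrary: n E x rule: less_induct)
  case less
  then interpret rational_schur n E by simp
  show ?case
  proof (rule E_one_step[OF _ less.prems(2)], intro allI impI)
    fix m :: int and E' x' assume m: "m < n" "rational_schur m E'" "generating m E' x'"
    show "E' x' 1" by (rule less.hyps[OF _ m(2,3)]) (use m(1) n_pos in simp)
  qed
qed

context rational_schur
begin

text \<open>This is Muzychuk's theorem. The coefficients are peeled off in order of increasing \<open>d\<close>: the least
  \<open>d > 0\<close> with \<open>f d \<noteq> 0\<close> divides its whole class, so its multiples are saturated.\<close>

theorem class_constant_decomposition:
  fixes f :: "int \<Rightarrow> int"
  assumes "class_constant E f"
  obtains c where "f = (\<lambda>x. \<Sum>d\<in>{d. 0 < d \<and> d dvd n \<and> saturated {y. d dvd y}}. c d * of_bool (d dvd x))"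
proof -
  define D where "D = {d. 0 < d \<and> d dvd n \<and> saturated {y. d dvd y}}"
  have fin: "finite D"
    by (rule finite_subset[of _ "{0..n}"]) (use n_pos in \<open>auto simp: D_def zdvd_imp_le\<close>)
  \<comment> \<open>The bound \<open>j\<close> below which \<open>f\<close> vanishes is raised step
    by step. Beyond \<open>n\<close> the function vanishes also at \<open>n\<close>, hence at 0, and
    so everywhere.\<close>
  have "\<exists>c. f = (\<lambda>x. \<Sum>d\<in>D. c d * of_bool (d dvd x))"
    if "class_constant E f" "\<And>x. 0 < x \<Longrightarrow> x < j \<Longrightarrow> f x = 0" "0 < j" for f :: "int \<Rightarrow> int" and j
    using that
  proof (induction "nat (n + 1 - j)" arbitrary: f j rule: less_induct)
    case less
    show ?case
    proof (cases "j > n")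
      case True
      have "f x = 0" for x
      proof (cases "n dvd x")
        case True
        then have "f x = f n" by (intro periodicD[OF class_constant_periodic[OF less.prems(1)]]) simp
        then show ?thesis using less.prems(2)[of n] n_pos \<open>j > n\<close> by simp
      next
        case False
        then have "0 < x mod n" using n_pos by (simp add: dvd_eq_mod_eq_0 order_less_le)
        moreover have "x mod n < j" using n_pos \<open>j > n\<close> by (meson less_trans pos_mod_bound)
        ultimately have "f (x mod n) = 0" by (rule less.prems(2))
        then show ?thesis using periodic_mod[OF class_constant_periodic[OF less.prems(1)]] by simp
      qed
      then show ?thesis by (intro exI[of _ "\<lambda>_. 0"]) auto
    next
      case False
      show ?thesis
      proof (cases "f j = 0")
        case True
        show ?thesis
        proof (rule less.hyps[OF _ less.prems(1)])
          show "nat (n + 1 - (j + 1)) < nat (n + 1 - j)" using False by simp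
          show "0 < j + 1" using less.prems(3) by simp
          show "f x = 0" if "0 < x" "x < j + 1" for x
            using that less.prems(2)[of x] True by (cases "x = j") auto
        qed
      next
        case fj: False
        obtain d where d: "d > 0" "d dvd n" "saturated {y. d dvd y}" "\<forall>y. E j y \<longrightarrow> d dvd y" "E j d"
          using class_gcd[of j] rational_schur_class_contains_one by blast
        have "d \<le> j" using d(4) less.prems(3) by (intro zdvd_imp_le) simp_all
        moreover have "f d \<noteq> 0" using class_constantD[OF less.prems(1) d(5)] fj by simp
        then have "\<not> d < j" using less.prems(2) d(1) by blast
        ultimately have dj: "d = j" by simp
        then have jD: "j \<in> D" using d by (simp add: D_def)
        \<comment> \<open>Subtracting this multiple removes the value at \<open>j\<close> and leaves
          the zeros at positive arguments below \<open>j\<close> untouched.\<close>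
        define g where "g = (\<lambda>x. f x - f j * of_bool (j dvd x))"
        have "class_constant E (\<lambda>x. of_bool (x \<in> {x. j dvd x}) :: int)"
          using d(3) by (simp only: class_constant_of_bool dj)
        then have "f x - f j * of_bool (j dvd x) = f y - f j * of_bool (j dvd y)" if "E x y" for x y
          using that less.prems(1) by (simp add: class_constant_def)
        then have "class_constant E g"
          unfolding class_constant_def g_def by blast
        then have "\<exists>c. g = (\<lambda>x. \<Sum>d\<in>D. c d * of_bool (d dvd x))"
        proof (rule less.hyps[rotated])
          show "nat (n + 1 - (j + 1)) < nat (n + 1 - j)" using False by simp
          show "0 < j + 1" using less.prems(3) by simp
          show "g x = 0" if "0 < x" "x < j + 1" for x
          proof (cases "x = j")
            case False
            then have "x < j" using that by simp
            then have "\<not> j dvd x" using that(1) zdvd_imp_le[of j x] by auto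
            then show ?thesis using less.prems(2)[OF that(1) \<open>x < j\<close>] by (simp add: g_def)
          qed (simp add: g_def)
        qed
        then obtain c where c: "g = (\<lambda>x. \<Sum>d\<in>D. c d * of_bool (d dvd x))" by blast
        have "f x = (\<Sum>d\<in>D. (c d + (if d = j then f j else 0)) * of_bool (d dvd x))" for x
        proof -
          have "f x = g x + f j * of_bool (j dvd x)" by (simp add: g_def)
          also have "f j * of_bool (j dvd x) = (\<Sum>d\<in>D. if d = j then f j * of_bool (j dvd x) else 0)"
            using fin jD by simp
          also have "g x + \<dots> = (\<Sum>d\<in>D. (c d + (if d = j then f j else 0)) * of_bool (d dvd x))"
            unfolding c sum.distrib[symmetric] by (intro sum.cong) (auto simp: distrib_right)
          finally show ?thesis .
        qed
        then show ?thesis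
          by (intro exI[of _ "\<lambda>d. c d + (if d = j then f j else 0)"] ext)
      qed
    qed
  qed
  from this[OF assms, of 1] show ?thesis using that unfolding D_def by auto
qed

end

section \<open>The rational group algebra of a cyclic group\<close>

locale finite_cyclic_group = group G for G (structure) +
  fixes g
  assumes finite_carrier: "finite (carrier G)"
    and g_closed: "g \<in> carrier G"
    and carrier_eq: "carrier G = range (\<lambda>x::int. g [^] x)"
begin

abbreviation QG :: "('a \<Rightarrow> rat) ring" where "QG \<equiv> group_algebra G"

definition n :: int where "n = int (ord g)"

lemma n_pos: "n > 0"
  using ord_ge_1[OF finite_carrier g_closed] by (simp add: n_def)

lemma pow_eq_iff: "g [^] x = g [^] y \<longleftrightarrow> n dvd x - y" for x y :: int
  using int_pow_eq[OF g_closed, of y x] by (auto simp: n_def)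

lemma pow_closed: "g [^] x \<in> carrier G" for x :: int
  using g_closed by simp

lemma pow_add: "g [^] (x + y) = g [^] x \<otimes> g [^] y" for x y :: int
  using g_closed by (simp add: int_pow_mult)

lemma carrierE:
  assumes "a \<in> carrier G"
  obtains x :: int where "a = g [^] x"
  using assms carrier_eq by auto

sublocale comm_group G
proof (rule group_comm_groupI)
  fix a b assume "a \<in> carrier G" "b \<in> carrier G"
  then obtain x y :: int where "a = g [^] x" "b = g [^] y" by (metis carrierE)
  then show "a \<otimes> b = b \<otimes> a" by (simp add: pow_add[symmetric] add.commute)
qed

lemma bij_pow: "bij_betw (\<lambda>x::int. g [^] x) {0..<n} (carrier G)"
proof (rule bij_betwI')
  fix x y :: int assume "x \<in> {0..<n}" "y \<in> {0..<n}"
  then show "(g [^] x = g [^] y) = (x = y)"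
    using dvd_diff_0_less_eq by (auto simp: pow_eq_iff)
next
  fix a assume "a \<in> carrier G"
  then obtain x :: int where "a = g [^] x" by (rule carrierE)
  then have "a = g [^] (x mod n)" by (simp add: pow_eq_iff dvd_minus_mod)
  then show "\<exists>x\<in>{0..<n}. a = g [^] x" using n_pos by (intro bexI[of _ "x mod n"]) simp_all
qed (rule pow_closed)

lemma sum_carrier: "(\<Sum>a\<in>carrier G. F a) = (\<Sum>x\<in>{0..<n}. F (g [^] x))"
  by (rule sum.reindex_bij_betw[OF bij_pow, symmetric])

lemma periodic_pow: "periodic n (\<lambda>x. u (g [^] x))"
  unfolding periodic_def by (metis pow_eq_iff)

text \<open>The bridge by which all facts on \<open>conv\<close> are carried to the group algebra,
  starting with the ring axioms.\<close>

lemma mult_pow: "(u \<otimes>\<^bsub>QG\<^esub> v) (g [^] x) = conv n (\<lambda>x. u (g [^] x)) (\<lambda>x. v (g [^] x)) x"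
proof -
  have "(u \<otimes>\<^bsub>QG\<^esub> v) (g [^] x)
      = (\<Sum>y\<in>{0..<n}. \<Sum>z\<in>{0..<n}. if g [^] y \<otimes> g [^] z = g [^] x then u (g [^] y) * v (g [^] z) else 0)"
    by (simp add: group_algebra_def sum_carrier)
  also have "\<dots> = (\<Sum>y\<in>{0..<n}. u (g [^] y) * v (g [^] (x - y)))"
  proof (rule sum.cong[OF refl])
    fix y
    have iff: "g [^] y \<otimes> g [^] z = g [^] x \<longleftrightarrow> z = (x - y) mod n" if "z \<in> {0..<n}" for z
    proof -
      have "g [^] y \<otimes> g [^] z = g [^] x \<longleftrightarrow> n dvd (y + z) - x" by (simp only: pow_add[symmetric] pow_eq_iff)
      also have "(y + z) - x = z - (x - y)" by simp
      also have "n dvd \<dots> \<longleftrightarrow> z mod n = (x - y) mod n" by (simp only: mod_eq_dvd_iff)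
      also have "z mod n = z" using that by simp
      finally show ?thesis .
    qed
    have "(\<Sum>z\<in>{0..<n}. if g [^] y \<otimes> g [^] z = g [^] x then u (g [^] y) * v (g [^] z) else 0)
        = (\<Sum>z\<in>{0..<n}. if z = (x - y) mod n then u (g [^] y) * v (g [^] z) else 0)"
      by (rule sum.cong) (simp_all add: iff)
    also have "\<dots> = u (g [^] y) * v (g [^] ((x - y) mod n))" using n_pos by simp
    also have "v (g [^] ((x - y) mod n)) = v (g [^] (x - y))" by (rule periodic_mod[OF periodic_pow])
    finally show "(\<Sum>z\<in>{0..<n}. if g [^] y \<otimes> g [^] z = g [^] x then u (g [^] y) * v (g [^] z) else 0)
      = u (g [^] y) * v (g [^] (x - y))" .
  qed
  finally show ?thesis by (simp add: conv_def)
qed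

lemma QG_carrier: "u \<in> carrier QG \<longleftrightarrow> (\<forall>a. a \<notin> carrier G \<longrightarrow> u a = 0)"
  by (simp add: group_algebra_def)

lemma QG_add: "u \<oplus>\<^bsub>QG\<^esub> v = (\<lambda>a. u a + v a)"
  by (simp add: group_algebra_def)

lemma QG_zero: "\<zero>\<^bsub>QG\<^esub> = (\<lambda>a. 0)"
  by (simp add: group_algebra_def)

lemma QG_one: "\<one>\<^bsub>QG\<^esub> = (\<lambda>a. if a = \<one> then 1 else 0)"
  by (simp add: group_algebra_def)

lemma mult_outside: "a \<notin> carrier G \<Longrightarrow> (u \<otimes>\<^bsub>QG\<^esub> v) a = 0"
  unfolding group_algebra_def by (auto intro!: sum.neutral)

lemma QG_eqI:
  assumes "u \<in> carrier QG" "v \<in> carrier QG" "\<And>x::int. u (g [^] x) = v (g [^] x)"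
  shows "u = v"
  using assms unfolding QG_carrier by (metis carrierE ext)

lemma mult_in_carrier: "u \<otimes>\<^bsub>QG\<^esub> v \<in> carrier QG"
  by (simp add: QG_carrier mult_outside)

lemma one_pow: "\<one>\<^bsub>QG\<^esub> (g [^] x) = (if n dvd x then 1 else 0)" for x :: int
  using pow_eq_iff[of x 0] by (simp add: QG_one)

lemma cring_QG: "cring QG"
proof (rule cringI)
  show "abelian_group QG"
  proof (rule abelian_groupI)
    fix u assume "u \<in> carrier QG"
    then show "\<exists>v\<in>carrier QG. v \<oplus>\<^bsub>QG\<^esub> u = \<zero>\<^bsub>QG\<^esub>"
      by (intro bexI[of _ "\<lambda>a. - u a"]) (auto simp: QG_add QG_zero QG_carrier)
  qed (auto simp: QG_add QG_zero QG_carrier add_ac)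
  show "comm_monoid QG"
  proof (rule comm_monoidI)
    fix u v w assume u: "u \<in> carrier QG" and v: "v \<in> carrier QG" and w: "w \<in> carrier QG"
    show "u \<otimes>\<^bsub>QG\<^esub> v \<in> carrier QG" by (rule mult_in_carrier)
    show "u \<otimes>\<^bsub>QG\<^esub> v \<otimes>\<^bsub>QG\<^esub> w = u \<otimes>\<^bsub>QG\<^esub> (v \<otimes>\<^bsub>QG\<^esub> w)"
      by (rule QG_eqI[OF mult_in_carrier mult_in_carrier])
        (simp add: mult_pow conv_assoc[OF n_pos periodic_pow periodic_pow periodic_pow])
    show "\<one>\<^bsub>QG\<^esub> \<otimes>\<^bsub>QG\<^esub> u = u"
      by (rule QG_eqI[OF mult_in_carrier u])
        (simp add: mult_pow one_pow conv_commute[OF n_pos periodic_unit periodic_pow] conv_unit_right[OF n_pos periodic_pow])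
    show "u \<otimes>\<^bsub>QG\<^esub> v = v \<otimes>\<^bsub>QG\<^esub> u"
      by (rule QG_eqI[OF mult_in_carrier mult_in_carrier])
        (simp add: mult_pow conv_commute[OF n_pos periodic_pow periodic_pow])
  qed (simp add: QG_carrier QG_one)
next
  fix u v w :: "'a \<Rightarrow> rat"
  show "(u \<oplus>\<^bsub>QG\<^esub> v) \<otimes>\<^bsub>QG\<^esub> w = u \<otimes>\<^bsub>QG\<^esub> w \<oplus>\<^bsub>QG\<^esub> v \<otimes>\<^bsub>QG\<^esub> w"
    by (rule QG_eqI) (simp_all add: QG_carrier QG_add mult_outside mult_pow conv_def distrib_right sum.distrib)
qed

sublocale QG: cring QG by (rule cring_QG)

lemma QG_minus:
  assumes "u \<in> carrier QG" "v \<in> carrier QG"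
  shows "u \<ominus>\<^bsub>QG\<^esub> v = (\<lambda>a. u a - v a)"
proof -
  have v: "(\<lambda>a. - v a) \<in> carrier QG" using assms by (simp add: QG_carrier)
  have "\<ominus>\<^bsub>QG\<^esub> v = (\<lambda>a. - v a)"
    by (rule QG.minus_equality[OF _ assms(2) v]) (simp add: QG_add QG_zero)
  then show ?thesis by (simp add: a_minus_def QG_add)
qed

lemma mult_scale_left: "(\<lambda>a. c * u a) \<otimes>\<^bsub>QG\<^esub> v = (\<lambda>a. c * (u \<otimes>\<^bsub>QG\<^esub> v) a)"
  by (auto simp: group_algebra_def sum_distrib_left mult.assoc if_distrib[of "(*) c"] cong: if_cong)

lemma mult_sum_left:
  "(\<lambda>a. \<Sum>i\<in>I. c i * u i a) \<otimes>\<^bsub>QG\<^esub> v = (\<lambda>a. \<Sum>i\<in>I. c i * (u i \<otimes>\<^bsub>QG\<^esub> v) a)"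
proof (rule QG_eqI)
  fix x :: int
  have "(\<Sum>y\<in>{0..<n}. (\<Sum>i\<in>I. c i * u i (g [^] y)) * v (g [^] (x - y)))
     = (\<Sum>i\<in>I. \<Sum>y\<in>{0..<n}. c i * (u i (g [^] y) * v (g [^] (x - y))))"
    by (subst sum.swap) (simp add: sum_distrib_right mult.assoc)
  then show "((\<lambda>a. \<Sum>i\<in>I. c i * u i a) \<otimes>\<^bsub>QG\<^esub> v) (g [^] x) = (\<Sum>i\<in>I. c i * (u i \<otimes>\<^bsub>QG\<^esub> v) (g [^] x))"
    by (simp add: mult_pow conv_def sum_distrib_left)
qed (simp_all add: mult_in_carrier QG_carrier mult_outside)

section \<open>Subgroup sums and their averages\<close>

lemma set_sum_eq: "finite A \<Longrightarrow> set_sum A = (\<lambda>a. if a \<in> A then 1 else 0 :: rat)"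
  by (auto simp: set_sum_def group_elem_def)

lemma subgroup_finite: "subgroup H G \<Longrightarrow> finite H"
  using finite_carrier finite_subset subgroup.subset by blast

lemma subgroup_card_pos: "subgroup H G \<Longrightarrow> card H > 0"
  using subgroup_finite subgroup.one_closed card_gt_0_iff by blast

lemma hat_eq: "subgroup H G \<Longrightarrow> hat H = (\<lambda>a. if a \<in> H then 1 / of_nat (card H) else 0 :: rat)"
  by (auto simp: hat_def set_sum_eq subgroup_finite)

lemma hat_closed: "subgroup H G \<Longrightarrow> hat H \<in> carrier QG"
  by (auto simp: QG_carrier hat_eq dest: subgroup.subset)

definition invariant :: "'a set \<Rightarrow> ('a \<Rightarrow> rat) \<Rightarrow> bool" where
  "invariant J u \<longleftrightarrow> (\<forall>a\<in>J. \<forall>x\<in>carrier G. u (a \<otimes> x) = u x)"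

lemma mult_apply:
  assumes "x \<in> carrier G"
  shows "(u \<otimes>\<^bsub>QG\<^esub> v) x = (\<Sum>y\<in>carrier G. u y * v (inv y \<otimes> x))"
proof -
  have "(\<Sum>z\<in>carrier G. if y \<otimes> z = x then u y * v z else 0) = u y * v (inv y \<otimes> x)"
    if y: "y \<in> carrier G" for y
  proof -
    have "(\<Sum>z\<in>carrier G. if y \<otimes> z = x then u y * v z else 0)
        = (\<Sum>z\<in>carrier G. if z = inv y \<otimes> x then u y * v z else 0)"
      using assms y by (intro sum.cong) (auto simp: inv_solve_left' m_assoc[symmetric])
    then show ?thesis using assms y finite_carrier by simp
  qed
  then show ?thesis by (simp add: group_algebra_def)
qed

lemma hat_mult_apply:
  assumes J: "subgroup J G" and "x \<in> carrier G"
  shows "(hat J \<otimes>\<^bsub>QG\<^esub> u) x = (\<Sum>y\<in>J. u (inv y \<otimes> x)) / of_nat (card J)"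
proof -
  have "(hat J \<otimes>\<^bsub>QG\<^esub> u) x = (\<Sum>y\<in>J. 1 / of_nat (card J) * u (inv y \<otimes> x))"
    unfolding mult_apply[OF assms(2)] hat_eq[OF J]
    by (rule sum.mono_neutral_cong_right) (use finite_carrier subgroup.subset[OF J] in auto)
  then show ?thesis by (simp add: sum_divide_distrib)
qed

lemma hat_mult_invariant:
  assumes J: "subgroup J G" and u: "u \<in> carrier QG" "invariant J u"
  shows "hat J \<otimes>\<^bsub>QG\<^esub> u = u"
proof
  fix x
  show "(hat J \<otimes>\<^bsub>QG\<^esub> u) x = u x"
  proof (cases "x \<in> carrier G")
    case True
    have "(\<Sum>y\<in>J. u (inv y \<otimes> x)) = (\<Sum>y\<in>J. u x)"
      using u(2) True subgroup.m_inv_closed[OF J] by (intro sum.cong) (auto simp: invariant_def)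
    then show ?thesis using subgroup_card_pos[OF J] by (simp add: hat_mult_apply[OF J True])
  qed (use u(1) in \<open>simp add: mult_outside QG_carrier\<close>)
qed

lemma invariant_mult:
  assumes "J \<subseteq> carrier G" "invariant J v"
  shows "invariant J (u \<otimes>\<^bsub>QG\<^esub> v)"
  unfolding invariant_def
proof (intro ballI)
  fix a x assume a: "a \<in> J" and x: "x \<in> carrier G"
  have aG: "a \<in> carrier G" using a assms(1) by blast
  have "v (inv y \<otimes> (a \<otimes> x)) = v (inv y \<otimes> x)" if y: "y \<in> carrier G" for y
  proof -
    have "inv y \<otimes> (a \<otimes> x) = a \<otimes> (inv y \<otimes> x)" using aG x y by (simp add: m_lcomm)
    then show ?thesis using assms(2) a x y by (simp add: invariant_def)
  qed
  then show "(u \<otimes>\<^bsub>QG\<^esub> v) (a \<otimes> x) = (u \<otimes>\<^bsub>QG\<^esub> v) x"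
    using aG x by (simp add: mult_apply)
qed

lemma invariant_hat:
  assumes H: "subgroup H G" and "K \<subseteq> H"
  shows "invariant K (hat H)"
proof -
  have "a \<otimes> x \<in> H \<longleftrightarrow> x \<in> H" if "a \<in> H" "x \<in> carrier G" for a x
  proof
    assume "a \<otimes> x \<in> H"
    then have "inv a \<otimes> (a \<otimes> x) \<in> H" using H that(1) by (simp add: subgroup.m_closed subgroup.m_inv_closed)
    moreover have "inv a \<otimes> (a \<otimes> x) = x"
      using that subgroup.mem_carrier[OF H] by (simp add: m_assoc[symmetric])
    ultimately show "x \<in> H" by simp
  qed (use H that in \<open>simp add: subgroup.m_closed\<close>)
  then show ?thesis unfolding invariant_def hat_eq[OF H] using assms(2) by auto
qed

lemma hat_mult_hat:
  assumes H: "subgroup H G" and K: "subgroup K G" and "K \<subseteq> H"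
  shows "hat K \<otimes>\<^bsub>QG\<^esub> hat H = hat H"
  by (rule hat_mult_invariant[OF K hat_closed[OF H] invariant_hat[OF H assms(3)]])

lemma set_mult_upper:
  assumes H: "subgroup H G" and K: "subgroup K G"
  shows "H \<subseteq> H <#> K" "K \<subseteq> H <#> K"
proof -
  show "H \<subseteq> H <#> K"
  proof
    fix h assume h: "h \<in> H"
    then have "h = h \<otimes> \<one>" using subgroup.mem_carrier[OF H] by simp
    then show "h \<in> H <#> K" using h subgroup.one_closed[OF K] unfolding set_mult_def by blast
  qed
  show "K \<subseteq> H <#> K"
  proof
    fix k assume k: "k \<in> K"
    then have "k = \<one> \<otimes> k" using subgroup.mem_carrier[OF K] by simp
    then show "k \<in> H <#> K" using k subgroup.one_closed[OF H] unfolding set_mult_def by blast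
  qed
qed

lemma set_mult_absorb:
  assumes H: "subgroup H G" and K: "subgroup K G" and "K \<subseteq> H"
  shows "K <#> H = H" "H <#> K = H"
proof -
  have "h \<otimes> k \<in> H" "k \<otimes> h \<in> H" if "h \<in> H" "k \<in> K" for h k
    using that assms(3) subgroup.m_closed[OF H] by blast+
  then have "K <#> H \<subseteq> H" "H <#> K \<subseteq> H" unfolding set_mult_def by blast+
  then show "K <#> H = H" "H <#> K = H"
    using set_mult_upper[OF H K] set_mult_upper[OF K H] by blast+
qed

text \<open>The product is invariant under \<open>H\<close> and under \<open>K\<close>, hence under
  \<open>H <#> K\<close>, so \<open>hat (H <#> K)\<close> fixes it. On the other hand
  \<open>hat (H <#> K)\<close> absorbs both factors.\<close>

lemma hat_mult:
  assumes H: "subgroup H G" and K: "subgroup K G"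
  shows "hat H \<otimes>\<^bsub>QG\<^esub> hat K = hat (H <#> K)"
proof -
  have HK: "subgroup (H <#> K) G" by (rule mult_subgroups[OF H K])
  note sub = set_mult_upper[OF H K]
  have cl: "hat H \<in> carrier QG" "hat K \<in> carrier QG" "hat (H <#> K) \<in> carrier QG"
    using hat_closed H K HK by blast+
  have invH: "invariant H (hat H \<otimes>\<^bsub>QG\<^esub> hat K)"
    using invariant_mult[OF subgroup.subset[OF H] invariant_hat[OF H order_refl], of "hat K"] cl by (simp add: QG.m_comm)
  have invK: "invariant K (hat H \<otimes>\<^bsub>QG\<^esub> hat K)"
    by (rule invariant_mult[OF subgroup.subset[OF K] invariant_hat[OF K order_refl]])
  have "invariant (H <#> K) (hat H \<otimes>\<^bsub>QG\<^esub> hat K)"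
    unfolding invariant_def
  proof (intro ballI)
    fix a x assume "a \<in> H <#> K" and x: "x \<in> carrier G"
    then obtain h k where hk: "h \<in> H" "k \<in> K" "a = h \<otimes> k" unfolding set_mult_def by auto
    have "h \<in> carrier G" "k \<in> carrier G"
      using subgroup.mem_carrier[OF H hk(1)] subgroup.mem_carrier[OF K hk(2)] .
    then show "(hat H \<otimes>\<^bsub>QG\<^esub> hat K) (a \<otimes> x) = (hat H \<otimes>\<^bsub>QG\<^esub> hat K) x"
      using invH invK hk x by (simp add: invariant_def m_assoc)
  qed
  then have "hat (H <#> K) \<otimes>\<^bsub>QG\<^esub> (hat H \<otimes>\<^bsub>QG\<^esub> hat K) = hat H \<otimes>\<^bsub>QG\<^esub> hat K"
    by (rule hat_mult_invariant[OF HK mult_in_carrier])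
  moreover have "hat (H <#> K) \<otimes>\<^bsub>QG\<^esub> (hat H \<otimes>\<^bsub>QG\<^esub> hat K) = hat (H <#> K)"
    using hat_mult_hat[OF HK H sub(1)] hat_mult_hat[OF HK K sub(2)] cl
    by (metis QG.m_comm QG.m_lcomm)
  ultimately show ?thesis by simp
qed

lemma subgroup_generator:
  assumes H: "subgroup H G"
  obtains k where "k \<in> H" "\<forall>K. subgroup K G \<longrightarrow> k \<in> K \<longrightarrow> H \<subseteq> K"
proof -
  define A where "A = {x::int. g [^] x \<in> H}"
  have "n \<in> A" using pow_eq_iff[of n 0] subgroup.one_closed[OF H] by (simp add: A_def)
  moreover have "x + y \<in> A" if "x \<in> A" "y \<in> A" for x y
    using that subgroup.m_closed[OF H] by (simp add: A_def pow_add)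
  moreover have "- x \<in> A" if "x \<in> A" for x
    using that subgroup.m_inv_closed[OF H] g_closed by (simp add: A_def int_pow_neg)
  ultimately obtain m where m: "m > 0" "m dvd n" "A = {x. m dvd x}"
    by (rule int_subgroup_multiples[OF _ n_pos])
  show ?thesis
  proof (rule that)
    have "m \<in> A" using m(3) by simp
    then show "g [^] m \<in> H" by (simp add: A_def)
    show "\<forall>K. subgroup K G \<longrightarrow> g [^] m \<in> K \<longrightarrow> H \<subseteq> K"
    proof (intro allI impI subsetI)
      fix K assume K: "subgroup K G" "g [^] m \<in> K"
      fix h assume h: "h \<in> H"
      obtain x :: int where x: "h = g [^] x" using carrierE[OF subgroup.mem_carrier[OF H h]] .
      then have "x \<in> A" using h by (simp add: A_def)
      then have "m dvd x" using m(3) by blast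
      then obtain j where "x = m * j" by (elim dvdE)
      then have "h = (g [^] m) [^] j" using x g_closed by (simp add: int_pow_pow)
      then show "h \<in> K" using subgroup_int_pow_closed[OF K] by simp
    qed
  qed
qed

end

section \<open>Schur rings over cyclic groups\<close>

lemma common_denominator:
  fixes u :: "'a \<Rightarrow> rat"
  assumes "finite A"
  shows "\<exists>D::int. D > 0 \<and> (\<forall>a\<in>A. of_int D * u a \<in> \<int>)"
  using assms
proof (induction A rule: finite_induct)
  case empty
  then show ?case by (intro exI[of _ 1]) simp
next
  case (insert a A)
  then obtain D :: int where D: "D > 0" "\<forall>a\<in>A. of_int D * u a \<in> \<int>" by blast
  obtain p q where pq: "quotient_of (u a) = (p, q)" by (cases "quotient_of (u a)")
  then have q: "q > 0" "u a = of_int p / of_int q"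
    using quotient_of_denom_pos quotient_of_div by blast+
  have "of_int (D * q) * u a \<in> \<int>" using q by simp
  moreover have "of_int (D * q) * u b \<in> \<int>" if "b \<in> A" for b
  proof -
    have "of_int (D * q) * u b = of_int q * (of_int D * u b)" by simp
    then show ?thesis using D(2) that by (metis Ints_mult Ints_of_int)
  qed
  ultimately show ?case using D(1) q(1) by (intro exI[of _ "D * q"]) simp
qed

locale cyclic_schur_ring = finite_cyclic_group +
  fixes P :: "'a set set"
  assumes partition: "partition_on (carrier G) P"
    and one_class: "{\<one>} \<in> P"
    and mult_class: "C \<in> P \<Longrightarrow> D \<in> P \<Longrightarrow> set_sum C \<otimes>\<^bsub>QG\<^esub> set_sum D \<in> set_sum_span P"
begin

abbreviation S :: "('a \<Rightarrow> rat) set" where "S \<equiv> set_sum_span P"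

lemma finite_P: "finite P"
  using finite_elements[OF finite_carrier partition] .

lemma class_subset: "C \<in> P \<Longrightarrow> C \<subseteq> carrier G"
  using partition partition_onD1 by blast

lemma finite_class: "C \<in> P \<Longrightarrow> finite C"
  using class_subset finite_carrier by (rule finite_subset)

lemma class_unique: "C \<in> P \<Longrightarrow> D \<in> P \<Longrightarrow> x \<in> C \<Longrightarrow> x \<in> D \<Longrightarrow> C = D"
  using partition by (meson disjointD disjoint_iff partition_onD2)

lemma carrier_class: "x \<in> carrier G \<Longrightarrow> \<exists>C\<in>P. x \<in> C"
  using partition partition_onD1 by blast

lemma span_sum_apply:
  assumes "C \<in> P" "x \<in> C"
  shows "(\<Sum>D\<in>P. c D * set_sum D x) = (c C :: rat)"
proof -
  have "(\<Sum>D\<in>P. c D * set_sum D x) = (\<Sum>D\<in>P. if D = C then c D else 0)"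
    using assms class_unique by (intro sum.cong) (auto simp: set_sum_eq finite_class)
  then show ?thesis using assms finite_P by simp
qed

lemma in_S_iff:
  "u \<in> S \<longleftrightarrow> u \<in> carrier QG \<and> (\<forall>C\<in>P. \<forall>x\<in>C. \<forall>y\<in>C. u x = u y)"
proof
  assume "u \<in> S"
  then obtain c where u: "u = (\<lambda>x. \<Sum>C\<in>P. c C * set_sum C x)" by (auto simp: set_sum_span_def)
  have "u x = 0" if "x \<notin> carrier G" for x
    unfolding u using that class_subset by (intro sum.neutral) (auto simp: set_sum_eq finite_class)
  moreover have "u x = c C" if "C \<in> P" "x \<in> C" for C x
    unfolding u by (rule span_sum_apply[OF that])
  ultimately show "u \<in> carrier QG \<and> (\<forall>C\<in>P. \<forall>x\<in>C. \<forall>y\<in>C. u x = u y)"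
    by (simp add: QG_carrier)
next
  assume u: "u \<in> carrier QG \<and> (\<forall>C\<in>P. \<forall>x\<in>C. \<forall>y\<in>C. u x = u y)"
  define c where "c = (\<lambda>C. u (SOME x. x \<in> C))"
  have "u = (\<lambda>x. \<Sum>C\<in>P. c C * set_sum C x)"
  proof
    fix x
    show "u x = (\<Sum>C\<in>P. c C * set_sum C x)"
    proof (cases "x \<in> carrier G")
      case True
      then obtain C where C: "C \<in> P" "x \<in> C" using carrier_class by blast
      then have "(SOME x. x \<in> C) \<in> C" by (intro someI)
      then have "u x = c C" using u C unfolding c_def by blast
      then show ?thesis by (simp add: span_sum_apply[OF C])
    next
      case False
      then have "(\<Sum>C\<in>P. c C * set_sum C x) = 0"
        using class_subset by (intro sum.neutral) (auto simp: set_sum_eq finite_class)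
      then show ?thesis using u False by (simp add: QG_carrier)
    qed
  qed
  then show "u \<in> S" by (auto simp: set_sum_span_def)
qed

lemma S_closed: "u \<in> S \<Longrightarrow> u \<in> carrier QG"
  by (simp add: in_S_iff)

lemma S_add: "u \<in> S \<Longrightarrow> v \<in> S \<Longrightarrow> (\<lambda>a. u a + v a) \<in> S"
  unfolding in_S_iff QG_carrier by (metis add_0)

lemma S_diff: "u \<in> S \<Longrightarrow> v \<in> S \<Longrightarrow> (\<lambda>a. u a - v a) \<in> S"
  unfolding in_S_iff QG_carrier by (metis diff_0_right)

lemma S_scale: "u \<in> S \<Longrightarrow> (\<lambda>a. c * u a) \<in> S"
  unfolding in_S_iff QG_carrier by (metis mult_zero_right)

lemma S_zero: "(\<lambda>a. 0) \<in> S"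
  by (simp add: in_S_iff QG_carrier)

lemma S_sum: "(\<And>i. i \<in> I \<Longrightarrow> u i \<in> S) \<Longrightarrow> (\<lambda>a. \<Sum>i\<in>I. c i * u i a) \<in> S"
  by (induction I rule: infinite_finite_induct) (simp_all add: S_zero S_add S_scale)

lemma S_mult:
  assumes u: "u \<in> S" and v: "v \<in> S"
  shows "u \<otimes>\<^bsub>QG\<^esub> v \<in> S"
proof -
  obtain c d where u_eq: "u = (\<lambda>x. \<Sum>C\<in>P. c C * set_sum C x)"
    and v_eq: "v = (\<lambda>x. \<Sum>C\<in>P. d C * set_sum C x)"
    using u v by (auto simp: set_sum_span_def)
  have cl: "set_sum C \<in> carrier QG" if "C \<in> P" for C
    using that class_subset by (auto simp: QG_carrier set_sum_eq finite_class)
  have "set_sum C \<otimes>\<^bsub>QG\<^esub> v \<in> S" if C: "C \<in> P" for C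
  proof -
    have "set_sum C \<otimes>\<^bsub>QG\<^esub> v = v \<otimes>\<^bsub>QG\<^esub> set_sum C"
      using QG.m_comm[OF cl[OF C] S_closed[OF v]] .
    also have "\<dots> = (\<lambda>a. \<Sum>D\<in>P. d D * (set_sum D \<otimes>\<^bsub>QG\<^esub> set_sum C) a)"
      unfolding v_eq by (rule mult_sum_left)
    also have "\<dots> \<in> S" using mult_class C by (intro S_sum)
    finally show ?thesis .
  qed
  then show ?thesis unfolding u_eq mult_sum_left by (intro S_sum)
qed

definition schur_rel :: "int \<Rightarrow> int \<Rightarrow> bool" where
  "schur_rel x y \<longleftrightarrow> (\<exists>C\<in>P. g [^] x \<in> C \<and> g [^] y \<in> C) \<or> gcd x n = gcd y n"

text \<open>Equal gcd with \<open>n\<close> means generating the same subgroup. The functions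
  constant on the classes of \<open>E\<close> thus correspond to the elements of \<open>S\<close>
  with equal coefficients at generators of the same subgroup.\<close>

definition E :: "int \<Rightarrow> int \<Rightarrow> bool" where "E = schur_rel\<^sup>*\<^sup>*"

lemma class_constant_E_iff:
  "class_constant E f \<longleftrightarrow> (\<forall>x y. schur_rel x y \<longrightarrow> f x = f y)"
proof
  assume "class_constant E f"
  then show "\<forall>x y. schur_rel x y \<longrightarrow> f x = f y"
    by (auto simp: class_constant_def E_def)
next
  assume *: "\<forall>x y. schur_rel x y \<longrightarrow> f x = f y"
  have "f x = f y" if "schur_rel\<^sup>*\<^sup>* x y" for x y
    using that by (induction rule: rtranclp_induct) (use * in auto)
  then show "class_constant E f" by (simp add: class_constant_def E_def)
qed

lemma class_constant_E_periodic:
  assumes "class_constant E f"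
  shows "periodic n f"
  unfolding periodic_def
proof (intro allI impI)
  fix x y assume "n dvd x - y"
  then have "gcd x n = gcd y n"
    by (metis gcd.commute gcd_mod_right mod_eq_dvd_iff n_pos less_irrefl)
  then show "f x = f y" using assms unfolding class_constant_E_iff schur_rel_def by blast
qed

definition lift :: "(int \<Rightarrow> int) \<Rightarrow> 'a \<Rightarrow> rat" where
  "lift f a = (if a \<in> carrier G then of_int (f (SOME x. g [^] x = a)) else 0)"

lemma lift_pow:
  assumes "periodic n f"
  shows "lift f (g [^] x) = of_int (f x)"
proof -
  have "g [^] (SOME y::int. g [^] y = g [^] x) = g [^] x" by (rule someI[of _ x]) simp
  then have "f (SOME y. g [^] y = g [^] x) = f x"
    using periodicD[OF assms] by (simp add: pow_eq_iff)
  then show ?thesis by (simp add: lift_def pow_closed)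
qed

lemma lift_in_S:
  assumes "class_constant E f"
  shows "lift f \<in> S"
  unfolding in_S_iff QG_carrier
proof (intro conjI ballI)
  fix C a b assume C: "C \<in> P" "a \<in> C" "b \<in> C"
  then obtain x y :: int where xy: "a = g [^] x" "b = g [^] y"
    using class_subset by (metis carrierE subsetD)
  then have "schur_rel x y" using C by (auto simp: schur_rel_def)
  then have "f x = f y" using assms by (simp add: class_constant_E_iff)
  then show "lift f a = lift f b"
    using class_constant_E_periodic[OF assms] by (simp add: xy lift_pow)
qed (simp add: lift_def)

lemma conv_of_int: "conv n (\<lambda>x. of_int (f x)) (\<lambda>x. of_int (h x)) x = of_int (conv n f h x)"
  by (simp add: conv_def)

sublocale rational_schur n E
proof
  show "n > 0" by (rule n_pos)
  have "symp schur_rel" by (rule sympI) (auto simp: schur_rel_def)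
  then have "symp E" unfolding E_def by (rule symp_rtranclp)
  then show "equivp E" by (intro equivpI) (simp_all add: E_def reflpI)
  show "E x y" if "gcd x n = gcd y n" for x y
    using that by (auto simp: E_def schur_rel_def)
  show "n dvd x" if "E x 0" for x
    \<comment> \<open>A chain ending at 0 never leaves the multiples of \<open>n\<close>: the
      identity is alone in its basic set and is the only element of order 1.\<close>
    using that unfolding E_def
  proof (induction rule: converse_rtranclp_induct)
    case (step x y)
    then have y: "g [^] y = \<one>" using pow_eq_iff[of y 0] by simp
    from step.hyps(1) consider C where "C \<in> P" "g [^] x \<in> C" "g [^] y \<in> C" | "gcd x n = gcd y n"
      unfolding schur_rel_def by blast
    then show ?case
    proof cases
      case 1
      then have "C = {\<one>}" using class_unique[OF _ one_class] y by blast
      then show ?thesis using 1 pow_eq_iff[of x 0] by simp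
    next
      case 2
      then have "gcd x n = n" using step.IH n_pos by simp
      then show ?thesis by (metis gcd_dvd1)
    qed
  qed simp
  show "class_constant E (conv n f h)" if f: "class_constant E f" and h: "class_constant E h"
    for f h :: "int \<Rightarrow> int"
    unfolding class_constant_E_iff
  proof (intro allI impI)
    fix x y assume xy: "schur_rel x y"
    have per: "periodic n f" "periodic n h" using f h class_constant_E_periodic by blast+
    have lift_mult: "(lift f \<otimes>\<^bsub>QG\<^esub> lift h) (g [^] z) = of_int (conv n f h z)" for z
      using per by (simp add: mult_pow lift_pow conv_of_int)
    from xy consider C where "C \<in> P" "g [^] x \<in> C" "g [^] y \<in> C" | "gcd x n = gcd y n"
      unfolding schur_rel_def by blast
    then show "conv n f h x = conv n f h y"
    proof cases
      case 1
      have "lift f \<otimes>\<^bsub>QG\<^esub> lift h \<in> S" by (intro S_mult lift_in_S f h)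
      then have "(lift f \<otimes>\<^bsub>QG\<^esub> lift h) (g [^] x) = (lift f \<otimes>\<^bsub>QG\<^esub> lift h) (g [^] y)"
        using 1 unfolding in_S_iff by blast
      then show ?thesis by (simp add: lift_mult)
    next
      case 2
      \<comment> \<open>Elements with equal gcd are related by a unit \<open>k\<close>. Dilation by
        \<open>k\<close> fixes \<open>f\<close> and \<open>h\<close>, hence also their
        convolution.\<close>
      obtain k where k: "coprime k n" "n dvd k * y - x"
        using coprime_multiplier[OF n_pos 2] .
      have gcd: "gcd (k * z) n = gcd z n" for z
        using k(1) by (intro gcd_mult_left_left_cancel) (simp add: coprime_commute)
      have inv: "(\<lambda>z. f (k * z)) = f" "(\<lambda>z. h (k * z)) = h"
        using f h gcd unfolding class_constant_E_iff schur_rel_def by blast+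
      have "conv n f h x = conv n f h (k * y)"
        using k(2) periodicD[OF periodic_conv[OF per(2)], of "k * y" x f] by simp
      also have "\<dots> = conv n f h y" using conv_dilate[OF n_pos per k(1), of y] by (simp add: inv)
      finally show ?thesis .
    qed
  qed
qed

section \<open>Idempotents as combinations of subgroup averages\<close>

definition L :: "'a set set" where "L = {H. subgroup H G \<and> set_sum H \<in> S}"

lemma L_subgroup [simp]: "H \<in> L \<Longrightarrow> subgroup H G"
  by (simp add: L_def)

lemma finite_L: "finite L"
proof (rule finite_subset)
  show "L \<subseteq> Pow (carrier G)" unfolding L_def using subgroup.subset by blast
qed (simp add: finite_carrier)

definition multiples :: "int \<Rightarrow> 'a set" where
  "multiples d = (\<lambda>x::int. g [^] x) ` {x. d dvd x}"

lemma pow_in_multiples: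
  assumes "d dvd n"
  shows "g [^] x \<in> multiples d \<longleftrightarrow> d dvd x"
proof
  assume "g [^] x \<in> multiples d"
  then obtain y where y: "d dvd y" "g [^] x = g [^] y" by (auto simp: multiples_def)
  then have "d dvd x - y" using assms by (meson dvd_trans pow_eq_iff)
  then have "d dvd (x - y) + y" using y(1) by (rule dvd_add)
  then show "d dvd x" by simp
qed (auto simp: multiples_def)

lemma subgroup_multiples: "subgroup (multiples d) G"
proof (rule subgroupI)
  show "multiples d \<subseteq> carrier G" using pow_closed by (auto simp: multiples_def)
  show "multiples d \<noteq> {}" by (auto simp: multiples_def)
  fix a assume "a \<in> multiples d"
  then obtain x where x: "d dvd x" "a = g [^] x" by (auto simp: multiples_def)
  then have "inv a = g [^] (- x)" using g_closed by (simp add: int_pow_neg)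
  then show "inv a \<in> multiples d" using x by (auto simp: multiples_def)
  fix b assume "b \<in> multiples d"
  then obtain y where y: "d dvd y" "b = g [^] y" by (auto simp: multiples_def)
  then have "a \<otimes> b = g [^] (x + y)" by (simp add: x pow_add)
  moreover have "d dvd x + y" using x(1) y(1) by (rule dvd_add)
  ultimately show "a \<otimes> b \<in> multiples d" by (auto simp: multiples_def)
qed

lemma multiples_in_L:
  assumes d: "d dvd n" and sat: "saturated {x. d dvd x}"
  shows "multiples d \<in> L"
proof -
  have "set_sum (multiples d) \<in> S"
    unfolding in_S_iff
  proof (intro conjI ballI)
    show "set_sum (multiples d) \<in> carrier QG"
      using subgroup.subset[OF subgroup_multiples, of d]
      by (auto simp: QG_carrier set_sum_eq[OF subgroup_finite[OF subgroup_multiples]])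
    fix C a b assume C: "C \<in> P" "a \<in> C" "b \<in> C"
    then obtain x y :: int where xy: "a = g [^] x" "b = g [^] y"
      using class_subset by (metis carrierE subsetD)
    then have "schur_rel x y" using C by (auto simp: schur_rel_def)
    then have Exy: "E x y" by (simp add: E_def)
    have "d dvd x \<longleftrightarrow> d dvd y"
      using saturatedD[OF sat Exy] saturatedD[OF sat E_sym[OF Exy]] by blast
    then have "a \<in> multiples d \<longleftrightarrow> b \<in> multiples d" by (simp add: xy pow_in_multiples[OF d])
    then show "set_sum (multiples d) a = (set_sum (multiples d) b :: rat)"
      by (simp add: set_sum_eq[OF subgroup_finite[OF subgroup_multiples]])
  qed
  then show ?thesis unfolding L_def using subgroup_multiples by blast
qed

lemma idempotent_in_span:
  assumes e: "e \<in> S" "e \<otimes>\<^bsub>QG\<^esub> e = e"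
  obtains c where "e = (\<lambda>a. \<Sum>H\<in>L. c H * hat H a)"
proof -
  obtain D :: int where D: "D > 0" "\<And>a. a \<in> carrier G \<Longrightarrow> of_int D * e a \<in> \<int>"
    using common_denominator[OF finite_carrier, of e] by blast
  define f where "f = (\<lambda>x::int. \<lfloor>of_int D * e (g [^] x)\<rfloor>)"
  have f: "of_int (f x) = of_int D * e (g [^] x)" for x
    unfolding f_def using D(2)[OF pow_closed] by (simp add: of_int_floor_cancel)
  have per: "periodic n f" unfolding f_def by (rule periodic_pow)
  have "conv n f f x = D * f x" for x
  proof -
    have "of_int (conv n f f x) = conv n (\<lambda>x. of_int D * e (g [^] x)) (\<lambda>x. of_int D * e (g [^] x)) x"
      by (simp only: conv_of_int[symmetric] f)
    also have "\<dots> = of_int D * (of_int D * (e \<otimes>\<^bsub>QG\<^esub> e) (g [^] x))"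
      by (simp only: conv_scale_left conv_scale_right mult_pow)
    also have "\<dots> = of_int (D * f x)" by (simp add: e(2) f)
    finally show ?thesis by (simp only: of_int_eq_iff)
  qed
  then have idem: "conv n f f = (\<lambda>x. D * f x)" by blast
  have "class_constant E f"
    unfolding class_constant_E_iff
  proof (intro allI impI)
    fix x y assume "schur_rel x y"
    then consider C where "C \<in> P" "g [^] x \<in> C" "g [^] y \<in> C" | "gcd x n = gcd y n"
      unfolding schur_rel_def by blast
    then show "f x = f y"
    proof cases
      case 1
      then have "e (g [^] x) = e (g [^] y)" using e(1) unfolding in_S_iff by blast
      then show ?thesis by (simp add: f_def)
    next
      case 2
      obtain k where k: "coprime k n" "n dvd k * y - x"
        using coprime_multiplier[OF n_pos 2] .
      have "f (k * y) = f x" by (rule periodicD[OF per k(2)])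
      then show ?thesis using quasi_idempotent_dilate[OF n_pos per idem D(1) k(1), of y] by simp
    qed
  qed
  then obtain c where c: "f = (\<lambda>x. \<Sum>d\<in>{d. 0 < d \<and> d dvd n \<and> saturated {y. d dvd y}}. c d * of_bool (d dvd x))"
    by (rule class_constant_decomposition)
  define I where "I = {d. 0 < d \<and> d dvd n \<and> saturated {y. d dvd y}}"
  \<comment> \<open>The cardinality turns an indicator function into a multiple of the
    \<open>hat\<close>, and the division by \<open>D\<close> undoes the clearing of
    denominators.\<close>
  define k :: "int \<Rightarrow> rat" where "k d = of_int (c d) * of_nat (card (multiples d)) / of_int D" for d
  have fin: "finite I"
    by (rule finite_subset[of _ "{0..n}"]) (use n_pos in \<open>auto simp: I_def zdvd_imp_le\<close>)
  have IL: "multiples ` I \<subseteq> L" using multiples_in_L unfolding I_def by blast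
  have "e = (\<lambda>a. \<Sum>d\<in>I. k d * hat (multiples d) a)"
  proof (rule QG_eqI)
    show "(\<lambda>a. \<Sum>d\<in>I. k d * hat (multiples d) a) \<in> carrier QG"
      using hat_closed[OF subgroup_multiples] by (auto simp: QG_carrier intro!: sum.neutral)
    fix x :: int
    have "k d * hat (multiples d) (g [^] x) = of_int (c d * of_bool (d dvd x)) / of_int D" if "d \<in> I" for d
      using that subgroup_card_pos[OF subgroup_multiples, of d]
      by (simp add: hat_eq[OF subgroup_multiples] pow_in_multiples I_def k_def)
    then have "(\<Sum>d\<in>I. k d * hat (multiples d) (g [^] x)) = of_int (f x) / of_int D"
      unfolding c I_def[symmetric] of_int_sum sum_divide_distrib by (intro sum.cong) auto
    then show "e (g [^] x) = (\<Sum>d\<in>I. k d * hat (multiples d) (g [^] x))"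
      using D(1) by (simp add: f)
  qed (rule S_closed[OF e(1)])
  \<comment> \<open>The coefficients of all \<open>d\<close> with the same subgroup are
    collected.\<close>
  also have "\<dots> = (\<lambda>a. \<Sum>H\<in>L. (\<Sum>d\<in>{d \<in> I. multiples d = H}. k d) * hat H a)"
  proof
    fix a
    have "(\<Sum>d\<in>I. k d * hat (multiples d) a)
        = (\<Sum>H\<in>L. \<Sum>d\<in>{d \<in> I. multiples d = H}. k d * hat (multiples d) a)"
      by (rule sum.group[OF fin finite_L IL, symmetric])
    also have "\<dots> = (\<Sum>H\<in>L. (\<Sum>d\<in>{d \<in> I. multiples d = H}. k d) * hat H a)"
      by (intro sum.cong refl) (simp add: sum_distrib_right)
    finally show "(\<Sum>d\<in>I. k d * hat (multiples d) a) = (\<Sum>H\<in>L. (\<Sum>d\<in>{d \<in> I. multiples d = H}. k d) * hat H a)" .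
  qed
  finally show ?thesis by (rule that)
qed

end

section \<open>The primitive idempotents\<close>

context finite_cyclic_group
begin

text \<open>At a generator of the cyclic group \<open>H\<close> only subgroups containing
  \<open>H\<close> contribute. The system is therefore triangular and is solved downwards from the
  largest subgroups.\<close>

lemma hat_independent:
  assumes fin: "finite I" and sub: "\<And>H. H \<in> I \<Longrightarrow> subgroup H G"
    and zero: "\<And>x. (\<Sum>H\<in>I. c H * hat H x) = (0 :: rat)"
  shows "H \<in> I \<Longrightarrow> c H = 0"
proof (induction "card (carrier G) - card H" arbitrary: H rule: less_induct)
  case less
  obtain k where k: "k \<in> H" "\<forall>K. subgroup K G \<longrightarrow> k \<in> K \<longrightarrow> H \<subseteq> K"
    using subgroup_generator[OF sub[OF less.prems]] .
  have "c K * hat K k = 0" if K: "K \<in> I" "K \<noteq> H" for K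
  proof (cases "k \<in> K")
    case True
    then have "H \<subset> K" using k(2) sub[OF K(1)] K(2) by blast
    moreover have "finite K" "K \<subseteq> carrier G"
      using subgroup_finite[OF sub[OF K(1)]] subgroup.subset[OF sub[OF K(1)]] .
    ultimately have "card H < card K" "card K \<le> card (carrier G)"
      by (simp_all add: psubset_card_mono card_mono finite_carrier)
    then have "c K = 0" using less.hyps[OF _ K(1)] by simp
    then show ?thesis by simp
  qed (simp add: hat_eq[OF sub[OF K(1)]])
  then have "(\<Sum>K\<in>I. c K * hat K k) = (\<Sum>K\<in>I. if K = H then c H * hat H k else 0)"
    by (intro sum.cong) auto
  then have "c H * hat H k = 0" using zero[of k] fin less.prems by simp
  then show ?case
    using k(1) subgroup_card_pos[OF sub[OF less.prems]] by (simp add: hat_eq[OF sub[OF less.prems]])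
qed

end

context cyclic_schur_ring
begin

lemma hat_in_S: "H \<in> L \<Longrightarrow> hat H \<in> S"
  unfolding hat_def L_def by (rule S_scale) simp

lemma L_carrier: "carrier G \<in> L"
proof -
  have "x \<in> carrier G" if "C \<in> P" "x \<in> C" for C x
    using that class_subset by blast
  then have "set_sum (carrier G) \<in> S"
    unfolding in_S_iff QG_carrier set_sum_eq[OF finite_carrier] by auto
  then show ?thesis unfolding L_def using subgroup_self by blast
qed

lemma L_mult:
  assumes H: "H \<in> L" and K: "K \<in> L"
  shows "H <#> K \<in> L"
proof -
  have sub: "subgroup H G" "subgroup K G" using H K by simp_all
  have HK: "subgroup (H <#> K) G" by (rule mult_subgroups[OF sub])
  have "hat (H <#> K) \<in> S"
    using S_mult[OF hat_in_S[OF H] hat_in_S[OF K]] by (simp add: hat_mult[OF sub])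
  then have "(\<lambda>x. of_nat (card (H <#> K)) * hat (H <#> K) x) \<in> S" by (rule S_scale)
  moreover have "(\<lambda>x. of_nat (card (H <#> K)) * hat (H <#> K) x) = (set_sum (H <#> K) :: 'a \<Rightarrow> rat)"
    using subgroup_card_pos[OF HK] by (auto simp: hat_def)
  ultimately have "set_sum (H <#> K) \<in> S" by (simp only:)
  then show ?thesis unfolding L_def using HK by blast
qed

lemma schur_lattice_eq: "schur_lattice G S = L"
  unfolding schur_lattice_def L_def normal_iff_subgroup by (rule refl)

abbreviation eps :: "'a set \<Rightarrow> 'a \<Rightarrow> rat" where "eps H \<equiv> schur_eps G S H"

lemma covers_subset: "M \<in> covers L H \<Longrightarrow> M \<in> L \<and> H \<subset> M"
  by (simp add: covers_def)

lemma finite_covers: "finite (covers L H)"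
  using finite_L by (rule rev_finite_subset) (use covers_subset in blast)

lemma cover_exists:
  assumes H: "H \<in> L" and K: "K \<in> L" "H \<subset> K"
  obtains M where "M \<in> covers L H" "M \<subseteq> K"
proof -
  define A where "A = {M \<in> L. H \<subset> M \<and> M \<subseteq> K}"
  have "finite A" unfolding A_def using finite_L by (rule rev_finite_subset) blast
  moreover have "K \<in> A" using K by (simp add: A_def)
  ultimately obtain M where M: "M \<in> A" "\<forall>M'\<in>A. M' \<subseteq> M \<longrightarrow> M = M'"
    using finite_has_minimal2[of A K] by blast
  have M': "M \<in> L" "H \<subset> M" "M \<subseteq> K" using M(1) unfolding A_def by blast+
  have "N = H \<or> N = M" if N: "N \<in> L" "H \<subseteq> N" "N \<subseteq> M" for N
  proof (cases "N = H")
    case False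
    then have "N \<in> A" unfolding A_def using N M'(3) by blast
    then show ?thesis using M(2) N(3) by blast
  qed simp
  then have "M \<in> covers L H" unfolding covers_def using M'(1,2) by blast
  then show ?thesis using M'(3) by (rule that)
qed

lemma minus_hat:
  assumes "H \<in> L" "M \<in> L"
  shows "hat H \<ominus>\<^bsub>QG\<^esub> hat M = (\<lambda>a. hat H a - hat M a)"
  by (intro QG_minus hat_closed L_subgroup assms)

lemma factor_closed: "H \<in> L \<Longrightarrow> M \<in> covers L H \<Longrightarrow> hat H \<ominus>\<^bsub>QG\<^esub> hat M \<in> carrier QG"
  by (intro QG.minus_closed hat_closed L_subgroup) (simp_all add: covers_def)

lemma eps_eq:
  "H \<noteq> carrier G \<Longrightarrow> eps H = (\<Otimes>\<^bsub>QG\<^esub>M\<in>covers L H. hat H \<ominus>\<^bsub>QG\<^esub> hat M)"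
  by (simp add: schur_eps_def schur_lattice_eq)

text \<open>How \<open>eps H\<close> multiplies with a \<open>hat K\<close> is decided by one
  well-chosen factor of the product; this splits it off.\<close>

lemma eps_factor:
  assumes H: "H \<in> L" "H \<noteq> carrier G" and M: "M \<in> covers L H"
  obtains u where "u \<in> carrier QG" "eps H = (hat H \<ominus>\<^bsub>QG\<^esub> hat M) \<otimes>\<^bsub>QG\<^esub> u"
proof -
  let ?t = "\<lambda>M. hat H \<ominus>\<^bsub>QG\<^esub> hat M"
  have cl: "?t \<in> covers L H \<rightarrow> carrier QG" using factor_closed[OF H(1)] by blast
  have "covers L H = insert M (covers L H - {M})" using M by blast
  then have "eps H = (\<Otimes>\<^bsub>QG\<^esub>N\<in>insert M (covers L H - {M}). ?t N)"
    using eps_eq[OF H(2)] by simp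
  also have "\<dots> = ?t M \<otimes>\<^bsub>QG\<^esub> (\<Otimes>\<^bsub>QG\<^esub>N\<in>covers L H - {M}. ?t N)"
    using finite_covers cl M by (intro QG.finprod_insert) auto
  finally show ?thesis
    by (rule that[rotated]) (use cl in \<open>auto intro!: QG.finprod_closed\<close>)
qed

lemma eps_closed:
  assumes "H \<in> L"
  shows "eps H \<in> carrier QG"
proof (cases "H = carrier G")
  case True
  then show ?thesis using hat_closed[OF subgroup_self] by (simp add: schur_eps_def)
next
  case False
  have "(\<lambda>M. hat H \<ominus>\<^bsub>QG\<^esub> hat M) \<in> covers L H \<rightarrow> carrier QG" using factor_closed[OF assms] by blast
  then show ?thesis unfolding eps_eq[OF False] by (rule QG.finprod_closed)
qed

lemma factor_mult_hat:
  assumes H: "H \<in> L" and M: "M \<in> covers L H" and K: "K \<in> L"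
  shows "(hat H \<ominus>\<^bsub>QG\<^esub> hat M) \<otimes>\<^bsub>QG\<^esub> hat K = (hat (K <#> H)) \<ominus>\<^bsub>QG\<^esub> hat (K <#> M)"
proof -
  have M_in_L: "M \<in> L" using M covers_subset by blast
  have cl: "hat H \<in> carrier QG" "hat M \<in> carrier QG" "hat K \<in> carrier QG"
    using H M_in_L K by (simp_all add: hat_closed)
  have "(hat H \<ominus>\<^bsub>QG\<^esub> hat M) \<otimes>\<^bsub>QG\<^esub> hat K = hat K \<otimes>\<^bsub>QG\<^esub> hat H \<ominus>\<^bsub>QG\<^esub> hat K \<otimes>\<^bsub>QG\<^esub> hat M"
    using cl by algebra
  then show ?thesis using H M_in_L K by (simp add: hat_mult)
qed

text \<open>Any cover \<open>M\<close> contains \<open>H\<close> and so \<open>K\<close>, hence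
  \<open>hat K\<close> fixes both terms of the factor for \<open>M\<close>.\<close>

lemma eps_mult_hat_le:
  assumes H: "H \<in> L" and K: "K \<in> L" "K \<subseteq> H"
  shows "eps H \<otimes>\<^bsub>QG\<^esub> hat K = eps H"
proof (cases "H = carrier G")
  case True
  have sub: "subgroup H G" "subgroup K G" using H K(1) by simp_all
  have "hat H \<otimes>\<^bsub>QG\<^esub> hat K = hat K \<otimes>\<^bsub>QG\<^esub> hat H"
    by (rule QG.m_comm[OF sub[THEN hat_closed]])
  also have "\<dots> = hat H" by (rule hat_mult_hat[OF sub K(2)])
  finally show ?thesis using True by (simp add: schur_eps_def)
next
  case False
  have "H \<subset> carrier G" using False subgroup.subset[OF L_subgroup[OF H]] by blast
  then obtain M where M: "M \<in> covers L H" using cover_exists[OF H L_carrier] by blast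
  obtain u where u: "u \<in> carrier QG" "eps H = (hat H \<ominus>\<^bsub>QG\<^esub> hat M) \<otimes>\<^bsub>QG\<^esub> u"
    using eps_factor[OF H False M] .
  have M_in_L: "M \<in> L" "H \<subset> M" using M covers_subset by blast+
  have "K <#> H = H" "K <#> M = M" using H K M_in_L by (intro set_mult_absorb(1); auto)+
  then have *: "(hat H \<ominus>\<^bsub>QG\<^esub> hat M) \<otimes>\<^bsub>QG\<^esub> hat K = hat H \<ominus>\<^bsub>QG\<^esub> hat M"
    using factor_mult_hat[OF H M K(1)] by simp
  have cl: "hat H \<ominus>\<^bsub>QG\<^esub> hat M \<in> carrier QG" "hat K \<in> carrier QG"
    using factor_closed[OF H M] K by (simp_all add: hat_closed)
  have "eps H \<otimes>\<^bsub>QG\<^esub> hat K = ((hat H \<ominus>\<^bsub>QG\<^esub> hat M) \<otimes>\<^bsub>QG\<^esub> hat K) \<otimes>\<^bsub>QG\<^esub> u"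
    unfolding u(2) using cl u(1) by (simp add: QG.m_ac)
  then show ?thesis by (simp add: * u(2))
qed

text \<open>Since \<open>K <#> H\<close> lies strictly above \<open>H\<close>, there is a cover
  \<open>M\<close> inside it. Then \<open>K <#> M = K <#> H\<close>, and \<open>hat K\<close> kills
  the factor for \<open>M\<close>.\<close>

lemma eps_mult_hat_not_le:
  assumes H: "H \<in> L" and K: "K \<in> L" "\<not> K \<subseteq> H"
  shows "eps H \<otimes>\<^bsub>QG\<^esub> hat K = \<zero>\<^bsub>QG\<^esub>"
proof -
  have sub: "subgroup H G" "subgroup K G" using H K(1) by simp_all
  have False': "H \<noteq> carrier G" using K(2) subgroup.subset[OF sub(2)] by blast
  have "H \<subset> K <#> H" using set_mult_upper[OF sub(2,1)] K(2) by blast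
  then obtain M where M: "M \<in> covers L H" "M \<subseteq> K <#> H"
    using cover_exists[OF H L_mult[OF K(1) H]] by blast
  have M_in_L: "M \<in> L" "H \<subset> M" using M(1) covers_subset by blast+
  obtain u where u: "u \<in> carrier QG" "eps H = (hat H \<ominus>\<^bsub>QG\<^esub> hat M) \<otimes>\<^bsub>QG\<^esub> u"
    using eps_factor[OF H False' M(1)] .
  have "K <#> M = K <#> H"
  proof
    show "K <#> H \<subseteq> K <#> M" using M_in_L(2) unfolding set_mult_def by blast
    have KH: "subgroup (K <#> H) G" by (rule mult_subgroups[OF sub(2,1)])
    show "K <#> M \<subseteq> K <#> H"
    proof
      fix a assume "a \<in> K <#> M"
      then obtain k m where km: "k \<in> K" "m \<in> M" "a = k \<otimes> m" unfolding set_mult_def by blast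
      then have "k \<in> K <#> H" "m \<in> K <#> H" using set_mult_upper[OF sub(2,1)] M(2) by blast+
      then show "a \<in> K <#> H" using subgroup.m_closed[OF KH] km(3) by simp
    qed
  qed
  then have *: "(hat H \<ominus>\<^bsub>QG\<^esub> hat M) \<otimes>\<^bsub>QG\<^esub> hat K = \<zero>\<^bsub>QG\<^esub>"
    using factor_mult_hat[OF H M(1) K(1)] hat_closed[OF mult_subgroups[OF sub(2,1)]]
    by (simp add: QG.minus_eq QG.r_neg)
  have cl: "hat H \<ominus>\<^bsub>QG\<^esub> hat M \<in> carrier QG" "hat K \<in> carrier QG"
    using factor_closed[OF H M(1)] K by (simp_all add: hat_closed)
  have "eps H \<otimes>\<^bsub>QG\<^esub> hat K = ((hat H \<ominus>\<^bsub>QG\<^esub> hat M) \<otimes>\<^bsub>QG\<^esub> hat K) \<otimes>\<^bsub>QG\<^esub> u"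
    unfolding u(2) using cl u(1) by (simp add: QG.m_ac)
  then show ?thesis unfolding * using QG.l_null[OF u(1)] by simp
qed

text \<open>The factor for \<open>M\<close> sends \<open>hat K\<close> with
  \<open>H \<subseteq> K\<close> to \<open>hat K - hat (K <#> M)\<close>, and \<open>K <#> M\<close>
  contains \<open>M\<close> and so differs from \<open>H\<close>. The coefficient of
  \<open>hat H\<close> stays 1, which will make \<open>eps H\<close> nonzero.\<close>

lemma eps_expansion:
  assumes H: "H \<in> L"
  obtains c where "eps H = (\<lambda>a. \<Sum>K\<in>L. c K * hat K a)" "c H = 1"
proof -
  let ?t = "\<lambda>M. hat H \<ominus>\<^bsub>QG\<^esub> hat M"
  have t_closed: "?t N \<in> carrier QG" if "N \<in> covers L H" for N
    by (rule factor_closed[OF H that])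
  \<comment> \<open>The leading \<open>hat H\<close> makes the empty product a combination of hats.
    The last clause restricts the sum to \<open>K\<close> above \<open>H\<close>, where
    \<open>K <#> H = K\<close>.\<close>
  have expand: "\<exists>c. hat H \<otimes>\<^bsub>QG\<^esub> (\<Otimes>\<^bsub>QG\<^esub>M\<in>A. ?t M) = (\<lambda>a. \<Sum>K\<in>L. c K * hat K a)
      \<and> c H = 1 \<and> (\<forall>K\<in>L. \<not> H \<subseteq> K \<longrightarrow> c K = 0)" if "finite A" "A \<subseteq> covers L H" for A
    using that
  proof (induction A rule: finite_induct)
    case empty
    have "(\<lambda>a. \<Sum>K\<in>L. (if K = H then 1 else 0) * hat K a) = (hat H :: 'a \<Rightarrow> rat)"
      using H finite_L by (simp add: if_distrib[of "\<lambda>c. c * _"] cong: if_cong)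
    then show ?case
      using hat_closed[OF L_subgroup[OF H]] by (intro exI[of _ "\<lambda>K. if K = H then 1 else 0"]) simp
  next
    case (insert M A)
    have M: "M \<in> covers L H" "M \<in> L" "H \<subset> M" using insert.prems covers_subset by blast+
    have cl: "hat H \<in> carrier QG" "hat M \<in> carrier QG" "?t M \<in> carrier QG"
      using H M t_closed by (simp_all add: hat_closed)
    have t_fun: "?t \<in> A \<rightarrow> carrier QG" using t_closed insert.prems by blast
    then have prod_cl: "(\<Otimes>\<^bsub>QG\<^esub>M\<in>A. ?t M) \<in> carrier QG" by (rule QG.finprod_closed)
    obtain c where c: "hat H \<otimes>\<^bsub>QG\<^esub> (\<Otimes>\<^bsub>QG\<^esub>M\<in>A. ?t M) = (\<lambda>a. \<Sum>K\<in>L. c K * hat K a)"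
      "c H = 1" "\<forall>K\<in>L. \<not> H \<subseteq> K \<longrightarrow> c K = 0"
      using insert by auto
    have "hat H \<otimes>\<^bsub>QG\<^esub> (\<Otimes>\<^bsub>QG\<^esub>M\<in>insert M A. ?t M)
        = (hat H \<otimes>\<^bsub>QG\<^esub> (\<Otimes>\<^bsub>QG\<^esub>M\<in>A. ?t M)) \<otimes>\<^bsub>QG\<^esub> ?t M"
      using insert.hyps t_fun cl prod_cl by (simp add: QG.finprod_insert QG.m_ac)
    also have "\<dots> = (\<lambda>a. \<Sum>K\<in>L. c K * (hat K \<otimes>\<^bsub>QG\<^esub> ?t M) a)"
      unfolding c(1) by (rule mult_sum_left)
    also have "\<dots> = (\<lambda>a. \<Sum>K\<in>L. c K * (hat K a - hat (K <#> M) a))"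
    proof (intro ext sum.cong refl)
      fix a K assume K: "K \<in> L"
      show "c K * (hat K \<otimes>\<^bsub>QG\<^esub> ?t M) a = c K * (hat K a - hat (K <#> M) a)"
      proof (cases "H \<subseteq> K")
        case True
        have "hat K \<otimes>\<^bsub>QG\<^esub> ?t M = ?t M \<otimes>\<^bsub>QG\<^esub> hat K"
          using K cl by (intro QG.m_comm) (simp_all add: hat_closed)
        also have "\<dots> = hat (K <#> H) \<ominus>\<^bsub>QG\<^esub> hat (K <#> M)"
          by (rule factor_mult_hat[OF H M(1) K])
        also have "K <#> H = K"
          using True H K by (intro set_mult_absorb(2)) simp_all
        finally show ?thesis using minus_hat[OF K L_mult[OF K M(2)]] by simp
      qed (use c(3) K in simp)
    qed
    also have "\<dots> = (\<lambda>a. \<Sum>K\<in>L. (c K - (\<Sum>N\<in>{N \<in> L. N <#> M = K}. c N)) * hat K a)"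
    proof
      fix a
      have "(\<Sum>K\<in>L. c K * hat (K <#> M) a) = (\<Sum>K\<in>L. \<Sum>N\<in>{N \<in> L. N <#> M = K}. c N * hat (N <#> M) a)"
        using L_mult[OF _ M(2)] by (intro sum.group[OF finite_L finite_L, symmetric]) blast
      also have "\<dots> = (\<Sum>K\<in>L. (\<Sum>N\<in>{N \<in> L. N <#> M = K}. c N) * hat K a)"
        by (intro sum.cong refl) (simp add: sum_distrib_right)
      finally show "(\<Sum>K\<in>L. c K * (hat K a - hat (K <#> M) a))
          = (\<Sum>K\<in>L. (c K - (\<Sum>N\<in>{N \<in> L. N <#> M = K}. c N)) * hat K a)"
        by (simp add: right_diff_distrib left_diff_distrib sum_subtractf)
    qed
    finally have eq: "hat H \<otimes>\<^bsub>QG\<^esub> (\<Otimes>\<^bsub>QG\<^esub>M\<in>insert M A. ?t M)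
        = (\<lambda>a. \<Sum>K\<in>L. (c K - (\<Sum>N\<in>{N \<in> L. N <#> M = K}. c N)) * hat K a)" .
    have M_le: "M \<subseteq> N <#> M" if "N \<in> L" for N
      using set_mult_upper(2)[of N M] that M(2) by simp
    have empty: "{N \<in> L. N <#> M = K} = {}" if "\<not> M \<subseteq> K" for K
      using M_le that by blast
    have zero: "(\<Sum>N\<in>{N \<in> L. N <#> M = K}. c N) = 0" if "\<not> M \<subseteq> K" for K
      unfolding empty[OF that] by simp
    show ?case
    proof (intro exI[of _ "\<lambda>K. c K - (\<Sum>N\<in>{N \<in> L. N <#> M = K}. c N)"] conjI eq ballI impI)
      show "c H - (\<Sum>N\<in>{N \<in> L. N <#> M = H}. c N) = 1" using zero[of H] c(2) M(3) by (simp add: less_le_not_le)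
      fix K assume K: "K \<in> L" "\<not> H \<subseteq> K"
      then have "\<not> M \<subseteq> K" using M(3) by blast
      then show "c K - (\<Sum>N\<in>{N \<in> L. N <#> M = K}. c N) = 0" using zero[of K] c(3) K by simp
    qed
  qed
  show ?thesis
  proof (cases "H = carrier G")
    case True
    have "(\<lambda>a. \<Sum>K\<in>L. (if K = H then 1 else 0) * hat K a) = (hat H :: 'a \<Rightarrow> rat)"
      using H finite_L by (simp add: if_distrib[of "\<lambda>c. c * _"] cong: if_cong)
    then show ?thesis using True by (intro that[of "\<lambda>K. if K = H then 1 else 0"]) (simp_all add: schur_eps_def)
  next
    case False
    have "hat H \<otimes>\<^bsub>QG\<^esub> eps H = eps H"
      using eps_mult_hat_le[OF H H order_refl] QG.m_comm[OF hat_closed[OF L_subgroup[OF H]] eps_closed[OF H]]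
      by simp
    then show ?thesis
      using expand[OF finite_covers order_refl] that unfolding eps_eq[OF False, symmetric] by metis
  qed
qed

lemma eps_nonzero:
  assumes H: "H \<in> L"
  shows "eps H \<noteq> \<zero>\<^bsub>QG\<^esub>"
proof
  assume zero: "eps H = \<zero>\<^bsub>QG\<^esub>"
  obtain c where c: "eps H = (\<lambda>a. \<Sum>K\<in>L. c K * hat K a)" "c H = 1"
    using eps_expansion[OF H] .
  have sum0: "(\<Sum>K\<in>L. c K * hat K x) = 0" for x
    using zero unfolding c(1) QG_zero by (rule fun_cong)
  have "c H = 0" by (rule hat_independent[OF finite_L L_subgroup sum0 H])
  then show False using c(2) by simp
qed

lemma eps_in_S:
  assumes H: "H \<in> L"
  shows "eps H \<in> S"
proof -
  obtain c where c: "eps H = (\<lambda>a. \<Sum>K\<in>L. c K * hat K a)" using eps_expansion[OF H] by metis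
  show ?thesis unfolding c by (intro S_sum hat_in_S)
qed

lemma span_mult_eps:
  assumes H: "H \<in> L"
  shows "(\<lambda>a. \<Sum>K\<in>L. c K * hat K a) \<otimes>\<^bsub>QG\<^esub> eps H = (\<lambda>a. (\<Sum>K\<in>{K \<in> L. K \<subseteq> H}. c K) * eps H a)"
proof -
  have "(\<Sum>K\<in>L. c K * (hat K \<otimes>\<^bsub>QG\<^esub> eps H) a) = (\<Sum>K\<in>L. if K \<subseteq> H then c K * eps H a else 0)" for a
  proof (intro sum.cong refl)
    fix K assume K: "K \<in> L"
    have "hat K \<otimes>\<^bsub>QG\<^esub> eps H = eps H \<otimes>\<^bsub>QG\<^esub> hat K"
      using K hat_closed eps_closed[OF H] by (intro QG.m_comm) simp_all
    then show "c K * (hat K \<otimes>\<^bsub>QG\<^esub> eps H) a = (if K \<subseteq> H then c K * eps H a else 0)"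
      using eps_mult_hat_le[OF H K] eps_mult_hat_not_le[OF H K] by (simp add: QG_zero)
  qed
  moreover have "(\<Sum>K\<in>L. if K \<subseteq> H then c K * eps H a else 0) = (\<Sum>K\<in>{K \<in> L. K \<subseteq> H}. c K) * eps H a" for a
    unfolding sum_distrib_right by (rule sum.inter_filter[OF finite_L, symmetric])
  ultimately show ?thesis unfolding mult_sum_left by (simp only:)
qed

lemma eps_idempotent:
  assumes H: "H \<in> L"
  shows "eps H \<otimes>\<^bsub>QG\<^esub> eps H = eps H"
proof (cases "H = carrier G")
  case True
  then show ?thesis using eps_mult_hat_le[OF H H order_refl] by (simp add: schur_eps_def)
next
  case False
  let ?t = "\<lambda>M. hat H \<ominus>\<^bsub>QG\<^esub> hat M"
  have cl: "?t M \<in> carrier QG" if "M \<in> covers L H" for M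
    by (rule factor_closed[OF H that])
  have "?t M \<otimes>\<^bsub>QG\<^esub> ?t M = ?t M" if "M \<in> covers L H" for M
  proof -
    have M: "M \<in> L" "H \<subset> M" using that covers_subset by blast+
    have "hat H \<otimes>\<^bsub>QG\<^esub> hat H = hat H" "hat M \<otimes>\<^bsub>QG\<^esub> hat M = hat M" "hat H \<otimes>\<^bsub>QG\<^esub> hat M = hat M"
      using H M by (auto intro!: hat_mult_hat)
    moreover have clHM: "hat H \<in> carrier QG" "hat M \<in> carrier QG" using H M hat_closed by simp_all
    moreover have "?t M \<otimes>\<^bsub>QG\<^esub> ?t M = hat H \<otimes>\<^bsub>QG\<^esub> hat H \<ominus>\<^bsub>QG\<^esub> hat H \<otimes>\<^bsub>QG\<^esub> hat M
        \<ominus>\<^bsub>QG\<^esub> hat H \<otimes>\<^bsub>QG\<^esub> hat M \<oplus>\<^bsub>QG\<^esub> hat M \<otimes>\<^bsub>QG\<^esub> hat M"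
      using clHM by algebra
    ultimately show ?thesis using clHM by (simp add: QG_minus QG_add QG_carrier)
  qed
  then have "(\<Otimes>\<^bsub>QG\<^esub>M\<in>covers L H. ?t M \<otimes>\<^bsub>QG\<^esub> ?t M) = (\<Otimes>\<^bsub>QG\<^esub>M\<in>covers L H. ?t M)"
    using cl by (intro QG.finprod_cong') auto
  then show ?thesis
    using cl by (simp add: eps_eq[OF False] QG.finprod_multf Pi_def)
qed

section \<open>Primitivity and completeness\<close>

lemma idempotents_S: "idempotents (QG\<lparr>carrier := S\<rparr>) = {e \<in> S. e \<otimes>\<^bsub>QG\<^esub> e = e}"
  by (simp add: idempotents_def)

text \<open>\<open>eps H\<close> is an eigenvector of multiplication by \<open>e\<close>, and the
  eigenvalue \<open>s\<close> satisfies \<open>s * s = s\<close>.\<close>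

lemma idempotent_mult_eps:
  assumes e: "e \<in> S" "e \<otimes>\<^bsub>QG\<^esub> e = e" and H: "H \<in> L"
  shows "e \<otimes>\<^bsub>QG\<^esub> eps H = \<zero>\<^bsub>QG\<^esub> \<or> e \<otimes>\<^bsub>QG\<^esub> eps H = eps H"
proof -
  obtain c where c: "e = (\<lambda>a. \<Sum>K\<in>L. c K * hat K a)" using idempotent_in_span[OF e] .
  define s where "s = (\<Sum>K\<in>{K \<in> L. K \<subseteq> H}. c K)"
  have s: "e \<otimes>\<^bsub>QG\<^esub> eps H = (\<lambda>a. s * eps H a)"
    unfolding c s_def by (rule span_mult_eps[OF H])
  have "e \<otimes>\<^bsub>QG\<^esub> (e \<otimes>\<^bsub>QG\<^esub> eps H) = e \<otimes>\<^bsub>QG\<^esub> eps H"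
    using S_closed[OF e(1)] eps_closed[OF H] e(2) by (simp add: QG.m_assoc[symmetric])
  moreover have "e \<otimes>\<^bsub>QG\<^esub> (e \<otimes>\<^bsub>QG\<^esub> eps H) = (\<lambda>a. s * (s * eps H a))"
  proof -
    have "e \<otimes>\<^bsub>QG\<^esub> (\<lambda>a. s * eps H a) = (\<lambda>a. s * eps H a) \<otimes>\<^bsub>QG\<^esub> e"
      using S_closed[OF e(1)] eps_closed[OF H] by (intro QG.m_comm) (auto simp: QG_carrier)
    also have "\<dots> = (\<lambda>a. s * (eps H \<otimes>\<^bsub>QG\<^esub> e) a)" by (rule mult_scale_left)
    also have "eps H \<otimes>\<^bsub>QG\<^esub> e = (\<lambda>a. s * eps H a)"
      using s S_closed[OF e(1)] eps_closed[OF H] by (simp add: QG.m_comm)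
    finally show ?thesis by (simp add: s)
  qed
  ultimately have eq: "s * (s * eps H a) = s * eps H a" for a
    unfolding s by (metis (no_types))
  obtain a where a: "eps H a \<noteq> 0" using eps_nonzero[OF H] by (auto simp: QG_zero)
  have "s = 0 \<or> s = 1" using eq[of a] a by auto
  then show ?thesis by (auto simp: s QG_zero)
qed

text \<open>The eigenvalue of \<open>e\<close> at \<open>eps H\<close> is the sum of its
  coefficients over the \<open>K \<subseteq> H\<close>. If all these sums vanish, so do the
  coefficients, by induction along inclusion. This is the completeness of the
  \<open>eps H\<close>.\<close>

lemma idempotent_eq_zero:
  assumes e: "e \<in> S" "e \<otimes>\<^bsub>QG\<^esub> e = e" and zero: "\<And>H. H \<in> L \<Longrightarrow> e \<otimes>\<^bsub>QG\<^esub> eps H = \<zero>\<^bsub>QG\<^esub>"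
  shows "e = \<zero>\<^bsub>QG\<^esub>"
proof -
  obtain c where c: "e = (\<lambda>a. \<Sum>K\<in>L. c K * hat K a)" using idempotent_in_span[OF e] .
  have sum0: "(\<Sum>K\<in>{K \<in> L. K \<subseteq> H}. c K) = 0" if H: "H \<in> L" for H
  proof -
    obtain a where a: "eps H a \<noteq> 0" using eps_nonzero[OF H] by (auto simp: QG_zero)
    have "(\<lambda>a. (\<Sum>K\<in>{K \<in> L. K \<subseteq> H}. c K) * eps H a) = (\<lambda>a. 0)"
      using zero[OF H] span_mult_eps[OF H, of c] by (simp only: c QG_zero)
    then have "(\<Sum>K\<in>{K \<in> L. K \<subseteq> H}. c K) * eps H a = 0" by (rule fun_cong)
    then show ?thesis using a by simp
  qed
  have "c H = 0" if "H \<in> L" for H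
    using that
  proof (induction "card H" arbitrary: H rule: less_induct)
    case less
    have "c K = 0" if "K \<in> L" "K \<subset> H" for K
      using that less.prems subgroup_finite by (intro less.hyps psubset_card_mono) auto
    then have "(\<Sum>K\<in>{K \<in> L. K \<subseteq> H}. c K) = (\<Sum>K\<in>{K \<in> L. K \<subseteq> H}. if K = H then c H else 0)"
      by (intro sum.cong) auto
    then show ?case using sum0[OF less.prems] less.prems finite_L by simp
  qed
  then show ?thesis unfolding c QG_zero by (intro ext sum.neutral) auto
qed

lemma eps_primitive:
  assumes H: "H \<in> L"
  shows "primitive_idempotent (QG\<lparr>carrier := S\<rparr>) (eps H)"
proof -
  have "False" if f: "f \<in> S" "f \<otimes>\<^bsub>QG\<^esub> f = f" "f \<noteq> \<zero>\<^bsub>QG\<^esub>"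
    and h: "h \<in> S" "h \<otimes>\<^bsub>QG\<^esub> h = h" "h \<noteq> \<zero>\<^bsub>QG\<^esub>"
    and sum: "eps H = f \<oplus>\<^bsub>QG\<^esub> h" for f h
  proof -
    have cl: "f \<in> carrier QG" "h \<in> carrier QG" using f(1) h(1) S_closed by blast+
    have "(f \<oplus>\<^bsub>QG\<^esub> h) \<otimes>\<^bsub>QG\<^esub> (f \<oplus>\<^bsub>QG\<^esub> h) = f \<otimes>\<^bsub>QG\<^esub> f \<oplus>\<^bsub>QG\<^esub> h \<otimes>\<^bsub>QG\<^esub> h \<oplus>\<^bsub>QG\<^esub> (f \<otimes>\<^bsub>QG\<^esub> h \<oplus>\<^bsub>QG\<^esub> f \<otimes>\<^bsub>QG\<^esub> h)"
      using cl by algebra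
    then have "f \<oplus>\<^bsub>QG\<^esub> h = f \<oplus>\<^bsub>QG\<^esub> h \<oplus>\<^bsub>QG\<^esub> (f \<otimes>\<^bsub>QG\<^esub> h \<oplus>\<^bsub>QG\<^esub> f \<otimes>\<^bsub>QG\<^esub> h)"
      using eps_idempotent[OF H] f(2) h(2) by (simp only: sum)
    \<comment> \<open>The mixed terms add up to twice the product, which vanishes only if the
      product does, as the coefficients are rational.\<close>
    then have fh: "f \<otimes>\<^bsub>QG\<^esub> h = \<zero>\<^bsub>QG\<^esub>" by (auto simp: QG_add QG_zero fun_eq_iff)
    have "f \<otimes>\<^bsub>QG\<^esub> eps H = f" using cl f(2) fh by (simp add: sum QG.r_distr)
    then have "f = eps H" using idempotent_mult_eps[OF f(1,2) H] f(3) by auto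
    then have "h = \<zero>\<^bsub>QG\<^esub>" using sum by (auto simp: QG_add QG_zero fun_eq_iff)
    then show False using h(3) by simp
  qed
  then show ?thesis
    unfolding primitive_idempotent_def idempotents_S
    using eps_in_S[OF H] eps_idempotent[OF H] eps_nonzero[OF H] by auto
qed

text \<open>Being nonzero, \<open>e\<close> does not annihilate every \<open>eps H\<close>, so it
  fixes one of them. Then \<open>e\<close> is the sum of the idempotents \<open>eps H\<close> and
  \<open>e - eps H\<close>, and primitivity makes the second one zero.\<close>

lemma primitive_eq_eps:
  assumes "primitive_idempotent (QG\<lparr>carrier := S\<rparr>) e"
  obtains H where "H \<in> L" "e = eps H"
proof -
  have e: "e \<in> S" "e \<otimes>\<^bsub>QG\<^esub> e = e" "e \<noteq> \<zero>\<^bsub>QG\<^esub>"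
    and prim: "\<And>f h. f \<in> S \<Longrightarrow> f \<otimes>\<^bsub>QG\<^esub> f = f \<Longrightarrow> h \<in> S \<Longrightarrow> h \<otimes>\<^bsub>QG\<^esub> h = h \<Longrightarrow>
      f \<noteq> \<zero>\<^bsub>QG\<^esub> \<Longrightarrow> h \<noteq> \<zero>\<^bsub>QG\<^esub> \<Longrightarrow> e \<noteq> f \<oplus>\<^bsub>QG\<^esub> h"
    using assms unfolding primitive_idempotent_def idempotents_S by auto
  obtain H where H: "H \<in> L" "e \<otimes>\<^bsub>QG\<^esub> eps H = eps H"
    using idempotent_eq_zero[OF e(1,2)] idempotent_mult_eps[OF e(1,2)] e(3) by blast
  define h where "h = e \<ominus>\<^bsub>QG\<^esub> eps H"
  have cl: "e \<in> carrier QG" "eps H \<in> carrier QG" using S_closed[OF e(1)] eps_closed[OF H(1)] .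
  have h_eq: "h = (\<lambda>a. e a - eps H a)" unfolding h_def by (rule QG_minus[OF cl])
  have "h \<in> S" unfolding h_eq by (rule S_diff[OF e(1) eps_in_S[OF H(1)]])
  moreover have "h \<otimes>\<^bsub>QG\<^esub> h = h"
  proof -
    have "h \<otimes>\<^bsub>QG\<^esub> h = e \<otimes>\<^bsub>QG\<^esub> e \<ominus>\<^bsub>QG\<^esub> e \<otimes>\<^bsub>QG\<^esub> eps H \<ominus>\<^bsub>QG\<^esub> e \<otimes>\<^bsub>QG\<^esub> eps H \<oplus>\<^bsub>QG\<^esub> eps H \<otimes>\<^bsub>QG\<^esub> eps H"
      unfolding h_def using cl by algebra
    also have "\<dots> = e \<ominus>\<^bsub>QG\<^esub> eps H \<ominus>\<^bsub>QG\<^esub> eps H \<oplus>\<^bsub>QG\<^esub> eps H"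
      by (simp only: e(2) H(2) eps_idempotent[OF H(1)])
    also have "\<dots> = h" unfolding h_def using cl by algebra
    finally show ?thesis .
  qed
  moreover have "e = eps H \<oplus>\<^bsub>QG\<^esub> h" by (simp add: h_eq QG_add)
  ultimately have "h = \<zero>\<^bsub>QG\<^esub>"
    using prim[OF eps_in_S[OF H(1)] eps_idempotent[OF H(1)]] eps_nonzero[OF H(1)] by blast
  then have "e = eps H" using \<open>e = eps H \<oplus>\<^bsub>QG\<^esub> h\<close> cl by simp
  then show ?thesis using that H(1) by blast
qed

end

theorem theorem3p3:
  fixes G :: "('a, 'b) monoid_scheme" and S :: "('a \<Rightarrow> rat) set"
  assumes "group G" and "finite (carrier G)" and "cyclic_group G"
    and "schur_ring G S"
  shows "(\<forall>H. subgroup H G \<and> set_sum H \<in> S \<longrightarrow>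
              primitive_idempotent (group_algebra G\<lparr>carrier := S\<rparr>) (schur_eps G S H)) \<and>
         complete_set_of_primitive_idempotents (group_algebra G\<lparr>carrier := S\<rparr>)
           {schur_eps G S H | H. subgroup H G \<and> set_sum H \<in> S}"
proof -
  interpret group G by (rule assms(1))
  obtain g where g: "g \<in> carrier G" "carrier G = range (\<lambda>x::int. g [^]\<^bsub>G\<^esub> x)"
    using assms(3) cyclic_group by blast
  obtain P where P: "partition_on (carrier G) P" "{\<one>\<^bsub>G\<^esub>} \<in> P"
    "\<forall>C\<in>P. \<forall>D\<in>P. set_sum C \<otimes>\<^bsub>group_algebra G\<^esub> set_sum D \<in> (set_sum_span P :: ('a \<Rightarrow> rat) set)"
    and S: "S = set_sum_span P"
    using assms(4) unfolding schur_ring_def by blast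
  interpret cyclic_schur_ring G g P
    by unfold_locales (use assms(2) g P in blast)+
  have "e \<in> {schur_eps G S H | H. subgroup H G \<and> set_sum H \<in> S}
      \<longleftrightarrow> primitive_idempotent (group_algebra G\<lparr>carrier := S\<rparr>) e" for e
    using eps_primitive primitive_eq_eps unfolding S L_def by blast
  then show ?thesis
    unfolding complete_set_of_primitive_idempotents_def using eps_primitive unfolding S L_def by blast
qed

end
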